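(* Let $\Omega\subset\mathbb{C}^n$ be a smoothly bounded pseudoconvex Reinhardt domain and let $p\in b\Omega$ be a boundary point. Then the variety type of $b\Omega$ at $p$ is equal to the regular type of $b\Omega$ at $p$.
   Context: A domain $\Omega\subset\mathbb{C}^n$ is Reinhardt if $(e^{i\theta_1}z_1,\ldots,e^{i\theta_n}z_n)\in\Omega$ whenever $(z_1,\ldots,z_n)\in\Omega$ and $0\le\theta_j\le 2\pi$, $1\le j\le n$. "Smoothly bounded" means bounded with $C^\infty$ boundary $b\Omega$. Write $\Omega=\{z\in\mathbb{C}^n:\rho(z)<0\}$ with $\rho$ a smooth defining function ($\rho$ is real-valued and $C^\infty$ near $b\Omega$, $\rho=0$ on $b\Omega$, $d\rho\neq 0$ on $b\Omega$). Let $\Delta\subset\mathbb{C}$ be the unit disc. An analytic disc through $p$ is a nonconstant holomorphic map $f\colon\Delta\to\mathbb{C}^n$ with $f(0)=p$. For such $f$, $v(f)$ denotes the order of vanishing at $0$ of $f-p$ (the minimum over the components of $f-p$ of their orders of vanishing at $0$), and $v(\rho\circ f)\in\{1,2,\ldots\}\cup\{\infty\}$ denotes the order of vanishing at $0$ of the smooth function $\rho\circ f$, which is defined near $0$ (the order of the lowest-order nonzero term in its Taylor expansion at $0$ in $\zeta,\bar\zeta$, and $\infty$ if there is none). The variety type of $b\Omega$ at $p$ is $$\sup_f \frac{v(\rho\circ f)}{v(f)}\in[1,\infty],$$ the supremum taken over all analytic discs $f$ through $p$. The regular type of $b\Omega$ at $p$ is the same supremum taken only over the regular analytic discs through $p$,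 i.e. those with $f'(0)\neq 0$ (for which $v(f)=1$). These quantities do not depend on the choice of $\rho$. *)

theory Defs
  imports "HOL-Analysis.Analysis"
begin

text \<open>
  \<open>Ck_on k g S\<close> is meant for open \<open>S\<close>: all iterated directional derivatives of order less than
  \<open>k\<close> are Frechet differentiable on \<open>S\<close>, and those of order \<open>k\<close> are continuous. In finite
  dimensions this is the usual class \<open>C\<^sup>k\<close>.
\<close>

fun Ck_on :: "nat \<Rightarrow> ('a::real_normed_vector \<Rightarrow> 'b::real_normed_vector) \<Rightarrow> 'a set \<Rightarrow> bool" where
  "Ck_on 0 g S \<longleftrightarrow> continuous_on S g"
| "Ck_on (Suc k) g S \<longleftrightarrow>
     (\<forall>x\<in>S. g differentiable (at x)) \<and>
     (\<forall>v. Ck_on k (\<lambda>x. frechet_derivative g (at x) v) S)"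

definition smooth_on :: "'a::real_normed_vector set \<Rightarrow> ('a \<Rightarrow> 'b::real_normed_vector) \<Rightarrow> bool" where
  "smooth_on S g \<longleftrightarrow> (\<forall>k. Ck_on k g S)"

text \<open>
  Wirtinger derivatives \<open>\<partial>/\<partial>z = (\<partial>/\<partial>x - i \<partial>/\<partial>y)/2\<close> and \<open>\<partial>/\<partial>zbar = (\<partial>/\<partial>x + i \<partial>/\<partial>y)/2\<close>
  along the complex line parametrised by an embedding \<open>e\<close>: take \<open>e = axis j\<close> for the
  \<open>j\<close>-th coordinate of \<open>\<complex>\<^sup>n\<close>, and \<open>e = id\<close> for functions of one complex variable.
\<close>

definition wirt :: "(complex \<Rightarrow> 'a::real_normed_vector) \<Rightarrow> ('a \<Rightarrow> complex) \<Rightarrow> 'a \<Rightarrow> complex" where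
  "wirt e g x =
     (frechet_derivative g (at x) (e 1) - \<i> * frechet_derivative g (at x) (e \<i>)) / 2"

definition wirt_bar :: "(complex \<Rightarrow> 'a::real_normed_vector) \<Rightarrow> ('a \<Rightarrow> complex) \<Rightarrow> 'a \<Rightarrow> complex" where
  "wirt_bar e g x =
     (frechet_derivative g (at x) (e 1) + \<i> * frechet_derivative g (at x) (e \<i>)) / 2"

definition smooth_defining_function ::
    "(complex ^ 'n) set \<Rightarrow> (complex ^ 'n \<Rightarrow> real) \<Rightarrow> bool" where
  "smooth_defining_function \<Omega> \<rho> \<longleftrightarrow>
     \<Omega> = {z. \<rho> z < 0} \<and>
     (\<exists>U. open U \<and> frontier \<Omega> \<subseteq> U \<and> smooth_on U \<rho>) \<and>
     (\<forall>z\<in>frontier \<Omega>. \<rho> z = 0) \<and>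
     (\<forall>z\<in>frontier \<Omega>. frechet_derivative \<rho> (at z) \<noteq> (\<lambda>v. 0))"

definition smoothly_bounded_domain :: "(complex ^ 'n) set \<Rightarrow> bool" where
  "smoothly_bounded_domain \<Omega> \<longleftrightarrow>
     open \<Omega> \<and> connected \<Omega> \<and> \<Omega> \<noteq> {} \<and> bounded \<Omega> \<and> (\<exists>\<rho>. smooth_defining_function \<Omega> \<rho>)"

definition reinhardt :: "(complex ^ 'n) set \<Rightarrow> bool" where
  "reinhardt \<Omega> \<longleftrightarrow>
     (\<forall>z\<in>\<Omega>. \<forall>\<theta>::real ^ 'n. (\<forall>j. 0 \<le> \<theta> $ j \<and> \<theta> $ j \<le> 2 * pi) \<longrightarrow>
        (\<chi> j. exp (\<i> * complex_of_real (\<theta> $ j)) * z $ j) \<in> \<Omega>)"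

definition levi_form ::
    "(complex ^ 'n \<Rightarrow> real) \<Rightarrow> complex ^ 'n \<Rightarrow> complex ^ 'n \<Rightarrow> complex" where
  "levi_form \<rho> z t =
     (\<Sum>j\<in>UNIV. \<Sum>k\<in>UNIV.
        wirt (axis j) (wirt_bar (axis k) (\<lambda>w. complex_of_real (\<rho> w))) z * t $ j * cnj (t $ k))"

text \<open>
  Levi pseudoconvexity of a domain with smooth boundary: positive semidefiniteness of the Levi
  form on the complex tangent space at every boundary point. The condition does not depend on the
  choice of the defining function. The Levi form is Hermitian, so taking the real part only serves
  to compare it with 0.
\<close>

definition pseudoconvex :: "(complex ^ 'n) set \<Rightarrow> bool" where
  "pseudoconvex \<Omega> \<longleftrightarrow>
     (\<exists>\<rho>. smooth_defining_function \<Omega> \<rho> \<and>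
        (\<forall>z\<in>frontier \<Omega>. \<forall>t.
           (\<Sum>j\<in>UNIV. wirt (axis j) (\<lambda>w. complex_of_real (\<rho> w)) z * t $ j) = 0 \<longrightarrow>
           0 \<le> Re (levi_form \<rho> z t)))"

text \<open>Only the values of a disc on the open unit disc \<open>ball 0 1\<close> are relevant.\<close>

definition analytic_disc :: "complex ^ 'n \<Rightarrow> (complex \<Rightarrow> complex ^ 'n) \<Rightarrow> bool" where
  "analytic_disc p f \<longleftrightarrow>
     (\<forall>j. (\<lambda>\<zeta>. f \<zeta> $ j) holomorphic_on ball 0 1) \<and>
     \<not> f constant_on ball 0 1 \<and> f 0 = p"

definition regular_disc :: "complex ^ 'n \<Rightarrow> (complex \<Rightarrow> complex ^ 'n) \<Rightarrow> bool" where
  "regular_disc p f \<longleftrightarrow> analytic_disc p f \<and> (\<exists>j. deriv (\<lambda>\<zeta>. f \<zeta> $ j) 0 \<noteq> 0)"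

text \<open>In both orders of vanishing below, the infimum of the empty set is \<open>\<infinity>\<close>.\<close>

definition holo_order :: "(complex \<Rightarrow> complex) \<Rightarrow> enat" where
  "holo_order h = Inf {enat k | k. (deriv ^^ k) h 0 \<noteq> 0}"

definition disc_order :: "(complex \<Rightarrow> complex ^ 'n) \<Rightarrow> enat" where
  "disc_order f = (INF j. holo_order (\<lambda>\<zeta>. f \<zeta> $ j - f 0 $ j))"

text \<open>
  The Taylor coefficient of \<open>z\<^sup>a zbar\<^sup>b\<close> of \<open>u\<close> at 0 is the mixed Wirtinger derivative
  of order \<open>(a, b)\<close> at 0 divided by \<open>a! b!\<close>.
\<close>

definition smooth_order :: "(complex \<Rightarrow> real) \<Rightarrow> enat" where
  "smooth_order u =
     Inf {enat (a + b) | a b.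
       (wirt id ^^ a) ((wirt_bar id ^^ b) (\<lambda>\<zeta>. complex_of_real (u \<zeta>))) 0 \<noteq> 0}"

definition contact_ratio ::
    "(complex ^ 'n \<Rightarrow> real) \<Rightarrow> (complex \<Rightarrow> complex ^ 'n) \<Rightarrow> ereal" where
  "contact_ratio \<rho> f =
     ereal_of_enat (smooth_order (\<rho> \<circ> f)) / ereal_of_enat (disc_order f)"

definition variety_type :: "(complex ^ 'n \<Rightarrow> real) \<Rightarrow> complex ^ 'n \<Rightarrow> ereal" where
  "variety_type \<rho> p = (SUP f\<in>{f. analytic_disc p f}. contact_ratio \<rho> f)"

definition regular_type :: "(complex ^ 'n \<Rightarrow> real) \<Rightarrow> complex ^ 'n \<Rightarrow> ereal" where
  "regular_type \<rho> p = (SUP f\<in>{f. regular_disc p f}. contact_ratio \<rho> f)"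

end

theory Submission
  imports Defs "HOL-Complex_Analysis.Cauchy_Integral_Formula"
begin

text \<open>
  In the coordinates \<open>log \<bar>z\<^sub>j\<bar>\<close> a pseudoconvex Reinhardt domain is convex near \<open>p\<close> and, in the
  coordinates where \<open>p\<close> vanishes, closed under decreasing \<open>\<bar>z\<^sub>j\<bar>\<close>; moreover it lies on one side of its
  tangent plane at \<open>p\<close>. Let \<open>f\<close> be a disc through \<open>p\<close> with leading term \<open>\<beta> \<zeta>\<^sup>v\<close> and contact order at
  least \<open>m > v\<close>. Pushing \<open>f\<close> inwards by \<open>O(\<bar>\<zeta>\<bar>\<^sup>m)\<close> puts it into the domain. A weighted geometric mean
  of \<open>f\<close> over a circle of radius \<open>\<bar>\<sigma>\<bar>\<close>, with the weights \<open>1 + cos\<close> that isolate the \<open>v\<close>-th Taylor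
  coefficient of \<open>log f\<^sub>j\<close>, then also lies in the domain; up to \<open>O(\<bar>\<sigma>\<bar>\<^sup>m)\<close> it can be chosen to be the
  point \<open>g(\<sigma>\<^sup>v)\<close> of the regular disc \<open>g\<close> with components \<open>p\<^sub>j exp (\<beta>\<^sub>j \<zeta> / (2 p\<^sub>j))\<close> or \<open>\<beta>\<^sub>j \<zeta> / 2\<close>.
  This bounds \<open>\<rho> \<circ> g\<close> from above. Since \<open>m > v\<close>, the disc \<open>g\<close> stays in the tangent plane, hence
  outside the domain, so \<open>\<rho> \<circ> g \<ge> 0\<close>. Thus \<open>g\<close> has contact order at least \<open>m / v\<close>.
\<close>

section \<open>Iterated Frechet differentiability\<close>

text \<open>The obstacle is that a disc vanishing to order v > 1 cannot in general be
  reparametrised: its higher coefficients mix with the leading one. Averaging over the (m + v)-th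
  roots of unity removes them: below degree m only the exponents 0 and v survive, so the mean
  depends on \<sigma>^v alone up to the error. A mean stays in a convex set only if its weights are
  nonnegative; the filter 1 + cos has this property, and it passes the v-th coefficient with the
  factor 1/2, which is the 1/2 in the exponent of g. In the coordinates where p vanishes, log f_j is
  singular at 0 and has no Taylor expansion. Closure under decreasing moduli asks there only for a
  point below the mean, so the lower bound |f_j| \<ge> |\<beta>_j| |\<sigma>|^v / 2 suffices, and
  this other 1/2 is merely a margin. Convexity alone gives one-sided information on \<rho> o g,
  hence the second inequality from the tangent plane. As \<rho>(g(\<sigma>^v)) is bounded by a
  multiple of |\<sigma>|^m and m / v need not be an integer, the estimate is kept in the form
  |\<rho> o g|^v \<le> C |\<zeta>|^m.\<close>

abbreviation fderiv :: "('a::real_normed_vector \<Rightarrow> 'b::real_normed_vector) \<Rightarrow> 'a \<Rightarrow> 'a \<Rightarrow> 'b" where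
  "fderiv g x \<equiv> frechet_derivative g (at x)"

lemma Ck_on_cong:
  assumes "open S" "Ck_on k g S" "\<And>x. x \<in> S \<Longrightarrow> g x = h x"
  shows "Ck_on k h S"
  using assms(2,3)
proof (induction k arbitrary: g h)
  case 0
  then show ?case by (simp cong: continuous_on_cong)
next
  case (Suc k)
  have diff: "h differentiable at x" if "x \<in> S" for x
    using Suc.prems that
    by (metis Ck_on.simps(2) assms(1) differentiable_def has_derivative_transform_within_open)
  have "fderiv g x v = fderiv h x v" if "x \<in> S" for x v
    using frechet_derivative_transform_within_open[of g x S h] Suc.prems assms(1) that by auto
  then have "Ck_on k (\<lambda>x. fderiv h x v) S" for v
    using Suc.IH Suc.prems(1) by (metis (mono_tags, lifting) Ck_on.simps(2))
  with diff show ?case by simp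
qed

lemma Ck_on_SucI:
  assumes "open S" "\<And>x. x \<in> S \<Longrightarrow> (g has_derivative g' x) (at x)"
    and "\<And>v. Ck_on k (\<lambda>x. g' x v) S"
  shows "Ck_on (Suc k) g S"
proof -
  have "g' x v = fderiv g x v" if "x \<in> S" for x v
    using frechet_derivative_at[OF assms(2)[OF that]] by simp
  then have "Ck_on k (\<lambda>x. fderiv g x v) S" for v
    using Ck_on_cong[OF assms(1) assms(3)[of v], of "\<lambda>x. fderiv g x v"] by simp
  then show ?thesis
    using assms(2) by (auto simp: differentiable_def)
qed

lemma Ck_on_has_derivative:
  assumes "Ck_on (Suc k) g S" "x \<in> S"
  shows "(g has_derivative fderiv g x) (at x)"
  using assms frechet_derivative_works by auto

lemma Ck_on_continuous:
  assumes "Ck_on k g S"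
  shows "continuous_on S g"
proof (cases k)
  case (Suc j)
  then have "\<forall>x\<in>S. g differentiable at x"
    using assms by simp
  then show ?thesis
    by (meson continuous_at_imp_continuous_on differentiable_imp_continuous_within)
qed (use assms in simp)

lemma Ck_on_SucD: "Ck_on (Suc k) g S \<Longrightarrow> Ck_on k g S"
proof (induction k arbitrary: g)
  case 0
  then show ?case using Ck_on_continuous by (metis Ck_on.simps(1))
qed auto

lemma Ck_on_const: "Ck_on k (\<lambda>x. c) S"
  by (induction k arbitrary: c) auto

lemma Ck_on_add:
  assumes "open S" "Ck_on k f S" "Ck_on k g S"
  shows "Ck_on k (\<lambda>x. f x + g x) S"
  using assms(2,3)
proof (induction k arbitrary: f g)
  case 0
  then show ?case by (simp add: continuous_on_add)
next
  case (Suc k)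
  show ?case
    by (rule Ck_on_SucI[where g' = "\<lambda>x v. fderiv f x v + fderiv g x v"])
      (use Suc assms(1) in \<open>auto intro!: has_derivative_add simp: frechet_derivative_works[symmetric]\<close>)
qed

lemma Ck_on_sum:
  assumes "open S" "\<And>i. i \<in> I \<Longrightarrow> Ck_on k (f i) S"
  shows "Ck_on k (\<lambda>x. \<Sum>i\<in>I. f i x) S"
  using assms(2) by (induction I rule: infinite_finite_induct) (auto intro: Ck_on_const Ck_on_add[OF assms(1)])

lemma Ck_on_bounded_linear:
  assumes "bounded_linear L" "open S" "Ck_on k f S"
  shows "Ck_on k (\<lambda>x. L (f x)) S"
  using assms(3)
proof (induction k arbitrary: f)
  case 0
  then show ?case
    using assms(1) by (simp add: linear_continuous_on_compose bounded_linear.continuous_on)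
next
  case (Suc k)
  show ?case
    by (rule Ck_on_SucI[where g' = "\<lambda>x v. L (fderiv f x v)"])
      (use Suc assms(1,2) in \<open>auto intro!: bounded_linear.has_derivative[OF assms(1)] simp: frechet_derivative_works[symmetric]\<close>)
qed

lemma Ck_on_bilinear:
  assumes "bounded_bilinear pr" "open S" "Ck_on k f S" "Ck_on k g S"
  shows "Ck_on k (\<lambda>x. pr (f x) (g x)) S"
  using assms(3,4)
proof (induction k arbitrary: f g)
  case 0
  then show ?case
    using bounded_bilinear.continuous_on[OF assms(1)] by simp
next
  case (Suc k)
  have f: "Ck_on k f S" and g: "Ck_on k g S"
    using Suc.prems Ck_on_SucD by blast+
  show ?case
  proof (rule Ck_on_SucI[where g' = "\<lambda>x v. pr (f x) (fderiv g x v) + pr (fderiv f x v) (g x)"])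
    show "((\<lambda>x. pr (f x) (g x)) has_derivative
      (\<lambda>v. pr (f x) (fderiv g x v) + pr (fderiv f x v) (g x))) (at x)"
      if "x \<in> S" for x
      using bounded_bilinear.FDERIV[OF assms(1) Ck_on_has_derivative[OF Suc.prems(1) that] Ck_on_has_derivative[OF Suc.prems(2) that]] .
    show "Ck_on k (\<lambda>x. pr (f x) (fderiv g x v) + pr (fderiv f x v) (g x)) S" for v
      using Suc f g by (intro Ck_on_add assms(2) Suc.IH) auto
  qed (rule assms(2))
qed

text \<open>Expanding the derivative of \<rho> at f x in \<open>Basis\<close> turns the chain rule
  into a finite sum of products, each of a component of the derivative of f with a directional
  derivative of \<rho> along f. The induction hypothesis applies to the latter, hence the
  generalisation over \<rho> with f fixed.\<close>

lemma Ck_on_compose: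
  fixes \<rho> :: "'a::euclidean_space \<Rightarrow> 'b::real_normed_vector"
  assumes "open S" "Ck_on k \<rho> T" "Ck_on k f S" "f ` S \<subseteq> T"
  shows "Ck_on k (\<lambda>x. \<rho> (f x)) S"
  using assms(2,3)
proof (induction k arbitrary: \<rho>)
  case 0
  then show ?case using assms(4)
    by (auto intro: continuous_on_compose2)
next
  case (Suc k)
  have f: "Ck_on k f S"
    using Suc.prems Ck_on_SucD by blast
  show ?case
  proof (rule Ck_on_SucI[where g' = "\<lambda>x v. \<Sum>b\<in>Basis. (fderiv f x v \<bullet> b) *\<^sub>R fderiv \<rho> (f x) b"])
    show "((\<lambda>x. \<rho> (f x)) has_derivative
      (\<lambda>v. \<Sum>b\<in>Basis. (fderiv f x v \<bullet> b) *\<^sub>R fderiv \<rho> (f x) b)) (at x)"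
      if "x \<in> S" for x
    proof -
      have D: "(\<rho> has_derivative fderiv \<rho> (f x)) (at (f x))"
        using Ck_on_has_derivative[OF Suc.prems(1)] that assms(4) by blast
      have lin: "linear (fderiv \<rho> (f x))"
        using D has_derivative_linear by blast
      have eq: "fderiv \<rho> (f x) w
          = (\<Sum>b\<in>Basis. (w \<bullet> b) *\<^sub>R fderiv \<rho> (f x) b)" for w
        using linear_sum[OF lin] linear_scale[OF lin] euclidean_representation[of w]
        by (metis (no_types, lifting) sum.cong)
      show ?thesis
        using has_derivative_compose[OF Ck_on_has_derivative[OF Suc.prems(2) that] D]
        unfolding eq[of "fderiv f x _"] .
    qed
    have "bounded_linear (\<lambda>w. w \<bullet> b)" for b :: 'a
      by (rule bounded_linear_inner_left)
    then show "Ck_on k (\<lambda>x. \<Sum>b\<in>Basis. (fderiv f x v \<bullet> b) *\<^sub>R fderiv \<rho> (f x) b) S" for v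
      using Suc f
      by (intro Ck_on_sum Ck_on_bilinear[OF bounded_bilinear_scaleR] assms(1)
            Ck_on_bounded_linear[where L="\<lambda>w. w \<bullet> _"]) auto
  qed (rule assms(1))
qed

lemma Ck_on_subset: "Ck_on k g S \<Longrightarrow> T \<subseteq> S \<Longrightarrow> Ck_on k g T"
  by (induction k arbitrary: g) (auto intro: continuous_on_subset)

lemma Ck_on_holomorphic:
  assumes "open S" "f holomorphic_on S"
  shows "Ck_on k f S"
  using assms(2)
proof (induction k arbitrary: f)
  case 0
  then show ?case by (simp add: holomorphic_on_imp_continuous_on)
next
  case (Suc k)
  have "(f has_derivative (\<lambda>v. deriv f x * v)) (at x)" if "x \<in> S" for x
    using Suc.prems assms(1) that by (metis has_field_derivative_def holomorphic_derivI)
  moreover have "Ck_on k (\<lambda>x. deriv f x * v) S" for v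
    by (rule Ck_on_bounded_linear[OF bounded_linear_mult_left])
      (use Suc assms(1) in \<open>auto intro: holomorphic_deriv\<close>)
  ultimately show ?case
    using Ck_on_SucI[OF assms(1), of f "\<lambda>x v. deriv f x * v"] by blast
qed

lemma bounded_linear_axis: "bounded_linear (\<lambda>w :: complex. axis j w :: complex ^ 'n)"
  by (auto intro!: linearI simp: axis_def vec_eq_iff linear_conv_bounded_linear[symmetric])

lemma sum_axis: "(\<Sum>j\<in>UNIV. axis j (z $ j)) = (z :: complex ^ 'n)"
  by (simp add: vec_eq_iff axis_def if_distrib[where f="\<lambda>g. g $ _"] cong: if_cong)

lemma Ck_on_holomorphic_vec:
  fixes f :: "complex \<Rightarrow> complex ^ 'n"
  assumes "open S" "\<And>j. (\<lambda>z. f z $ j) holomorphic_on S"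
  shows "Ck_on k f S"
proof -
  have "Ck_on k (\<lambda>z. \<Sum>j\<in>UNIV. axis j (f z $ j)) S"
    using assms by (intro Ck_on_sum Ck_on_bounded_linear[OF bounded_linear_axis] Ck_on_holomorphic)
  then show ?thesis by (simp add: sum_axis)
qed

section \<open>Restriction to lines and symmetry of second derivatives\<close>

lemma has_vector_derivative_along_line:
  assumes "(g has_derivative D) (at (a + s *\<^sub>R w))"
  shows "((\<lambda>s. g (a + s *\<^sub>R w)) has_vector_derivative D w) (at s)"
proof -
  have "((\<lambda>s. a + s *\<^sub>R w) has_derivative (\<lambda>u. u *\<^sub>R w)) (at s)"
    by (auto intro!: derivative_eq_intros)
  from has_derivative_compose[OF this assms] show ?thesis
    using linear_scale[OF has_derivative_linear[OF assms]] by (simp add: has_vector_derivative_def)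
qed

text \<open>Both iterated derivatives occur as intermediate values of the same second difference.\<close>

lemma second_difference_mvt:
  fixes g :: "'a::real_normed_vector \<Rightarrow> real"
  assumes ball: "\<And>y. norm (y - x) \<le> h * (norm v + norm w) \<Longrightarrow> y \<in> S"
    and C: "Ck_on 2 g S" and h: "0 < h"
  shows "\<exists>y. norm (y - x) \<le> h * (norm v + norm w) \<and>
    g (x + h *\<^sub>R v + h *\<^sub>R w) - g (x + h *\<^sub>R v) - g (x + h *\<^sub>R w) + g x =
    h * h * fderiv (\<lambda>y. fderiv g y v) y w"
proof -
  have dist: "norm ((x + s *\<^sub>R v + t *\<^sub>R w) - x) \<le> h * (norm v + norm w)"
    if "0 \<le> s" "s \<le> h" "0 \<le> t" "t \<le> h" for s t
  proof -
    have "norm ((x + s *\<^sub>R v + t *\<^sub>R w) - x) \<le> s * norm v + t * norm w"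
      using norm_triangle_ineq[of "s *\<^sub>R v" "t *\<^sub>R w"] that by (simp add: add.assoc)
    also have "\<dots> \<le> h * norm v + h * norm w"
      using that by (intro add_mono mult_right_mono) auto
    finally show ?thesis by (simp add: algebra_simps)
  qed
  have inS: "x + s *\<^sub>R v + t *\<^sub>R w \<in> S" if "0 \<le> s" "s \<le> h" "0 \<le> t" "t \<le> h" for s t
    using dist[OF that] ball by blast
  have C': "Ck_on (Suc (Suc 0)) g S" and C'': "Ck_on (Suc 0) (\<lambda>y. fderiv g y v) S"
    using C by (simp_all add: numeral_2_eq_2)
  \<comment> \<open>The mean value theorem is applied to the increment in direction w as a function
    of the step in direction v, and afterwards in direction w. Writing \<open>0 *\<^sub>R w\<close>
    lets one derivative formula serve both terms.\<close>
  have "\<exists>\<xi>. 0 < \<xi> \<and> \<xi> < h \<and>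
      (g (x + h *\<^sub>R v + h *\<^sub>R w) - g (x + h *\<^sub>R v + 0 *\<^sub>R w)) - (g (x + 0 *\<^sub>R v + h *\<^sub>R w) - g (x + 0 *\<^sub>R v + 0 *\<^sub>R w)) =
      (h - 0) * (fderiv g (x + \<xi> *\<^sub>R v + h *\<^sub>R w) v - fderiv g (x + \<xi> *\<^sub>R v + 0 *\<^sub>R w) v)"
  proof (rule MVT2[OF h])
    fix s assume s: "0 \<le> s" "s \<le> h"
    have "((\<lambda>s. g (x + s *\<^sub>R v + t *\<^sub>R w)) has_field_derivative fderiv g (x + s *\<^sub>R v + t *\<^sub>R w) v) (at s)"
      if "0 \<le> t" "t \<le> h" for t
    proof -
      have D: "(g has_derivative fderiv g (x + s *\<^sub>R v + t *\<^sub>R w)) (at (x + s *\<^sub>R v + t *\<^sub>R w))"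
        using Ck_on_has_derivative[OF C' inS[OF s that]] .
      then have "(g has_derivative fderiv g (x + s *\<^sub>R v + t *\<^sub>R w)) (at ((x + t *\<^sub>R w) + s *\<^sub>R v))"
        by (simp add: algebra_simps)
      from has_vector_derivative_along_line[OF this] show ?thesis
        by (simp add: has_real_derivative_iff_has_vector_derivative algebra_simps)
    qed
    from DERIV_diff[OF this[of h] this[of 0]] h
    show "((\<lambda>s. g (x + s *\<^sub>R v + h *\<^sub>R w) - g (x + s *\<^sub>R v + 0 *\<^sub>R w)) has_field_derivative
      fderiv g (x + s *\<^sub>R v + h *\<^sub>R w) v - fderiv g (x + s *\<^sub>R v + 0 *\<^sub>R w) v) (at s)"
      by simp
  qed
  then obtain \<xi> where \<xi>: "0 < \<xi>" "\<xi> < h" and eq1: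
    "g (x + h *\<^sub>R v + h *\<^sub>R w) - g (x + h *\<^sub>R v) - g (x + h *\<^sub>R w) + g x =
      h * (fderiv g (x + \<xi> *\<^sub>R v + h *\<^sub>R w) v - fderiv g (x + \<xi> *\<^sub>R v) v)"
    by (auto simp: diff_diff_eq2 diff_add_eq)
  let ?G = "\<lambda>y. fderiv g y v"
  have "\<exists>H. 0 < H \<and> H < h \<and>
      ?G (x + \<xi> *\<^sub>R v + h *\<^sub>R w) - ?G (x + \<xi> *\<^sub>R v + 0 *\<^sub>R w) =
      (h - 0) * fderiv ?G (x + \<xi> *\<^sub>R v + H *\<^sub>R w) w"
  proof (rule MVT2[OF h])
    fix t assume t: "0 \<le> t" "t \<le> h"
    have D: "(?G has_derivative fderiv ?G (x + \<xi> *\<^sub>R v + t *\<^sub>R w)) (at (x + \<xi> *\<^sub>R v + t *\<^sub>R w))"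
      by (rule Ck_on_has_derivative[OF C'' inS]) (use \<xi> t in auto)
    from has_vector_derivative_along_line[OF D]
    show "((\<lambda>t. ?G (x + \<xi> *\<^sub>R v + t *\<^sub>R w)) has_field_derivative fderiv ?G (x + \<xi> *\<^sub>R v + t *\<^sub>R w) w) (at t)"
      by (simp add: has_real_derivative_iff_has_vector_derivative)
  qed
  then obtain H where H: "0 < H" "H < h" and eq2:
    "?G (x + \<xi> *\<^sub>R v + h *\<^sub>R w) - ?G (x + \<xi> *\<^sub>R v) = h * fderiv ?G (x + \<xi> *\<^sub>R v + H *\<^sub>R w) w"
    by auto
  show ?thesis
    using dist[of \<xi> H] \<xi> H eq1 eq2
    by (intro exI[of _ "x + \<xi> *\<^sub>R v + H *\<^sub>R w"]) auto
qed

lemma second_derivative_symmetric_real: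
  fixes g :: "'a::real_normed_vector \<Rightarrow> real"
  assumes "open S" "x \<in> S" and C: "Ck_on 2 g S"
  shows "fderiv (\<lambda>y. fderiv g y v) x w =
         fderiv (\<lambda>y. fderiv g y w) x v"
proof -
  define A where "A = (\<lambda>y. fderiv (\<lambda>y. fderiv g y v) y w)"
  define B where "B = (\<lambda>y. fderiv (\<lambda>y. fderiv g y w) y v)"
  have cont: "isCont A x" "isCont B x"
    using C assms(1,2) by (auto simp: numeral_2_eq_2 A_def B_def continuous_on_eq_continuous_at)
  have "\<bar>A x - B x\<bar> \<le> e" if "0 < e" for e
  proof -
    obtain d1 where d1: "0 < d1" "\<And>y. norm (y - x) < d1 \<Longrightarrow> \<bar>A y - A x\<bar> < e / 2"
      using cont(1)[unfolded continuous_at_eps_delta, rule_format, of "e / 2"] \<open>0 < e\<close>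
      by (auto simp: dist_norm)
    obtain d2 where d2: "0 < d2" "\<And>y. norm (y - x) < d2 \<Longrightarrow> \<bar>B y - B x\<bar> < e / 2"
      using cont(2)[unfolded continuous_at_eps_delta, rule_format, of "e / 2"] \<open>0 < e\<close>
      by (auto simp: dist_norm)
    obtain d3 where d3: "0 < d3" "\<And>y. norm (y - x) < d3 \<Longrightarrow> y \<in> S"
      using assms(1,2) by (metis dist_commute dist_norm mem_ball openE subsetD)
    \<comment> \<open>The summand 1 gives the strict bound below and covers v = w = 0.\<close>
    define h where "h = min d1 (min d2 d3) / (norm v + norm w + 1)"
    have h: "0 < h" using d1 d2 d3 by (simp add: h_def add_nonneg_pos)
    have "h * (norm v + norm w) < h * (norm v + norm w + 1)"
      using h by simp
    also have "\<dots> = min d1 (min d2 d3)"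
      using add_nonneg_pos[of "norm v + norm w" 1] by (simp add: h_def)
    finally have hs: "h * (norm v + norm w) < min d1 (min d2 d3)" .
    have sub: "\<And>y. norm (y - x) \<le> h * (norm v + norm w) \<Longrightarrow> y \<in> S"
      using d3 hs by force
    obtain y1 where y1: "norm (y1 - x) \<le> h * (norm v + norm w)"
      "g (x + h *\<^sub>R v + h *\<^sub>R w) - g (x + h *\<^sub>R v) - g (x + h *\<^sub>R w) + g x = h * h * A y1"
      using second_difference_mvt[OF sub C h] unfolding A_def by blast
    have sub': "\<And>y. norm (y - x) \<le> h * (norm w + norm v) \<Longrightarrow> y \<in> S"
      using sub by (simp add: add.commute)
    obtain y2 where y2: "norm (y2 - x) \<le> h * (norm w + norm v)"
      "g (x + h *\<^sub>R w + h *\<^sub>R v) - g (x + h *\<^sub>R w) - g (x + h *\<^sub>R v) + g x = h * h * B y2"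
      using second_difference_mvt[OF sub' C h] unfolding B_def by blast
    have "x + h *\<^sub>R w + h *\<^sub>R v = x + h *\<^sub>R v + h *\<^sub>R w"
      by (simp add: add.assoc add.commute[of "h *\<^sub>R w"])
    note y2' = y2(2)[unfolded this]
    have "h * h * A y1 = h * h * B y2"
      using y1(2) y2' by linarith
    then have "A y1 = B y2" using h by simp
    moreover have "\<bar>A y1 - A x\<bar> < e / 2" using d1(2) y1 hs by force
    moreover have "\<bar>B y2 - B x\<bar> < e / 2" using d2(2)[of y2] y2 hs by (simp add: add.commute)
    ultimately show ?thesis by linarith
  qed
  then have "A x = B x"
    using field_le_epsilon[of "\<bar>A x - B x\<bar>" 0] by simp
  then show ?thesis by (simp add: A_def B_def)
qed

text \<open>Pairing with a fixed vector b commutes with both differentiations and reduces to the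
  real-valued case. Complex-valued functions are the intended application.\<close>

lemma second_derivative_symmetric:
  fixes g :: "'a::real_normed_vector \<Rightarrow> 'b::real_inner"
  assumes "open S" "x \<in> S" and C: "Ck_on 2 g S"
  shows "fderiv (\<lambda>y. fderiv g y v) x w =
         fderiv (\<lambda>y. fderiv g y w) x v"
proof -
  have inner: "fderiv (\<lambda>y. G y \<bullet> b) y u = fderiv G y u \<bullet> b"
    if "G differentiable at y" for b :: 'b and G :: "'a \<Rightarrow> 'b" and y u
    using frechet_derivative_at[OF bounded_linear.has_derivative[OF bounded_linear_inner_left
          that[unfolded frechet_derivative_works]], of b] by (metis (no_types, lifting))
  have D2: "fderiv (\<lambda>y. fderiv (\<lambda>y. g y \<bullet> b) y v) x w =
      fderiv (\<lambda>y. fderiv g y v) x w \<bullet> b" for b v w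
  proof -
    have "fderiv (\<lambda>y. fderiv (\<lambda>y. g y \<bullet> b) y v) x
        = fderiv (\<lambda>y. fderiv g y v \<bullet> b) x"
    proof (rule frechet_derivative_transform_within_open[symmetric])
      have "(\<lambda>y. fderiv g y v) differentiable at x"
        using C assms(2) by (simp add: numeral_2_eq_2)
      then show "(\<lambda>y. fderiv g y v \<bullet> b) differentiable at x"
        by simp
      show "fderiv g y v \<bullet> b = fderiv (\<lambda>y. g y \<bullet> b) y v" if "y \<in> S" for y
        using inner[of g y b v] C that by (simp add: numeral_2_eq_2)
    qed (use assms in auto)
    then show ?thesis
      using inner[of "\<lambda>y. fderiv g y v" x b w] C assms(2)
      by (simp add: numeral_2_eq_2)
  qed
  have "Ck_on 2 (\<lambda>y. g y \<bullet> b) S" for b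
    using Ck_on_bounded_linear[OF bounded_linear_inner_left assms(1) C] .
  then have "fderiv (\<lambda>y. fderiv g y v) x w \<bullet> b =
      fderiv (\<lambda>y. fderiv g y w) x v \<bullet> b" for b
    using second_derivative_symmetric_real[OF assms(1,2), of "\<lambda>y. g y \<bullet> b" v w] D2 by simp
  then show ?thesis
    by (metis vector_eq_rdot)
qed

section \<open>Orders of vanishing and Taylor expansion along lines\<close>

lemma smooth_on_Ck: "smooth_on S g \<Longrightarrow> Ck_on k g S"
  by (simp add: smooth_on_def)

lemma smooth_on_has_derivative:
  assumes "smooth_on S g" "x \<in> S"
  shows "(g has_derivative fderiv g x) (at x)"
  using Ck_on_has_derivative assms smooth_on_Ck by blast

lemma smooth_on_frechet:
  assumes "smooth_on S g"
  shows "smooth_on S (\<lambda>x. fderiv g x v)"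
  using assms unfolding smooth_on_def by (metis Ck_on.simps(2))

lemma bounded_linear_half_times: "bounded_linear (\<lambda>z :: complex. c * z / 2)"
  using bounded_linear_compose[OF bounded_linear_divide bounded_linear_mult_right] .

lemma smooth_on_lincomb:
  fixes f g :: "'a::real_normed_vector \<Rightarrow> complex"
  assumes "open S" "smooth_on S f" "smooth_on S g"
  shows "smooth_on S (\<lambda>x. (f x + c * g x) / 2)"
proof -
  have "Ck_on k (\<lambda>x. 1 * f x / 2 + c * g x / 2) S" for k
    using assms smooth_on_Ck
    by (intro Ck_on_add Ck_on_bounded_linear[OF bounded_linear_half_times]) auto
  then show ?thesis
    by (simp add: smooth_on_def add_divide_distrib)
qed

lemma smooth_on_wirt:
  assumes "open S" "smooth_on S g"
  shows "smooth_on S (wirt id g)" "smooth_on S (wirt_bar id g)"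
  using smooth_on_lincomb[OF assms(1) smooth_on_frechet[OF assms(2)] smooth_on_frechet[OF assms(2)], of 1 "-\<i>" \<i>]
    smooth_on_lincomb[OF assms(1) smooth_on_frechet[OF assms(2)] smooth_on_frechet[OF assms(2)], of 1 "\<i>" \<i>]
  unfolding wirt_def[abs_def] wirt_bar_def[abs_def] by simp_all

lemma wirt_cong:
  assumes "open S" "smooth_on S g" "\<And>y. y \<in> S \<Longrightarrow> g y = h y" "x \<in> S"
  shows "wirt id g x = wirt id h x"
proof -
  have "fderiv g x = fderiv h x"
    using assms smooth_on_has_derivative[OF assms(2,4)]
    by (intro frechet_derivative_transform_within_open[where X=S]) (auto intro: differentiableI)
  then show ?thesis by (simp add: wirt_def)
qed

lemma frechet_derivative_lincomb:
  fixes f g :: "'a::real_normed_vector \<Rightarrow> complex"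
  assumes "smooth_on S f" "smooth_on S g" "x \<in> S"
  shows "fderiv (\<lambda>x. (f x + c * g x) / 2) x v
    = (fderiv f x v + c * fderiv g x v) / 2"
proof -
  have "((\<lambda>x. f x + c * g x) has_derivative
     (\<lambda>v. fderiv f x v + c * fderiv g x v)) (at x)"
    using smooth_on_has_derivative[OF assms(1,3)] smooth_on_has_derivative[OF assms(2,3)]
    by (intro has_derivative_add has_derivative_mult_right)
  from bounded_linear.has_derivative[OF bounded_linear_divide this, of 2]
  show ?thesis
    by (metis (mono_tags, lifting) frechet_derivative_at)
qed

text \<open>\<open>smooth_order\<close> fixes one order of differentiation, all
  \<open>wirt_bar\<close> before all \<open>wirt\<close>. Differentiating such a mixed derivative
  along a line puts a \<open>wirt_bar\<close> outside, which has to be moved back in.\<close>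

lemma wirt_bar_wirt:
  assumes "open S" "smooth_on S g" "x \<in> S"
  shows "wirt_bar id (wirt id g) x = wirt id (wirt_bar id g) x"
proof -
  let ?D = "\<lambda>v x. fderiv g x v"
  have "wirt id g = (\<lambda>x. (?D 1 x + (-\<i>) * ?D \<i> x) / 2)"
    by (simp add: wirt_def[abs_def])
  note eq1 = this
  have 1: "fderiv (wirt id g) x v =
     (fderiv (?D 1) x v + (-\<i>) * fderiv (?D \<i>) x v) / 2" for v
    unfolding eq1
    by (rule frechet_derivative_lincomb[OF smooth_on_frechet[OF assms(2)] smooth_on_frechet[OF assms(2)] assms(3)])
  have "wirt_bar id g = (\<lambda>x. (?D 1 x + \<i> * ?D \<i> x) / 2)"
    by (simp add: wirt_bar_def[abs_def])
  note eq2 = this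
  have 2: "fderiv (wirt_bar id g) x v =
     (fderiv (?D 1) x v + \<i> * fderiv (?D \<i>) x v) / 2" for v
    unfolding eq2
    by (rule frechet_derivative_lincomb[OF smooth_on_frechet[OF assms(2)] smooth_on_frechet[OF assms(2)] assms(3)])
  have 3: "fderiv (?D 1) x \<i> = fderiv (?D \<i>) x 1"
    using second_derivative_symmetric[OF assms(1,3) smooth_on_Ck[OF assms(2)]] .
  show ?thesis
    unfolding wirt_def[of id "wirt_bar id g"] wirt_bar_def[of id "wirt id g"]
    by (simp add: 1 2 3 field_simps)
qed

section \<open>Mixed Wirtinger derivatives and Taylor expansion on lines\<close>

abbreviation wirt_pow :: "nat \<Rightarrow> nat \<Rightarrow> (complex \<Rightarrow> complex) \<Rightarrow> complex \<Rightarrow> complex" where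
  "wirt_pow a b g \<equiv> (wirt id ^^ a) ((wirt_bar id ^^ b) g)"

lemma smooth_on_wirt_pow:
  assumes "open S" "smooth_on S g"
  shows "smooth_on S (wirt_pow a b g)"
proof -
  have "smooth_on S ((wirt_bar id ^^ b) g)"
    by (induction b) (simp_all only: funpow.simps o_apply id_apply[of g] assms smooth_on_wirt)
  then show ?thesis
    by (induction a) (simp_all only: funpow.simps o_apply id_apply[of "(wirt_bar id ^^ b) g"] assms smooth_on_wirt)
qed

lemma wirt_bar_wirt_pow:
  assumes "open S" "smooth_on S g" "x \<in> S"
  shows "wirt_bar id ((wirt id ^^ a) g) x = (wirt id ^^ a) (wirt_bar id g) x"
  using assms(3)
proof (induction a arbitrary: x)
  case (Suc a)
  have W: "smooth_on S ((wirt id ^^ a) g)"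
    using smooth_on_wirt_pow[OF assms(1,2), of a 0] by simp
  have "wirt_bar id ((wirt id ^^ Suc a) g) x = wirt id (wirt_bar id ((wirt id ^^ a) g)) x"
    using wirt_bar_wirt[OF assms(1) W Suc.prems] by simp
  also have "\<dots> = wirt id ((wirt id ^^ a) (wirt_bar id g)) x"
    using wirt_cong[OF assms(1) smooth_on_wirt(2)[OF assms(1) W] Suc.IH Suc.prems] by blast
  finally show ?case by (simp only: funpow.simps o_apply)
qed simp

lemma frechet_derivative_wirt:
  assumes "(g has_derivative D) (at x)"
  shows "D w = w * wirt id g x + cnj w * wirt_bar id g x"
proof -
  have lin: "linear D" using assms has_derivative_linear by blast
  have D: "D = fderiv g x" using assms frechet_derivative_at by blast
  have "w = Re w *\<^sub>R 1 + Im w *\<^sub>R \<i>"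
    by (simp add: complex_eq_iff)
  then have "D w = D (Re w *\<^sub>R 1 + Im w *\<^sub>R \<i>)"
    by metis
  also have "\<dots> = Re w * D 1 + Im w * D \<i>"
    unfolding linear_add[OF lin] linear_scale[OF lin] by (simp add: scaleR_conv_of_real)
  also have "\<dots> = w * wirt id g x + cnj w * wirt_bar id g x"
    by (simp add: wirt_def wirt_bar_def D[symmetric] complex_eq_iff field_simps)
  finally show ?thesis .
qed

text \<open>The k-th derivative of t \<mapsto> g(t w): the k-th power of the operator w d/dz + cnj w
  d/dzbar, expanded binomially. For t = 0 and |w| = 1 it is a trigonometric polynomial in w whose
  coefficients are, up to nonzero factors, the Taylor coefficients that enter
  \<open>smooth_order\<close>.\<close>

definition line_deriv :: "(complex \<Rightarrow> complex) \<Rightarrow> nat \<Rightarrow> complex \<Rightarrow> real \<Rightarrow> complex" where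
  "line_deriv g k w t = (\<Sum>a\<le>k. of_nat (k choose a) * w ^ a * cnj w ^ (k - a) *
     wirt_pow a (k - a) g (t *\<^sub>R w))"

text \<open>Pascal's rule for applying that operator once more: Y a b stands for w^a (cnj w)^b times
  the mixed derivative of order (a, b), and one differentiation raises one of the two
  indices.\<close>

lemma pascal_sum:
  fixes Y :: "nat \<Rightarrow> nat \<Rightarrow> 'a::comm_semiring_1"
  shows "(\<Sum>a\<le>k. of_nat (k choose a) * (Y (Suc a) (k - a) + Y a (Suc (k - a))))
    = (\<Sum>a\<le>Suc k. of_nat (Suc k choose a) * Y a (Suc k - a))"
proof -
  have "(\<Sum>a\<le>k. of_nat (k choose a) * Y a (Suc (k - a)))
    = (\<Sum>a\<le>Suc k. of_nat (k choose a) * Y a (Suc k - a))"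
    by (simp add: Suc_diff_le binomial_eq_0)
  also have "\<dots> = Y 0 (Suc k) + (\<Sum>a\<le>k. of_nat (k choose Suc a) * Y (Suc a) (k - a))"
    by (subst sum.atMost_Suc_shift) simp
  finally have "(\<Sum>a\<le>k. of_nat (k choose a) * (Y (Suc a) (k - a) + Y a (Suc (k - a))))
    = Y 0 (Suc k) + (\<Sum>a\<le>k. of_nat (Suc k choose Suc a) * Y (Suc a) (k - a))"
    by (simp add: sum.distrib algebra_simps)
  also have "\<dots> = (\<Sum>a\<le>Suc k. of_nat (Suc k choose a) * Y a (Suc k - a))"
    by (simp add: sum.atMost_Suc_shift del: sum.atMost_Suc binomial_Suc_Suc)
  finally show ?thesis .
qed

lemma line_deriv_has_derivative:
  assumes "open S" "smooth_on S g" "t *\<^sub>R w \<in> S"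
  shows "(line_deriv g k w has_vector_derivative line_deriv g (Suc k) w t) (at t)"
proof -
  define U where "U = (\<lambda>a b. wirt_pow a b g)"
  have U: "((\<lambda>t. U a b (t *\<^sub>R w)) has_vector_derivative
      w * U (Suc a) b (t *\<^sub>R w) + cnj w * U a (Suc b) (t *\<^sub>R w)) (at t)" for a b
  proof -
    have sm: "smooth_on S (U a b)"
      unfolding U_def by (rule smooth_on_wirt_pow[OF assms(1,2)])
    have D: "(U a b has_derivative fderiv (U a b) (0 + t *\<^sub>R w)) (at (0 + t *\<^sub>R w))"
      using smooth_on_has_derivative[OF sm assms(3)] by simp
    have B: "smooth_on S ((wirt_bar id ^^ b) g)"
      using smooth_on_wirt_pow[OF assms(1,2), of 0 b] by simp
    have "wirt_bar id (U a b) (t *\<^sub>R w) = U a (Suc b) (t *\<^sub>R w)"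
      unfolding U_def using wirt_bar_wirt_pow[OF assms(1) B assms(3)] by simp
    moreover have "wirt id (U a b) = U (Suc a) b"
      by (simp add: U_def)
    ultimately show ?thesis
      using has_vector_derivative_along_line[OF D] frechet_derivative_wirt[OF D, of w] by simp
  qed
  define Y where "Y = (\<lambda>a b. w ^ a * cnj w ^ b * U a b (t *\<^sub>R w))"
  have "(line_deriv g k w has_vector_derivative
     (\<Sum>a\<le>k. of_nat (k choose a) * w ^ a * cnj w ^ (k - a) *
       (w * U (Suc a) (k - a) (t *\<^sub>R w) + cnj w * U a (Suc (k - a)) (t *\<^sub>R w)))) (at t)"
  proof -
    have "line_deriv g k w = (\<lambda>t. \<Sum>a\<le>k. of_nat (k choose a) * w ^ a * cnj w ^ (k - a) * U a (k - a) (t *\<^sub>R w))"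
      by (simp add: line_deriv_def[abs_def] U_def)
    then show ?thesis
      by (simp only:) (intro has_vector_derivative_sum has_vector_derivative_mult_right U)
  qed
  also have "(\<Sum>a\<le>k. of_nat (k choose a) * w ^ a * cnj w ^ (k - a) *
       (w * U (Suc a) (k - a) (t *\<^sub>R w) + cnj w * U a (Suc (k - a)) (t *\<^sub>R w)))
     = (\<Sum>a\<le>k. of_nat (k choose a) * (Y (Suc a) (k - a) + Y a (Suc (k - a))))"
    by (intro sum.cong refl) (simp add: Y_def algebra_simps)
  also have "\<dots> = line_deriv g (Suc k) w t"
    unfolding pascal_sum by (simp add: line_deriv_def Y_def U_def mult.assoc del: sum.atMost_Suc)
  finally show ?thesis .
qed

text \<open>The Lagrange form of the remainder is available for real functions of a real variable,
  hence the real parts of the complex-valued \<open>line_deriv\<close>.\<close>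

lemma Maclaurin_line:
  assumes "open S" "smooth_on S u" and "\<And>t. \<bar>t\<bar> \<le> \<bar>s\<bar> \<Longrightarrow> t *\<^sub>R w \<in> S"
  shows "\<exists>t. \<bar>t\<bar> \<le> \<bar>s\<bar> \<and> u (s *\<^sub>R w) =
    (\<Sum>k<m. Re (line_deriv (\<lambda>z. complex_of_real (u z)) k w 0) / fact k * s ^ k)
      + Re (line_deriv (\<lambda>z. complex_of_real (u z)) m w t) / fact m * s ^ m"
proof (rule Maclaurin_bi_le[of "\<lambda>k t. Re (line_deriv (\<lambda>z. complex_of_real (u z)) k w t)" "\<lambda>s. u (s *\<^sub>R w)"])
  show "(\<lambda>t. Re (line_deriv (\<lambda>z. complex_of_real (u z)) 0 w t)) = (\<lambda>s. u (s *\<^sub>R w))"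
    by (simp add: line_deriv_def)
  have "smooth_on S (\<lambda>z. complex_of_real (u z))"
    using Ck_on_bounded_linear[OF bounded_linear_of_real assms(1)] assms(2) by (auto simp: smooth_on_def)
  from line_deriv_has_derivative[OF assms(1) this] assms(3)
  show "\<forall>m' t. m' < m \<and> \<bar>t\<bar> \<le> \<bar>s\<bar> \<longrightarrow> ((\<lambda>t. Re (line_deriv (\<lambda>z. complex_of_real (u z)) m' w t))
      has_real_derivative Re (line_deriv (\<lambda>z. complex_of_real (u z)) (Suc m') w t)) (at t)"
    by (auto intro!: has_field_derivative_Re simp: has_vector_derivative_complex_iff)
qed

section \<open>Order of vanishing against growth bounds\<close>

lemma smooth_order_leD:
  assumes "enat m \<le> smooth_order u" "a + b < m"
  shows "wirt_pow a b (\<lambda>z. complex_of_real (u z)) 0 = 0"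
proof (rule ccontr)
  assume "\<not> ?thesis"
  then have "smooth_order u \<le> enat (a + b)"
    unfolding smooth_order_def by (intro Inf_lower) auto
  with assms show False
    by (metis enat_ord_simps(1) leD order_trans)
qed

text \<open>The expansion is taken on the segment from 0 to z, at parameter 1. The terms below m
  vanish, and the remainder is controlled by bounds for the derivatives of order m on a closed
  ball.\<close>

lemma smooth_order_imp_bound:
  assumes "open S" "0 \<in> S" "smooth_on S u" "enat m \<le> smooth_order u"
  obtains C r where "0 < r" "0 \<le> C" "\<And>z. cmod z < r \<Longrightarrow> \<bar>u z\<bar> \<le> C * cmod z ^ m"
proof -
  let ?g = "\<lambda>z. complex_of_real (u z)"
  obtain r where r: "0 < r" "cball 0 r \<subseteq> S"
    using assms(1,2) open_contains_cball by blast
  have sm: "smooth_on S ?g"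
    using Ck_on_bounded_linear[OF bounded_linear_of_real assms(1)] assms(3) by (auto simp: smooth_on_def)
  have "\<exists>B. \<forall>z\<in>cball 0 r. cmod (wirt_pow a (m - a) ?g z) \<le> B" for a
  proof -
    have "continuous_on (cball 0 r) (wirt_pow a (m - a) ?g)"
      using smooth_on_wirt_pow[OF assms(1) sm] r(2)
      by (meson Ck_on_continuous continuous_on_subset smooth_on_Ck)
    then have "bounded (wirt_pow a (m - a) ?g ` cball 0 r)"
      by (intro compact_imp_bounded compact_continuous_image) auto
    then show ?thesis by (auto simp: bounded_iff)
  qed
  then obtain B where B: "\<And>a z. z \<in> cball 0 r \<Longrightarrow> cmod (wirt_pow a (m - a) ?g z) \<le> B a"
    by metis
  define C where "C = (\<Sum>a\<le>m. of_nat (m choose a) * B a)"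
  have B0: "0 \<le> B a" for a
    using B[of 0 a] r(1) by (meson centre_in_cball less_imp_le norm_ge_zero order_trans)
  have "\<bar>u z\<bar> \<le> C * cmod z ^ m" if "cmod z < r" for z
  proof -
    have in_r: "t *\<^sub>R z \<in> cball 0 r" if "\<bar>t\<bar> \<le> 1" for t
      using that \<open>cmod z < r\<close> mult_left_le_one_le[of "cmod z" "\<bar>t\<bar>"] by (simp add: mult.commute)
    then have "t *\<^sub>R z \<in> S" if "\<bar>t\<bar> \<le> 1" for t
      using that r(2) by blast
    then obtain t where t: "\<bar>t\<bar> \<le> 1" and eq: "u z =
      (\<Sum>k<m. Re (line_deriv ?g k z 0) / fact k) + Re (line_deriv ?g m z t) / fact m"
      using Maclaurin_line[OF assms(1,3), of 1 z m] r(2) by (auto simp del: mem_cball_0)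
    have "line_deriv ?g k z 0 = 0" if "k < m" for k
      unfolding line_deriv_def
      by (intro sum.neutral ballI) (use smooth_order_leD[OF assms(4)] that in auto)
    then have "\<bar>u z\<bar> = \<bar>Re (line_deriv ?g m z t)\<bar> / fact m"
      using eq by (simp add: abs_div)
    also have "\<dots> \<le> \<bar>Re (line_deriv ?g m z t)\<bar> / 1"
      by (intro divide_left_mono) (auto simp: fact_ge_1)
    also have "\<dots> \<le> cmod (line_deriv ?g m z t)"
      by (simp add: abs_Re_le_cmod)
    also have "\<dots> \<le> (\<Sum>a\<le>m. of_nat (m choose a) * B a * cmod z ^ m)"
      unfolding line_deriv_def
    proof (rule sum_norm_le)
      fix a assume "a \<in> {..m}"
      then have "cmod z ^ a * cmod z ^ (m - a) = cmod z ^ m"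
        by (simp flip: power_add)
      then have zz: "cmod (z ^ a * cnj z ^ (m - a)) = cmod z ^ m"
        by (simp add: norm_mult norm_power)
      have eq: "cmod (of_nat (m choose a) * z ^ a * cnj z ^ (m - a) * x) = of_nat (m choose a) * cmod z ^ m * cmod x" for x
        using zz by (simp add: norm_mult)
      show "cmod (of_nat (m choose a) * z ^ a * cnj z ^ (m - a) *
          wirt_pow a (m - a) ?g (t *\<^sub>R z)) \<le> of_nat (m choose a) * B a * cmod z ^ m"
        unfolding eq using mult_left_mono[OF B[OF in_r[OF t], of a], of "of_nat (m choose a) * cmod z ^ m"]
        by (simp add: mult_ac)
    qed
    also have "\<dots> = C * cmod z ^ m"
      by (simp add: C_def sum_distrib_right)
    finally show ?thesis .
  qed
  moreover have "0 \<le> C"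
    unfolding C_def by (intro sum_nonneg mult_nonneg_nonneg B0) auto
  ultimately show ?thesis using r(1) that by blast
qed

text \<open>On the unit circle cnj w = 1 / w, so multiplication by w^k turns the sum into a
  polynomial in w^2. Every point of the circle is such a square, and a nonzero polynomial has
  finitely many roots.\<close>

lemma trig_polynomial_nonzero:
  fixes c :: "nat \<Rightarrow> complex"
  assumes "a0 \<le> k" "c a0 \<noteq> 0"
  shows "\<exists>w. cmod w = 1 \<and> (\<Sum>a\<le>k. c a * w ^ a * cnj w ^ (k - a)) \<noteq> 0"
proof (rule ccontr)
  assume neg: "\<not> ?thesis"
  have "sphere 0 1 \<subseteq> {x. (\<Sum>a\<le>k. c a * x ^ a) = 0}"
  proof
    fix x :: complex assume "x \<in> sphere 0 1"
    then have x: "cmod x = 1" by simp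
    define w where "w = csqrt x"
    have w: "w ^ 2 = x" "cmod w = 1"
      using x by (auto simp: w_def)
    have "w * cnj w = 1"
      using w(2) by (simp add: complex_norm_square[symmetric])
    have "c a * x ^ a = w ^ k * (c a * w ^ a * cnj w ^ (k - a))" if "a \<le> k" for a
    proof -
      have "w ^ k * cnj w ^ (k - a) = w ^ a * (w * cnj w) ^ (k - a)"
        using that by (simp add: power_mult_distrib flip: power_add mult.assoc)
      also have "\<dots> = w ^ a" using \<open>w * cnj w = 1\<close> by simp
      finally show ?thesis
        using w(1) by (metis (no_types, lifting) mult.assoc mult.commute power_add power_mult mult_2)
    qed
    then have "(\<Sum>a\<le>k. c a * x ^ a) = w ^ k * (\<Sum>a\<le>k. c a * w ^ a * cnj w ^ (k - a))"
      unfolding sum_distrib_left by (intro sum.cong) auto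
    then show "x \<in> {x. (\<Sum>a\<le>k. c a * x ^ a) = 0}"
      using neg w(2) by auto
  qed
  moreover have "infinite (sphere 0 1 :: complex set)"
    using connected_uncountable[OF connected_sphere[of "0::complex" 1], of 1 "-1"] uncountable_infinite by simp
  ultimately have "infinite {x. (\<Sum>a\<le>k. c a * x ^ a) = 0}"
    using finite_subset by blast
  then show False
    using polyfun_finite_roots[of c k] assms by blast
qed

text \<open>For real u, \<open>line_deriv\<close> is a derivative of a real function on the line,
  although its terms are complex. Hence a nonzero leading form has nonzero real part, which is the
  part seen by \<open>Maclaurin_line\<close>.\<close>

lemma Im_line_deriv_zero:
  assumes "open S" "0 \<in> S" "smooth_on S u"
  shows "Im (line_deriv (\<lambda>z. complex_of_real (u z)) k w 0) = 0"
proof -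
  let ?g = "\<lambda>z. complex_of_real (u z)"
  have sm: "smooth_on S ?g"
    using Ck_on_bounded_linear[OF bounded_linear_of_real assms(1)] assms(3) by (auto simp: smooth_on_def)
  define T where "T = {t. t *\<^sub>R w \<in> S}"
  have T: "open T"
    unfolding T_def using open_vimage[OF assms(1), of "\<lambda>t. t *\<^sub>R w"]
    by (simp add: vimage_def continuous_intros)
  have "\<forall>t\<in>T. Im (line_deriv ?g k w t) = 0"
  proof (induction k)
    case 0
    then show ?case by (simp add: line_deriv_def)
  next
    case (Suc k)
    show ?case
    proof
      fix t assume t: "t \<in> T"
      have "((\<lambda>t. Im (line_deriv ?g k w t)) has_real_derivative Im (line_deriv ?g (Suc k) w t)) (at t)"
        using line_deriv_has_derivative[OF assms(1) sm] t
        by (auto simp: T_def has_vector_derivative_complex_iff)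
      then have "((\<lambda>t. 0) has_real_derivative Im (line_deriv ?g (Suc k) w t)) (at t)"
        by (rule DERIV_cong_ev[THEN iffD1, rotated 3])
          (use Suc eventually_nhds_in_open[OF T t] in \<open>auto elim: eventually_mono\<close>)
      then show "Im (line_deriv ?g (Suc k) w t) = 0"
        using DERIV_unique DERIV_const by blast
    qed
  qed
  then show ?thesis using assms(2) by (simp add: T_def)
qed

text \<open>If the order k is finite, the form of degree k is nonzero in some direction w, and along
  it |u| is at least a positive multiple of s^k. Comparing s^(v k) with s^m for small s leaves m
  \<le> v k. The power v avoids a fractional exponent.\<close>

lemma bound_imp_smooth_order:
  assumes "open S" "0 \<in> S" "smooth_on S u" "0 < v" "0 < r"
    and bound: "\<And>z. cmod z < r \<Longrightarrow> \<bar>u z\<bar> ^ v \<le> C * cmod z ^ m"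
  shows "enat m \<le> enat v * smooth_order u"
proof (cases "smooth_order u")
  case infinity
  then show ?thesis using \<open>0 < v\<close> by simp
next
  case (enat k)
  let ?g = "\<lambda>z. complex_of_real (u z)"
  let ?U = "\<lambda>a b. wirt_pow a b ?g"
  let ?A = "{enat (a + b) | a b. ?U a b 0 \<noteq> 0}"
  have "?A \<noteq> {}"
    using enat unfolding smooth_order_def by (metis (no_types, lifting) Inf_enat_def enat.distinct(1))
  then have "Inf ?A \<in> ?A"
    unfolding Inf_enat_def by (metis (no_types, lifting) LeastI ex_in_conv)
  then obtain a0 b0 where ab: "a0 + b0 = k" "?U a0 b0 0 \<noteq> 0"
    using enat unfolding smooth_order_def by auto
  define c where "c = (\<lambda>a. of_nat (k choose a) * ?U a (k - a) 0)"
  have "a0 \<le> k" "c a0 \<noteq> 0"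
    using ab by (auto simp: c_def)
  then obtain w where w: "cmod w = 1" "(\<Sum>a\<le>k. c a * w ^ a * cnj w ^ (k - a)) \<noteq> 0"
    using trig_polynomial_nonzero by blast
  have sm: "smooth_on S ?g"
    using Ck_on_bounded_linear[OF bounded_linear_of_real assms(1)] assms(3) by (auto simp: smooth_on_def)
  have "line_deriv ?g k w 0 = (\<Sum>a\<le>k. c a * w ^ a * cnj w ^ (k - a))"
    unfolding line_deriv_def c_def by (intro sum.cong) auto
  then have P0: "Re (line_deriv ?g k w 0) \<noteq> 0"
    using w(2) Im_line_deriv_zero[OF assms(1-3), of k w] by (simp add: complex_eq_iff)
  define q where "q = \<bar>Re (line_deriv ?g k w 0)\<bar> / 2"
  have q: "0 < q" using P0 by (simp add: q_def)
  have "isCont (line_deriv ?g k w) 0"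
    using line_deriv_has_derivative[OF assms(1) sm, of 0 w k] assms(2) has_vector_derivative_continuous by auto
  then have "isCont (\<lambda>t. Re (line_deriv ?g k w t)) 0"
    by (rule continuous_Re)
  then obtain d where d: "0 < d" "\<And>t. \<bar>t\<bar> < d \<Longrightarrow> \<bar>Re (line_deriv ?g k w t) - Re (line_deriv ?g k w 0)\<bar> < q"
    using q unfolding continuous_at_eps_delta by (auto simp: dist_norm)
  obtain d' where d': "0 < d'" "ball 0 d' \<subseteq> S"
    using assms(1,2) openE by blast
  have order: "(\<Sum>j<k. Re (line_deriv ?g j w 0) / fact j * s ^ j) = 0" for s
  proof (rule sum.neutral, rule ballI)
    fix j assume "j \<in> {..<k}"
    then have "line_deriv ?g j w 0 = 0"
      unfolding line_deriv_def
      by (intro sum.neutral ballI) (use smooth_order_leD[of k u] enat in auto)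
    then show "Re (line_deriv ?g j w 0) / fact j * s ^ j = 0" by simp
  qed
  have lower: "q / fact k * s ^ k \<le> \<bar>u (s *\<^sub>R w)\<bar>" if s: "0 < s" "s < d" "s < d'" for s
  proof -
    have "t *\<^sub>R w \<in> S" if "\<bar>t\<bar> \<le> \<bar>s\<bar>" for t
      using that s d'(2) w(1) by (auto simp: subset_iff)
    then obtain t where t: "\<bar>t\<bar> \<le> \<bar>s\<bar>" "u (s *\<^sub>R w) = Re (line_deriv ?g k w t) / fact k * s ^ k"
      using Maclaurin_line[OF assms(1,3), of s w k] order by auto
    have "q \<le> \<bar>Re (line_deriv ?g k w t)\<bar>"
      using d(2)[of t] t(1) s q_def by linarith
    then have "q / fact k * s ^ k \<le> \<bar>Re (line_deriv ?g k w t)\<bar> / fact k * s ^ k"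
      using s by (intro mult_right_mono divide_right_mono) auto
    also have "\<dots> = \<bar>u (s *\<^sub>R w)\<bar>"
      using s t(2) by (simp add: abs_mult)
    finally show ?thesis .
  qed
  have "m \<le> v * k"
  proof (rule ccontr)
    assume "\<not> m \<le> v * k"
    then have mk: "m = v * k + Suc (m - v * k - 1)" by simp
    define c0 where "c0 = (q / fact k) ^ v"
    have c0: "0 < c0" using q by (simp add: c0_def)
    \<comment> \<open>The last entry makes |C| s at most c0 / 2, against c0 \<le> |C| s below; s
      \<le> 1 allows surplus powers of s to be dropped.\<close>
    define s where "s = Min {d / 2, d' / 2, r / 2, 1, c0 / (2 * (\<bar>C\<bar> + 1))}"
    have "0 < s"
      unfolding s_def using d(1) d'(1) assms(5) c0 by (subst Min_gr_iff) auto
    have "s \<le> x" if "x \<in> {d / 2, d' / 2, r / 2, 1, c0 / (2 * (\<bar>C\<bar> + 1))}" for x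
      unfolding s_def using that by (intro Min.coboundedI) auto
    from this[of "d / 2"] this[of "d' / 2"] this[of "r / 2"] this[of 1] this[of "c0 / (2 * (\<bar>C\<bar> + 1))"] \<open>0 < s\<close>
    have s: "0 < s" "s < d" "s < d'" "s < r" "s \<le> 1" "s \<le> c0 / (2 * (\<bar>C\<bar> + 1))"
      using d(1) d'(1) assms(5) by auto
    have "c0 * s ^ (v * k) = (q / fact k * s ^ k) ^ v"
      by (simp only: c0_def power_mult_distrib power_mult[symmetric] mult.commute[of v k])
    also have "\<dots> \<le> \<bar>u (s *\<^sub>R w)\<bar> ^ v"
      using lower[OF s(1-3)] q s by (intro power_mono) auto
    also have "\<dots> \<le> C * s ^ m"
      using bound[of "s *\<^sub>R w"] s w(1) by simp
    also have "\<dots> \<le> \<bar>C\<bar> * s ^ m"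
      using s by (intro mult_right_mono) auto
    also have "s ^ m = s ^ (v * k) * s ^ Suc (m - v * k - 1)"
      using mk by (metis power_add)
    also have "\<bar>C\<bar> * \<dots> \<le> \<bar>C\<bar> * (s ^ (v * k) * s)"
      using s by (intro mult_left_mono) (auto simp: mult_left_le_one_le power_le_one mult_left_le)
    finally have "s ^ (v * k) * c0 \<le> s ^ (v * k) * (\<bar>C\<bar> * s)"
      by (simp add: mult_ac)
    then have "c0 \<le> \<bar>C\<bar> * s"
      using s by simp
    also have "\<dots> \<le> (\<bar>C\<bar> + 1) * s" using s by simp
    also have "\<dots> \<le> (\<bar>C\<bar> + 1) * (c0 / (2 * (\<bar>C\<bar> + 1)))"
      using s by (intro mult_left_mono) auto
    also have "\<dots> = c0 / 2"
      by (simp add: field_simps add_nonneg_eq_0_iff)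
    finally show False using c0 by simp
  qed
  then show ?thesis
    using enat by simp
qed

section \<open>The Levi form along holomorphic discs\<close>

lemma second_derivative_linear:
  fixes \<rho> :: "'a::euclidean_space \<Rightarrow> real"
  assumes "open U" "smooth_on U \<rho>" "z \<in> U"
  shows "linear (\<lambda>v. fderiv (\<lambda>x. fderiv \<rho> x w) z v)"
    and "linear (\<lambda>w. fderiv (\<lambda>x. fderiv \<rho> x w) z v)"
proof -
  have L: "linear (\<lambda>v. fderiv (\<lambda>x. fderiv \<rho> x w) z v)" for w
    using smooth_on_has_derivative[OF smooth_on_frechet[OF assms(2)] assms(3)] has_derivative_linear by blast
  from L show "linear (\<lambda>v. fderiv (\<lambda>x. fderiv \<rho> x w) z v)" .
  show "linear (\<lambda>w. fderiv (\<lambda>x. fderiv \<rho> x w) z v)"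
    using L[of v] second_derivative_symmetric[OF assms(1,3) smooth_on_Ck[OF assms(2)], of v] by simp
qed

text \<open>In the first derivative both the base point and the direction move with s. Expanding q1
  s in \<open>Basis\<close> separates them into products of real functions; the second derivative is
  the Hessian on the velocity plus the gradient on the acceleration.\<close>

lemma derivatives_along_curve:
  fixes \<rho> :: "'a::euclidean_space \<Rightarrow> real"
  assumes U: "open U" "smooth_on U \<rho>"
    and q: "\<And>s. \<bar>s\<bar> < r \<Longrightarrow> q s \<in> U"
      "\<And>s. \<bar>s\<bar> < r \<Longrightarrow> (q has_vector_derivative q1 s) (at s)"
      "(q1 has_vector_derivative q2) (at 0)"
    and r: "0 < r"
  shows "\<And>s. \<bar>s\<bar> < r \<Longrightarrow> ((\<lambda>s. \<rho> (q s)) has_real_derivative fderiv \<rho> (q s) (q1 s)) (at s)"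
    and "((\<lambda>s. fderiv \<rho> (q s) (q1 s)) has_real_derivative
      fderiv (\<lambda>x. fderiv \<rho> x (q1 0)) (q 0) (q1 0)
        + fderiv \<rho> (q 0) q2) (at 0)"
proof -
  have chain: "((\<lambda>s. g (q s)) has_real_derivative fderiv g (q s) (q1 s)) (at s)"
    if g: "smooth_on U g" and s: "\<bar>s\<bar> < r" for g :: "'a \<Rightarrow> real" and s
  proof -
    have D: "(g has_derivative fderiv g (q s)) (at (q s))"
      using smooth_on_has_derivative[OF g q(1)[OF s]] .
    show ?thesis
      using has_derivative_compose[OF q(2)[OF s, unfolded has_vector_derivative_def] D]
        linear_scale[OF has_derivative_linear[OF D]]
      by (simp add: has_field_derivative_def mult_commute_abs)
  qed
  show "((\<lambda>s. \<rho> (q s)) has_real_derivative fderiv \<rho> (q s) (q1 s)) (at s)"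
    if "\<bar>s\<bar> < r" for s
    using chain[OF U(2) that] .
  let ?g = "\<lambda>b x. fderiv \<rho> x b"
  have r0: "\<bar>0::real\<bar> < r" using r by simp
  have sum: "(\<Sum>b\<in>Basis. (w \<bullet> b) * L b) = L w" if L: "linear L" for L :: "'a \<Rightarrow> real" and w
  proof -
    have "L w = L (\<Sum>b\<in>Basis. (w \<bullet> b) *\<^sub>R b)" by (simp add: euclidean_representation)
    also have "\<dots> = (\<Sum>b\<in>Basis. (w \<bullet> b) * L b)"
      by (simp add: linear_sum[OF L] linear_scale[OF L])
    finally show ?thesis by simp
  qed
  have lin: "linear (fderiv \<rho> (q s))" if "\<bar>s\<bar> < r" for s
    using smooth_on_has_derivative[OF U(2) q(1)[OF that]] has_derivative_linear by blast
  have "((\<lambda>s. \<Sum>b\<in>Basis. (q1 s \<bullet> b) * ?g b (q s)) has_real_derivative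
     (\<Sum>b\<in>Basis. (q2 \<bullet> b) * ?g b (q 0)
       + fderiv (?g b) (q 0) (q1 0) * (q1 0 \<bullet> b))) (at 0)"
  proof (intro DERIV_sum DERIV_mult)
    fix b :: 'a
    show "((\<lambda>s. q1 s \<bullet> b) has_real_derivative q2 \<bullet> b) (at 0)"
      using bounded_linear.has_vector_derivative[OF bounded_linear_inner_left q(3)]
      by (simp add: has_real_derivative_iff_has_vector_derivative)
    show "((\<lambda>s. ?g b (q s)) has_real_derivative fderiv (?g b) (q 0) (q1 0)) (at 0)"
      using chain[OF smooth_on_frechet[OF U(2)] r0] .
  qed
  moreover have "(\<Sum>b\<in>Basis. (q2 \<bullet> b) * ?g b (q 0)
       + fderiv (?g b) (q 0) (q1 0) * (q1 0 \<bullet> b))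
     = fderiv (?g (q1 0)) (q 0) (q1 0) + fderiv \<rho> (q 0) q2"
    using sum[OF lin[OF r0], of q2] sum[OF second_derivative_linear(2)[OF U q(1)[OF r0]], of "q1 0" "q1 0"]
    by (simp add: sum.distrib mult.commute)
  moreover have "((\<lambda>s. \<Sum>b\<in>Basis. (q1 s \<bullet> b) * ?g b (q s)) has_real_derivative c) (at 0)
     \<longleftrightarrow> ((\<lambda>s. fderiv \<rho> (q s) (q1 s)) has_real_derivative c) (at 0)" for c
  proof (rule DERIV_cong_ev)
    have "\<forall>\<^sub>F s in nhds 0. s \<in> ball 0 r"
      using r by (intro eventually_nhds_in_open) auto
    then show "\<forall>\<^sub>F s in nhds 0. (\<Sum>b\<in>Basis. (q1 s \<bullet> b) * ?g b (q s)) = fderiv \<rho> (q s) (q1 s)"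
      by eventually_elim (use sum[OF lin] in auto)
  qed auto
  ultimately show "((\<lambda>s. fderiv \<rho> (q s) (q1 s)) has_real_derivative
      fderiv (\<lambda>x. fderiv \<rho> x (q1 0)) (q 0) (q1 0)
        + fderiv \<rho> (q 0) q2) (at 0)"
    by simp
qed

text \<open>The function \<phi> + k s^2 is \<le> 0 and vanishes at 0. If c + 2 k were positive, its
  derivative would be positive just to the right of 0 and the function would increase there.\<close>

lemma second_derivative_le_of_quadratic_bound:
  fixes \<phi> :: "real \<Rightarrow> real"
  assumes "0 < r" "\<And>s. \<bar>s\<bar> < r \<Longrightarrow> (\<phi> has_real_derivative \<phi>1 s) (at s)"
    and "(\<phi>1 has_real_derivative c) (at 0)" "\<phi> 0 = 0"
    and "\<And>s. \<bar>s\<bar> < r \<Longrightarrow> \<phi> s \<le> - k * s\<^sup>2" "0 \<le> k"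
  shows "\<phi>1 0 = 0" "c \<le> - 2 * k"
proof -
  have le0: "\<phi> s \<le> 0" if "\<bar>s\<bar> < r" for s
    using assms(5)[OF that] mult_nonneg_nonneg[OF \<open>0 \<le> k\<close> zero_le_power2[of s]] by linarith
  show 0: "\<phi>1 0 = 0"
    by (rule DERIV_local_max[of \<phi> _ 0 r]) (use assms(1,2,4) le0 in auto)
  show "c \<le> - 2 * k"
  proof (rule ccontr)
    assume "\<not> c \<le> - 2 * k"
    then have pos: "0 < c + 2 * k" by simp
    have "((\<lambda>s. \<phi>1 s + 2 * k * s) has_real_derivative c + 2 * k) (at 0)"
      by (auto intro!: derivative_eq_intros assms(3))
    from DERIV_pos_inc_right[OF this pos] 0
    obtain d where d: "0 < d" "\<And>h. 0 < h \<Longrightarrow> h < d \<Longrightarrow> 0 < \<phi>1 h + 2 * k * h" by auto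
    define h where "h = min d r / 2"
    have h: "0 < h" "h < d" "h < r" using d(1) assms(1) by (auto simp: h_def)
    have "\<exists>\<xi>. 0 < \<xi> \<and> \<xi> < h \<and> (\<phi> h + k * h\<^sup>2) - (\<phi> 0 + k * 0\<^sup>2) = (h - 0) * (\<phi>1 \<xi> + 2 * k * \<xi>)"
      by (rule MVT2[OF h(1)]) (use h in \<open>auto intro!: derivative_eq_intros assms(2)\<close>)
    then obtain \<xi> where "0 < \<xi>" "\<xi> < h" "\<phi> h + k * h\<^sup>2 = h * (\<phi>1 \<xi> + 2 * k * \<xi>)"
      using assms(4) by auto
    moreover have "0 < h * (\<phi>1 \<xi> + 2 * k * \<xi>)"
      using d(2)[of \<xi>] calculation h by simp
    ultimately show False
      using assms(5)[of h] h by simp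
  qed
qed

lemma vec_decomp_axis:
  fixes t :: "complex ^ 'n"
  shows "t = (\<Sum>j\<in>UNIV. Re (t $ j) *\<^sub>R axis j 1 + Im (t $ j) *\<^sub>R axis j \<i>)"
proof -
  have "(\<Sum>j\<in>UNIV. Re (t $ j) *\<^sub>R axis j 1 + Im (t $ j) *\<^sub>R axis j \<i>) $ i = t $ i" for i
  proof -
    have "(\<Sum>j\<in>UNIV. Re (t $ j) *\<^sub>R axis j 1 + Im (t $ j) *\<^sub>R axis j \<i>) $ i
       = (\<Sum>j\<in>UNIV. if j = i then t $ i else 0)"
      unfolding sum_component
      by (intro sum.cong refl) (auto simp: axis_def complex_eq_iff)
    then show ?thesis by simp
  qed
  then show ?thesis by (simp add: vec_eq_iff)
qed

text \<open>The matrix is the one that \<open>wirt\<close> after \<open>wirt_bar\<close> makes of a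
  real bilinear form B, later the Hessian. Both sides are expanded in the real basis
  \<open>axis j 1\<close>, \<open>axis j \<i>\<close> and compared termwise.\<close>

lemma Re_hermitian_form:
  fixes B :: "complex ^ 'n \<Rightarrow> complex ^ 'n \<Rightarrow> real"
  assumes B: "\<And>w. linear (\<lambda>v. B v w)" "\<And>v. linear (\<lambda>w. B v w)"
  shows "Re (\<Sum>j\<in>UNIV. \<Sum>k\<in>UNIV. Complex ((B (axis j 1) (axis k 1) + B (axis j \<i>) (axis k \<i>)) / 4)
       ((B (axis j 1) (axis k \<i>) - B (axis j \<i>) (axis k 1)) / 4) * t $ j * cnj (t $ k))
    = (B t t + B (\<i> *s t) (\<i> *s t)) / 4"
proof -
  have exp: "B v w = (\<Sum>j\<in>UNIV. \<Sum>k\<in>UNIV.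
      Re (v $ j) * (Re (w $ k) * B (axis j 1) (axis k 1) + Im (w $ k) * B (axis j 1) (axis k \<i>))
    + Im (v $ j) * (Re (w $ k) * B (axis j \<i>) (axis k 1) + Im (w $ k) * B (axis j \<i>) (axis k \<i>)))" for v w
  proof -
    have 1: "B v w = (\<Sum>j\<in>UNIV. Re (v $ j) * B (axis j 1) w + Im (v $ j) * B (axis j \<i>) w)" for v w
      by (subst vec_decomp_axis[of v])
        (simp add: linear_sum[OF B(1)] linear_add[OF B(1)] linear_scale[OF B(1)])
    have 2: "B v w = (\<Sum>k\<in>UNIV. Re (w $ k) * B v (axis k 1) + Im (w $ k) * B v (axis k \<i>))" for v w
      by (subst vec_decomp_axis[of w])
        (simp add: linear_sum[OF B(2)] linear_add[OF B(2)] linear_scale[OF B(2)])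
    show ?thesis
      by (subst 1, subst (1 2) 2) (simp add: sum_distrib_left[symmetric] sum.distrib)
  qed
  show ?thesis
    unfolding exp[of t t] exp[of "\<i> *s t" "\<i> *s t"] sum.distrib[symmetric] sum_divide_distrib Re_sum
    by (intro sum.cong refl) (simp add: field_simps)
qed

lemma wirt_eq:
  assumes "(g has_derivative G) (at x)"
  shows "wirt e g x = (G (e 1) - \<i> * G (e \<i>)) / 2"
  unfolding wirt_def frechet_derivative_at[OF assms, symmetric] ..

text \<open>This is the identity Laplacian = 4 d/dz d/dzbar on the complex line spanned by
  t.\<close>

lemma levi_form_real_part:
  assumes U: "open U" "smooth_on U \<rho>" "z \<in> U"
  defines "B \<equiv> \<lambda>v w. fderiv (\<lambda>x. fderiv \<rho> x w) z v"
  shows "Re (levi_form \<rho> z t) = (B t t + B (\<i> *s t) (\<i> *s t)) / 4"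
proof -
  have of_real: "fderiv (\<lambda>w. complex_of_real (\<rho> w)) x v = complex_of_real (fderiv \<rho> x v)"
    if "x \<in> U" for x v
    using frechet_derivative_at[OF bounded_linear.has_derivative[OF bounded_linear_of_real
          smooth_on_has_derivative[OF U(2) that]]] by metis
  have eq: "wirt (axis j) (wirt_bar (axis k) (\<lambda>w. complex_of_real (\<rho> w))) z
     = Complex ((B (axis j 1) (axis k 1) + B (axis j \<i>) (axis k \<i>)) / 4)
       ((B (axis j 1) (axis k \<i>) - B (axis j \<i>) (axis k 1)) / 4)" for j k
  proof -
    let ?h = "\<lambda>x. (complex_of_real (fderiv \<rho> x (axis k 1)) +
        \<i> * complex_of_real (fderiv \<rho> x (axis k \<i>))) / 2"
    have d: "(?h has_derivative (\<lambda>v. (complex_of_real (B v (axis k 1)) + \<i> * complex_of_real (B v (axis k \<i>))) / 2)) (at z)"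
    proof -
      have "((\<lambda>x. fderiv \<rho> x w) has_derivative (\<lambda>v. B v w)) (at z)" for w
        using smooth_on_has_derivative[OF smooth_on_frechet[OF U(2)] U(3), of w] unfolding B_def .
      then show ?thesis
        by (intro bounded_linear.has_derivative[OF bounded_linear_divide] has_derivative_add
            has_derivative_mult_right has_derivative_of_real)
    qed
    have "(wirt_bar (axis k) (\<lambda>w. complex_of_real (\<rho> w)) has_derivative
       (\<lambda>v. (complex_of_real (B v (axis k 1)) + \<i> * complex_of_real (B v (axis k \<i>))) / 2)) (at z)"
      by (rule has_derivative_transform_within_open[OF d U(1,3)])
        (simp add: wirt_bar_def of_real)
    note wb = this
    show ?thesis
      unfolding wirt_eq[OF wb] by (simp add: complex_eq_iff)
  qed
  show ?thesis
    unfolding levi_form_def eq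
    by (rule Re_hermitian_form) (use second_derivative_linear[OF U] in \<open>auto simp: B_def\<close>)
qed

lemma holomorphic_curve_derivative:
  fixes G :: "complex \<Rightarrow> complex ^ 'n"
  assumes "open S" "\<And>j. (\<lambda>z. G z $ j) holomorphic_on S" "s *\<^sub>R w \<in> S"
  shows "((\<lambda>s. G (s *\<^sub>R w)) has_vector_derivative w *s (\<chi> j. deriv (\<lambda>z. G z $ j) (s *\<^sub>R w))) (at s)"
proof -
  have "((\<lambda>s. G (s *\<^sub>R w) $ j) has_vector_derivative w * deriv (\<lambda>z. G z $ j) (s *\<^sub>R w)) (at s)" for j
  proof -
    have "((\<lambda>z. G z $ j) has_field_derivative deriv (\<lambda>z. G z $ j) (s *\<^sub>R w)) (at (0 + s *\<^sub>R w))"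
      using holomorphic_derivI[OF assms(2,1,3)] by simp
    from has_vector_derivative_along_line[OF this[unfolded has_field_derivative_def]]
    show ?thesis by (simp add: mult.commute)
  qed
  then have "((\<lambda>s. \<Sum>j\<in>UNIV. axis j (G (s *\<^sub>R w) $ j)) has_vector_derivative
     (\<Sum>j\<in>UNIV. axis j ((w *s (\<chi> j. deriv (\<lambda>z. G z $ j) (s *\<^sub>R w))) $ j))) (at s)"
    by (intro has_vector_derivative_sum bounded_linear.has_vector_derivative[OF bounded_linear_axis]) simp
  then show ?thesis by (simp only: sum_axis)
qed

text \<open>
  A holomorphic disc that touches the boundary from inside and leaves it quadratically in one
  direction would have negative Laplacian of \<open>\<rho>\<close> along it, which is four times the Levi form in
  its complex tangent direction.
\<close>

lemma no_inner_touching_disc: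
  fixes \<rho> :: "complex ^ 'n \<Rightarrow> real"
  assumes U: "open U" "smooth_on U \<rho>" "G 0 \<in> U" "\<rho> (G 0) = 0"
    and levi: "\<And>t. (\<Sum>j\<in>UNIV. wirt (axis j) (\<lambda>w. complex_of_real (\<rho> w)) (G 0) * t $ j) = 0
      \<Longrightarrow> 0 \<le> Re (levi_form \<rho> (G 0) t)"
    and hol: "\<And>j. (\<lambda>z. G z $ j) holomorphic_on UNIV"
    and k: "0 < k" and r: "0 < r"
    and inside: "\<And>z. cmod z < r \<Longrightarrow> \<rho> (G z) \<le> - k * (Im z)\<^sup>2"
  shows False
proof -
  define D where "D = fderiv \<rho> (G 0)"
  define B where "B = (\<lambda>v w. fderiv (\<lambda>x. fderiv \<rho> x w) (G 0) v)"
  define G1 where "G1 = (\<lambda>z. \<chi> j. deriv (\<lambda>z. G z $ j) z)"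
  define G2 where "G2 = (\<chi> j. deriv (\<lambda>z. G1 z $ j) 0)"
  have hol1: "(\<lambda>z. G1 z $ j) holomorphic_on UNIV" for j
    using holomorphic_deriv[OF hol] by (simp add: G1_def)
  have "continuous_on UNIV G"
    using Ck_on_holomorphic_vec[of UNIV G, OF _ hol] Ck_on_continuous by blast
  then obtain r' where r': "0 < r'" "\<And>z. cmod z < r' \<Longrightarrow> G z \<in> U"
  proof -
    assume a: "\<And>r'. 0 < r' \<Longrightarrow> (\<And>z. cmod z < r' \<Longrightarrow> G z \<in> U) \<Longrightarrow> thesis" and c: "continuous_on UNIV G"
    have "open (G -` U)" using c U(1) open_vimage by blast
    then obtain e where "0 < e" "ball 0 e \<subseteq> G -` U"
      using U(3) by (meson openE vimageI)
    then show thesis using a[of e] by (auto simp: subset_iff)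
  qed
  define \<delta> where "\<delta> = min r r'"
  have \<delta>: "0 < \<delta>" using r r' by (simp add: \<delta>_def)
  \<comment> \<open>Restriction to the real line in direction w, where Im (s w) = s Im w: the upper
    bound is 0 for w = 1 and - k s^2 for w = \<i>. These are the two directions used.\<close>
  have dir: "D (w *s G1 0) = 0" "B (w *s G1 0) (w *s G1 0) + D (w *s (w *s G2)) \<le> - 2 * (k * (Im w)\<^sup>2)"
    if w: "cmod w = 1" for w
  proof -
    have 1: "G (s *\<^sub>R w) \<in> U" if "\<bar>s\<bar> < \<delta>" for s
      using r'(2) that w by (simp add: \<delta>_def)
    have 2: "((\<lambda>s. G (s *\<^sub>R w)) has_vector_derivative w *s G1 (s *\<^sub>R w)) (at s)" for s
      using holomorphic_curve_derivative[OF open_UNIV hol] by (simp add: G1_def)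
    have "((\<lambda>s. G1 (s *\<^sub>R w)) has_vector_derivative w *s G2) (at 0)"
      using holomorphic_curve_derivative[OF open_UNIV hol1, of 0 w] by (simp add: G2_def)
    then have 3: "((\<lambda>s. w *s G1 (s *\<^sub>R w)) has_vector_derivative w *s (w *s G2)) (at 0)"
    proof (rule bounded_linear.has_vector_derivative[rotated])
      show "bounded_linear (\<lambda>v :: complex ^ 'n. w *s v)"
        by (auto intro!: linearI simp: linear_conv_bounded_linear[symmetric] vec_eq_iff algebra_simps)
    qed
    note c = derivatives_along_curve[OF U(1,2), of \<delta> "\<lambda>s. G (s *\<^sub>R w)", OF 1 2 3 \<delta>]
    have "\<rho> (G (s *\<^sub>R w)) \<le> - (k * (Im w)\<^sup>2) * s\<^sup>2" if "\<bar>s\<bar> < \<delta>" for s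
      using inside[of "s *\<^sub>R w"] that w by (simp add: \<delta>_def power_mult_distrib mult_ac)
    from second_derivative_le_of_quadratic_bound[OF \<delta> c(1) c(2) _ this] U(4) k
    show "D (w *s G1 0) = 0" "B (w *s G1 0) (w *s G1 0) + D (w *s (w *s G2)) \<le> - 2 * (k * (Im w)\<^sup>2)"
      by (auto simp: D_def B_def)
  qed
  have Dh: "(\<rho> has_derivative D) (at (G 0))"
    unfolding D_def using smooth_on_has_derivative[OF U(2,3)] .
  have Dlin: "linear D"
    using Dh has_derivative_linear by blast
  let ?t = "G1 0"
  \<comment> \<open>Complex tangency of t amounts to D t = 0 and D (\<i> t) = 0, the first-order
    conditions obtained for w = 1 and w = \<i>.\<close>
  have tan: "(\<Sum>j\<in>UNIV. wirt (axis j) (\<lambda>w. complex_of_real (\<rho> w)) (G 0) * t $ j)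
    = (complex_of_real (D t) - \<i> * complex_of_real (D (\<i> *s t))) / 2" for t
  proof -
    have "wirt (axis j) (\<lambda>w. complex_of_real (\<rho> w)) (G 0) = (complex_of_real (D (axis j 1)) - \<i> * complex_of_real (D (axis j \<i>))) / 2" for j
      by (rule wirt_eq[OF bounded_linear.has_derivative[OF bounded_linear_of_real Dh]])
    note W = this
    have Dexp: "D v = (\<Sum>j\<in>UNIV. Re (v $ j) * D (axis j 1) + Im (v $ j) * D (axis j \<i>))" for v
      by (subst vec_decomp_axis[of v])
        (simp add: linear_sum[OF Dlin] linear_add[OF Dlin] linear_scale[OF Dlin])
    show ?thesis
      unfolding W Dexp[of t] Dexp[of "\<i> *s t"] of_real_sum sum_distrib_left sum_divide_distrib sum_subtractf[symmetric]
      by (intro sum.cong refl) (simp add: complex_eq_iff field_simps)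
  qed
  have "1 *s ?t = ?t" by simp
  then have "0 \<le> Re (levi_form \<rho> (G 0) ?t)"
    using dir(1)[of 1] dir(1)[of \<i>] by (intro levi) (simp add: tan)
  then have "0 \<le> B ?t ?t + B (\<i> *s ?t) (\<i> *s ?t)"
    using levi_form_real_part[OF U(1-3), of ?t] by (simp add: B_def)
  \<comment> \<open>When the inequalities for w = 1 and w = \<i> are added, the second-order terms
    of the disc cancel because \<i>^2 = -1. The Laplacian remains, bounded by - 2 k.\<close>
  moreover have "D (\<i> *s (\<i> *s G2)) = - D G2"
  proof -
    have "\<i> *s (\<i> *s G2) = - G2" by (simp add: vec_eq_iff)
    then show ?thesis using linear_neg[OF Dlin] by simp
  qed
  ultimately show False
    using dir(2)[of 1] dir(2)[of \<i>] k by simp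
qed

section \<open>Reinhardt domains in logarithmic coordinates\<close>

text \<open>Translation by x in the coordinates log |z_j|, with arguments and zero coordinates left
  alone.\<close>

definition scale :: "real ^ 'n \<Rightarrow> complex ^ 'n \<Rightarrow> complex ^ 'n" where
  "scale x z = (\<chi> j. of_real (exp (x $ j)) * z $ j)"

lemma scale_nth [simp]: "scale x z $ j = of_real (exp (x $ j)) * z $ j"
  by (simp add: scale_def)

lemma scale_0 [simp]: "scale 0 z = z"
  by (simp add: vec_eq_iff)

lemma continuous_on_scale [continuous_intros]:
  assumes "continuous_on S f" "continuous_on S g"
  shows "continuous_on S (\<lambda>t. scale (f t) (g t))"
  unfolding scale_def using assms by (intro continuous_intros)

lemma scale_has_vector_derivative:
  "((\<lambda>t. scale (t *\<^sub>R e) z) has_vector_derivative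
     (\<chi> j. of_real (e $ j) * scale (t *\<^sub>R e) z $ j)) (at t)"
proof -
  have "((\<lambda>t. of_real (exp (t * e $ j)) * z $ j) has_vector_derivative
     (of_real (e $ j) * (of_real (exp (t * e $ j)) * z $ j))) (at t)" for j
    by (auto intro!: derivative_eq_intros simp: has_vector_derivative_def scaleR_conv_of_real algebra_simps)
  then have "((\<lambda>t. \<Sum>j\<in>UNIV. axis j (scale (t *\<^sub>R e) z $ j)) has_vector_derivative
     (\<Sum>j\<in>UNIV. axis j ((\<chi> j. of_real (e $ j) * scale (t *\<^sub>R e) z $ j) $ j))) (at t)"
    by (intro has_vector_derivative_sum bounded_linear.has_vector_derivative[OF bounded_linear_axis]) simp
  then show ?thesis by (simp only: sum_axis)
qed

lemma norm_le_sum_components: "norm (z :: complex ^ 'n) \<le> (\<Sum>j\<in>UNIV. cmod (z $ j))"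
  by (simp add: norm_vec_def L2_set_le_sum)

lemma reinhardt_moduli:
  assumes "reinhardt \<Omega>" "z \<in> \<Omega>" "\<And>j. cmod (w $ j) = cmod (z $ j)"
  shows "w \<in> \<Omega>"
proof -
  have "\<exists>\<theta>. 0 \<le> \<theta> \<and> \<theta> \<le> 2 * pi \<and> exp (\<i> * of_real \<theta>) * z $ j = w $ j" for j
  proof -
    have "\<exists>\<theta>. 0 \<le> \<theta> \<and> \<theta> \<le> 2 * pi \<and> cis \<theta> = u" if u: "cmod u = 1" for u
    proof -
      have "cis (Arg2pi u) = u"
        using Arg2pi_eq[of u] u by (metis cis_conv_exp mult_1 of_real_1)
      then show ?thesis
        using Arg2pi_ge_0[of u] Arg2pi_lt_2pi[of u] by (intro exI[of _ "Arg2pi u"]) auto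
    qed
    moreover have "cmod (if z $ j = 0 then 1 else w $ j / z $ j) = 1"
      using assms(3)[of j] by (auto simp: norm_divide)
    ultimately obtain \<theta> where "0 \<le> \<theta>" "\<theta> \<le> 2 * pi" "cis \<theta> = (if z $ j = 0 then 1 else w $ j / z $ j)"
      by blast
    moreover have "w $ j = 0" if "z $ j = 0"
      using assms(3)[of j] that by simp
    ultimately show ?thesis
      by (intro exI[of _ \<theta>]) (auto simp: cis_conv_exp mult.commute split: if_splits)
  qed
  then obtain \<theta> where "\<And>j. 0 \<le> \<theta> j \<and> \<theta> j \<le> 2 * pi \<and> exp (\<i> * of_real (\<theta> j)) * z $ j = w $ j"
    by metis
  then have "w = (\<chi> j. exp (\<i> * of_real ((\<chi> j. \<theta> j) $ j)) * z $ j)"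
    and "\<forall>j. 0 \<le> (\<chi> j. \<theta> j) $ j \<and> (\<chi> j. \<theta> j) $ j \<le> 2 * pi"
    by (auto simp: vec_eq_iff)
  then show ?thesis
    using assms(1,2) unfolding reinhardt_def by metis
qed

section \<open>The gradient of a defining function in logarithmic coordinates\<close>

lemma defining_function_closure:
  assumes "smooth_defining_function \<Omega> \<rho>" "z \<in> closure \<Omega>"
  shows "\<rho> z \<le> 0"
proof (cases "z \<in> \<Omega>")
  case True
  then show ?thesis using assms(1) by (auto simp: smooth_defining_function_def)
next
  case False
  then have "z \<in> frontier \<Omega>"
    using assms(2) by (metis DiffI frontier_def interior_subset subsetD)
  then show ?thesis using assms(1) by (simp add: smooth_defining_function_def)
qed

lemma notin_iff_nonneg:
  assumes "smooth_defining_function \<Omega> \<rho>"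
  shows "z \<notin> \<Omega> \<longleftrightarrow> 0 \<le> \<rho> z"
  using assms by (auto simp: smooth_defining_function_def)

lemma DERIV_le_0_of_nonpos_right:
  fixes \<phi> :: "real \<Rightarrow> real"
  assumes "(\<phi> has_real_derivative d) (at 0)" "\<phi> 0 = 0" "\<And>s. 0 < s \<Longrightarrow> s < 1 \<Longrightarrow> \<phi> s \<le> 0"
  shows "d \<le> 0"
proof (rule ccontr)
  assume "\<not> d \<le> 0"
  then obtain c where "0 < c" "\<And>h. 0 < h \<Longrightarrow> h < c \<Longrightarrow> 0 < \<phi> h"
    using DERIV_pos_inc_right[OF assms(1)] assms(2) by auto
  moreover have "0 < min c 1 / 2" "min c 1 / 2 < c" "min c 1 / 2 < 1"
    using \<open>0 < c\<close> by auto
  ultimately show False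
    using assms(3)[of "min c 1 / 2"] by (meson not_le)
qed

text \<open>Not \<rho> itself but only its sign is invariant under rotations. Rotating one
  coordinate keeps p outside \<Omega>, so \<rho> has a minimum at p along the orbit and D vanishes
  in direction \<i> p_j. Where p_j = 0, negating the increment in that coordinate preserves the sign
  of \<rho>, which excludes a nonzero derivative; the convention v_j / 0 = 0 fits this case.\<close>

lemma reinhardt_gradient:
  fixes \<rho> :: "complex ^ 'n \<Rightarrow> real"
  assumes R: "reinhardt \<Omega>" and def: "smooth_defining_function \<Omega> \<rho>"
    and D: "(\<rho> has_derivative D) (at p)" and p: "\<rho> p = 0"
  shows "D v = (\<Sum>j\<in>UNIV. D (axis j (p $ j)) * Re (v $ j / p $ j))"
proof -
  have lin: "linear D" using D has_derivative_linear by blast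
  have pO: "p \<notin> \<Omega>" using notin_iff_nonneg[OF def] p by simp
  have tangential: "D (axis j (\<i> * p $ j)) = 0" for j
  proof -
    define q where "q = (\<lambda>t :: real. p + axis j ((cis t - 1) * p $ j))"
    have "((\<lambda>t. axis j ((cis t - 1) * p $ j)) has_vector_derivative axis j ((\<i> * cis 0 - 0) * p $ j)) (at 0)"
    proof -
      have "(cis has_vector_derivative \<i> * cis 0) (at 0)"
        unfolding has_vector_derivative_complex_iff by (auto intro!: derivative_eq_intros)
      then show ?thesis
        by (intro bounded_linear.has_vector_derivative[OF bounded_linear_axis] has_vector_derivative_mult_left
          has_vector_derivative_diff has_vector_derivative_const)
    qed
    then have "(q has_vector_derivative axis j (\<i> * p $ j)) (at 0)"
      unfolding q_def by (auto intro!: derivative_eq_intros)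
    moreover have "q 0 = p" by (simp add: q_def axis_def vec_eq_iff)
    ultimately have "((\<lambda>t. \<rho> (q t)) has_derivative (\<lambda>t. D (t *\<^sub>R axis j (\<i> * p $ j)))) (at 0)"
      using has_derivative_compose[of q _ 0 UNIV \<rho> D] D by (simp add: has_vector_derivative_def)
    then have "((\<lambda>t. \<rho> (q t)) has_real_derivative D (axis j (\<i> * p $ j))) (at 0)"
      by (simp add: linear_scale[OF lin] has_field_derivative_def mult_commute_abs)
    moreover have "0 \<le> \<rho> (q t)" for t
    proof -
      have "cmod (q t $ k) = cmod (p $ k)" for k
        by (simp add: q_def axis_def algebra_simps norm_mult)
      then have "q t \<notin> \<Omega>"
        using reinhardt_moduli[OF R, of "q t" p] pO by metis
      then show ?thesis using notin_iff_nonneg[OF def] by blast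
    qed
    ultimately show ?thesis
      using DERIV_local_min[of "\<lambda>t. \<rho> (q t)" _ 0 1] \<open>q 0 = p\<close> p by auto
  qed
  have zero: "D (axis j w) = 0" if pj: "p $ j = 0" for j w
  proof -
    have d: "((\<lambda>t. \<rho> (p + t *\<^sub>R axis j w)) has_real_derivative D (axis j w)) (at 0)"
      using has_vector_derivative_along_line[of \<rho> D p 0 "axis j w"] D
      by (simp add: has_real_derivative_iff_has_vector_derivative)
    have sym: "\<rho> (p + t *\<^sub>R axis j w) < 0 \<longleftrightarrow> \<rho> (p + (- t) *\<^sub>R axis j w) < 0" for t
    proof -
      have "cmod ((p + t *\<^sub>R axis j w) $ k) = cmod ((p + (- t) *\<^sub>R axis j w) $ k)" for k
        using pj by (simp add: axis_def)
      then have "p + t *\<^sub>R axis j w \<in> \<Omega> \<longleftrightarrow> p + (- t) *\<^sub>R axis j w \<in> \<Omega>"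
        using reinhardt_moduli[OF R] by metis
      then show ?thesis
        using notin_iff_nonneg[OF def] by (metis not_le)
    qed
    show ?thesis
    proof (rule ccontr)
      assume "D (axis j w) \<noteq> 0"
      then consider "D (axis j w) < 0" | "0 < D (axis j w)" by linarith
      then show False
      proof cases
        case 1
        obtain d1 where "0 < d1" "\<And>h. 0 < h \<Longrightarrow> h < d1 \<Longrightarrow> \<rho> (p + h *\<^sub>R axis j w) < 0"
          using DERIV_neg_dec_right[OF d 1] p by auto
        moreover obtain d2 where "0 < d2" "\<And>h. 0 < h \<Longrightarrow> h < d2 \<Longrightarrow> 0 < \<rho> (p + (- h) *\<^sub>R axis j w)"
          using DERIV_neg_dec_left[OF d 1] p by auto
        ultimately show False
          using sym[of "min d1 d2 / 2"] by (smt (verit) field_sum_of_halves min_def)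
      next
        case 2
        obtain d1 where "0 < d1" "\<And>h. 0 < h \<Longrightarrow> h < d1 \<Longrightarrow> 0 < \<rho> (p + h *\<^sub>R axis j w)"
          using DERIV_pos_inc_right[OF d 2] p by auto
        moreover obtain d2 where "0 < d2" "\<And>h. 0 < h \<Longrightarrow> h < d2 \<Longrightarrow> \<rho> (p + (- h) *\<^sub>R axis j w) < 0"
          using DERIV_pos_inc_left[OF d 2] p by auto
        ultimately show False
          using sym[of "min d1 d2 / 2"] by (smt (verit) field_sum_of_halves min_def)
      qed
    qed
  qed
  have "D (axis j (v $ j)) = D (axis j (p $ j)) * Re (v $ j / p $ j)" for j
  proof (cases "p $ j = 0")
    case True
    then show ?thesis using zero by simp
  next
    case False
    define q where "q = v $ j / p $ j"
    have "axis j (v $ j) = Re q *\<^sub>R axis j (p $ j) + Im q *\<^sub>R (axis j (\<i> * p $ j) :: complex ^ 'n)"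
    proof -
      have "v $ j = (of_real (Re q) + \<i> * of_real (Im q)) * p $ j"
        using False complex_eq[of q] by (simp add: q_def)
      then show ?thesis
        by (simp add: vec_eq_iff axis_def) (simp add: scaleR_conv_of_real algebra_simps)
    qed
    then show ?thesis
      using tangential by (simp add: linear_add[OF lin] linear_scale[OF lin] q_def)
  qed
  moreover have "D v = (\<Sum>j\<in>UNIV. D (axis j (v $ j)))"
    using linear_sum[OF lin, of "\<lambda>j. axis j (v $ j)" UNIV] by (simp add: sum_axis)
  ultimately show ?thesis by simp
qed

text \<open>
  The gradient with respect to \<open>log \<bar>z\<^sub>j\<bar>\<close>. It vanishes in the coordinates where \<open>p\<close> does and
  serves as the direction \<open>e\<close> transversal to the boundary.
\<close>

definition log_gradient :: "(complex ^ 'n \<Rightarrow> real) \<Rightarrow> complex ^ 'n \<Rightarrow> real ^ 'n" where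
  "log_gradient \<rho> p = (\<chi> j. fderiv \<rho> p (axis j (p $ j)))"

text \<open>Along the translations c \<mapsto> \<open>scale (c *\<^sub>R e) z\<close> the function
  \<rho> grows at rate at least \<kappa>, with the same rate for all starting points near p. The
  integrated form converts distances along e directly into values of \<rho>.\<close>

definition transversal ::
    "(complex ^ 'n \<Rightarrow> real) \<Rightarrow> complex ^ 'n \<Rightarrow> real ^ 'n \<Rightarrow> real \<Rightarrow> real \<Rightarrow> real \<Rightarrow> bool" where
  "transversal \<rho> p e \<delta> a \<kappa> \<longleftrightarrow> 0 < \<delta> \<and> 0 < a \<and> 0 < \<kappa> \<and>
     (\<forall>z\<in>ball p \<delta>. \<forall>c c'. - a \<le> c \<longrightarrow> c \<le> c' \<longrightarrow> c' \<le> a \<longrightarrow>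
        \<rho> (scale (c *\<^sub>R e) z) + \<kappa> * (c' - c) \<le> \<rho> (scale (c' *\<^sub>R e) z))"

lemma transversalD:
  assumes "transversal \<rho> p e \<delta> a \<kappa>" "z \<in> ball p \<delta>" "- a \<le> c" "c \<le> c'" "c' \<le> a"
  shows "\<rho> (scale (c *\<^sub>R e) z) + \<kappa> * (c' - c) \<le> \<rho> (scale (c' *\<^sub>R e) z)"
  using assms unfolding transversal_def by blast

lemma transversal_pos: "transversal \<rho> p e \<delta> a \<kappa> \<Longrightarrow> 0 < \<delta> \<and> 0 < a \<and> 0 < \<kappa>"
  by (simp add: transversal_def)

lemma log_gradient_formula:
  assumes R: "reinhardt \<Omega>" and def: "smooth_defining_function \<Omega> \<rho>" and p: "p \<in> frontier \<Omega>"
  shows "fderiv \<rho> p v = (\<Sum>j\<in>UNIV. log_gradient \<rho> p $ j * Re (v $ j / p $ j))"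
    and "log_gradient \<rho> p \<noteq> 0"
proof -
  obtain U where U: "open U" "frontier \<Omega> \<subseteq> U" "smooth_on U \<rho>"
    and 0: "\<rho> p = 0" "fderiv \<rho> p \<noteq> (\<lambda>v. 0)"
    using def p unfolding smooth_defining_function_def by blast
  have D: "(\<rho> has_derivative fderiv \<rho> p) (at p)"
    using smooth_on_has_derivative[OF U(3)] U(2) p by blast
  show f: "fderiv \<rho> p v = (\<Sum>j\<in>UNIV. log_gradient \<rho> p $ j * Re (v $ j / p $ j))" for v
    unfolding log_gradient_def vec_lambda_beta by (rule reinhardt_gradient[OF R def D 0(1)])
  show "log_gradient \<rho> p \<noteq> 0"
  proof
    assume "log_gradient \<rho> p = 0"
    then have "fderiv \<rho> p v = 0" for v using f[of v] by simp
    then show False using 0(2) by blast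
  qed
qed

text \<open>At p the derivative of \<rho> along the translations is N, the squared norm of the
  logarithmic gradient. By continuity it exceeds N / 2 nearby, and the mean value theorem gives
  \<kappa> = N / 2.\<close>

lemma transversal_exists:
  fixes \<rho> :: "complex ^ 'n \<Rightarrow> real"
  assumes R: "reinhardt \<Omega>" and def: "smooth_defining_function \<Omega> \<rho>" and p: "p \<in> frontier \<Omega>"
  obtains \<delta> a \<kappa> where "transversal \<rho> p (log_gradient \<rho> p) \<delta> a \<kappa>"
proof -
  let ?e = "log_gradient \<rho> p"
  obtain U where U: "open U" "frontier \<Omega> \<subseteq> U" "smooth_on U \<rho>"
    using def unfolding smooth_defining_function_def by blast
  have pU: "p \<in> U" using U(2) p by blast
  define m where "m = (\<lambda>z. \<chi> j. of_real (?e $ j) * z $ j :: complex ^ 'n)"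
  define h where "h = (\<lambda>z. fderiv \<rho> z (m z))"
  define N where "N = (\<Sum>j\<in>UNIV. (?e $ j)\<^sup>2)"
  have "N \<noteq> 0"
    using log_gradient_formula(2)[OF R def p]
    by (auto simp: N_def sum_nonneg_eq_0_iff vec_eq_iff)
  then have N: "0 < N" by (simp add: N_def less_le sum_nonneg)
  have zero: "?e $ j = 0" if "p $ j = 0" for j
  proof -
    have "linear (fderiv \<rho> p)"
      using smooth_on_has_derivative[OF U(3) pU] has_derivative_linear by blast
    moreover have "axis j (p $ j) = (0 :: complex ^ 'n)"
      using that by (simp add: axis_def vec_eq_iff)
    ultimately show ?thesis
      unfolding log_gradient_def by (metis linear_0 vec_lambda_beta)
  qed
  have "?e $ j * Re (m p $ j / p $ j) = (?e $ j)\<^sup>2" for j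
    using zero[of j] by (cases "p $ j = 0") (auto simp: m_def power2_eq_square)
  then have hp: "h p = N"
    unfolding h_def N_def log_gradient_formula(1)[OF R def p] by simp
  have h_sum: "h z = (\<Sum>b\<in>Basis. (m z \<bullet> b) * fderiv \<rho> z b)" if "z \<in> U" for z
  proof -
    have L: "linear (fderiv \<rho> z)"
      using smooth_on_has_derivative[OF U(3) that] has_derivative_linear by blast
    have "h z = fderiv \<rho> z (\<Sum>b\<in>Basis. (m z \<bullet> b) *\<^sub>R b)"
      by (simp add: h_def euclidean_representation)
    then show ?thesis
      by (simp add: linear_sum[OF L] linear_scale[OF L])
  qed
  have "continuous_on U (\<lambda>z. fderiv \<rho> z b)" for b
    using smooth_on_frechet[OF U(3)] Ck_on_continuous smooth_on_Ck by blast
  then have "continuous_on U (\<lambda>z. \<Sum>b\<in>Basis. (m z \<bullet> b) * fderiv \<rho> z b)"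
    unfolding m_def by (intro continuous_intros) auto
  then have "continuous_on U h"
    using h_sum by (simp cong: continuous_on_cong)
  note cont_h = this
  define W where "W = U \<inter> h -` {N / 2 <..}"
  have "open W"
    unfolding W_def using cont_h U(1) by (intro continuous_open_preimage) auto
  then have "open ((\<lambda>x. scale (fst x *\<^sub>R ?e) (snd x)) -` W)"
    by (rule open_vimage) (intro continuous_intros)
  moreover have "(0, p) \<in> (\<lambda>x. scale (fst x *\<^sub>R ?e) (snd x)) -` W"
    using hp N pU by (simp add: W_def)
  ultimately obtain A B where A: "open A" and B: "open B" and 0: "(0, p) \<in> A \<times> B" and sub:
    "A \<times> B \<subseteq> (\<lambda>x. scale (fst x *\<^sub>R ?e) (snd x)) -` W"
    by (rule open_prod_elim)
  then have AB: "open A" "open B" "0 \<in> A" "p \<in> B"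
    "A \<times> B \<subseteq> (\<lambda>x. scale (fst x *\<^sub>R ?e) (snd x)) -` W"
    by auto
  obtain a where a: "0 < a" "cball 0 a \<subseteq> A" using AB(1,3) open_contains_cball by blast
  obtain \<delta> where \<delta>: "0 < \<delta>" "ball p \<delta> \<subseteq> B" using AB(2,4) openE by blast
  have "\<rho> (scale (c *\<^sub>R ?e) z) + N / 2 * (c' - c) \<le> \<rho> (scale (c' *\<^sub>R ?e) z)"
    if z: "z \<in> ball p \<delta>" and c: "- a \<le> c" "c \<le> c'" "c' \<le> a" for z c c'
  proof (cases "c = c'")
    case False
    then have "c < c'" using c by simp
    have in_set: "scale (t *\<^sub>R ?e) z \<in> U" "N / 2 < h (scale (t *\<^sub>R ?e) z)" if "c \<le> t" "t \<le> c'" for t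
    proof -
      have "(t, z) \<in> A \<times> B"
        using that c a(2) \<delta>(2) z by (auto simp: subset_iff)
      then have "(t, z) \<in> (\<lambda>x. scale (fst x *\<^sub>R ?e) (snd x)) -` W"
        using AB(5) by blast
      then show "scale (t *\<^sub>R ?e) z \<in> U" "N / 2 < h (scale (t *\<^sub>R ?e) z)" by (auto simp: W_def)
    qed
    have "\<exists>t. c < t \<and> t < c' \<and> \<rho> (scale (c' *\<^sub>R ?e) z) - \<rho> (scale (c *\<^sub>R ?e) z) = (c' - c) * h (scale (t *\<^sub>R ?e) z)"
    proof (rule MVT2[OF \<open>c < c'\<close>])
      fix t assume t: "c \<le> t" "t \<le> c'"
      have "((\<lambda>t. scale (t *\<^sub>R ?e) z) has_vector_derivative m (scale (t *\<^sub>R ?e) z)) (at t)"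
        unfolding m_def by (rule scale_has_vector_derivative)
      moreover have D: "(\<rho> has_derivative fderiv \<rho> (scale (t *\<^sub>R ?e) z)) (at (scale (t *\<^sub>R ?e) z))"
        using smooth_on_has_derivative[OF U(3) in_set(1)[OF t]] .
      ultimately have "((\<lambda>t. \<rho> (scale (t *\<^sub>R ?e) z)) has_derivative
         (\<lambda>s. fderiv \<rho> (scale (t *\<^sub>R ?e) z) (s *\<^sub>R m (scale (t *\<^sub>R ?e) z)))) (at t)"
        unfolding has_vector_derivative_def using has_derivative_compose by blast
      then show "((\<lambda>t. \<rho> (scale (t *\<^sub>R ?e) z)) has_real_derivative h (scale (t *\<^sub>R ?e) z)) (at t)"
        by (simp add: linear_scale[OF has_derivative_linear[OF D]] h_def has_field_derivative_def mult_commute_abs)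
    qed
    then obtain t where t: "c < t" "t < c'"
      and eq: "\<rho> (scale (c' *\<^sub>R ?e) z) - \<rho> (scale (c *\<^sub>R ?e) z) = (c' - c) * h (scale (t *\<^sub>R ?e) z)" by blast
    have "(c' - c) * (N / 2) \<le> (c' - c) * h (scale (t *\<^sub>R ?e) z)"
      using in_set(2)[of t] t by (intro mult_left_mono) auto
    then show ?thesis using eq by (simp add: mult.commute)
  qed simp
  then have "transversal \<rho> p ?e \<delta> a (N / 2)"
    using \<delta> a N unfolding transversal_def by auto
  then show ?thesis using that by blast
qed

section \<open>Local logarithmic convexity\<close>

text \<open>Logarithmic coordinates are taken relative to p; where p_j = 0, the reference value 1
  makes x_j the logarithm of the modulus itself.\<close>

definition base_point :: "complex ^ 'n \<Rightarrow> complex ^ 'n" where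
  "base_point p = (\<chi> j. if p $ j = 0 then 1 else p $ j)"

lemma base_point_nth: "base_point p $ j = (if p $ j = 0 then 1 else p $ j)"
  by (simp add: base_point_def)

text \<open>Where p_j = 0 the neighbourhood |z_j| < H becomes the half-line below ln H, with z_j = 0
  at minus infinity. Points with zero coordinates, possibly p itself, are therefore reached only by
  limits.\<close>

definition log_box :: "complex ^ 'n \<Rightarrow> real \<Rightarrow> (real ^ 'n) set" where
  "log_box p H = {x. \<forall>j. if p $ j = 0 then x $ j < ln H else \<bar>x $ j\<bar> < H}"

definition log_domain :: "(complex ^ 'n) set \<Rightarrow> complex ^ 'n \<Rightarrow> real \<Rightarrow> (real ^ 'n) set" where
  "log_domain \<Omega> p H = {x \<in> log_box p H. scale x (base_point p) \<in> \<Omega>}"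

lemma norm_less_of_components:
  fixes z :: "complex ^ 'n"
  assumes "\<And>j. cmod (z $ j) < E / CARD('n)"
  shows "norm z < E"
proof -
  have "norm z \<le> (\<Sum>j\<in>UNIV. cmod (z $ j))" by (rule norm_le_sum_components)
  also have "\<dots> < (\<Sum>j\<in>(UNIV :: 'n set). E / CARD('n))"
    by (rule sum_strict_mono) (use assms in auto)
  also have "\<dots> = E" by simp
  finally show ?thesis .
qed

lemma log_box_near:
  fixes p :: "complex ^ 'n"
  assumes "0 < E"
  obtains H where "0 < H" "\<And>H' x. H' \<le> H \<Longrightarrow> 0 < H' \<Longrightarrow> x \<in> log_box p H' \<Longrightarrow> scale x (base_point p) \<in> ball p E"
proof -
  define E' where "E' = E / CARD('n)"
  have e': "0 < E'" using assms by (simp add: E'_def)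
  have "\<exists>h>0. \<forall>t. (if p $ j = 0 then t < ln h else \<bar>t\<bar> < h) \<longrightarrow>
     cmod (of_real (exp t) * base_point p $ j - p $ j) < E'" for j
  proof (cases "p $ j = 0")
    case True
    have "exp t < E'" if "t < ln E'" for t
      using that e' by (metis exp_less_cancel_iff exp_ln)
    then show ?thesis using True e' by (auto simp: base_point_nth intro!: exI[of _ E'])
  next
    case False
    have "isCont (\<lambda>t. of_real (exp t) * p $ j - p $ j) 0"
      by (intro continuous_intros)
    then obtain h where "0 < h" "\<And>t. \<bar>t\<bar> < h \<Longrightarrow> cmod (of_real (exp t) * p $ j - p $ j) < E'"
      unfolding continuous_at_eps_delta using e' by (auto simp: dist_norm)
    then show ?thesis using False by (auto simp: base_point_nth)
  qed
  then obtain h where h: "\<And>j. 0 < h j" "\<And>j t. (if p $ j = 0 then t < ln (h j) else \<bar>t\<bar> < h j) \<Longrightarrow>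
     cmod (of_real (exp t) * base_point p $ j - p $ j) < E'" by metis
  define H where "H = Min (range h)"
  have H: "0 < H" "\<And>j. H \<le> h j" using h(1) by (auto simp: H_def)
  have "scale x (base_point p) \<in> ball p E" if "H' \<le> H" "0 < H'" "x \<in> log_box p H'" for H' x
  proof -
    have "cmod ((scale x (base_point p) - p) $ j) < E'" for j
    proof -
      have "H' \<le> h j" using H(2)[of j] that(1) by linarith
      moreover from this have "ln H' \<le> ln (h j)" using that(2) h(1) by simp
      moreover have "if p $ j = 0 then x $ j < ln H' else \<bar>x $ j\<bar> < H'"
        using that(3) by (auto simp: log_box_def)
      ultimately have "if p $ j = 0 then x $ j < ln (h j) else \<bar>x $ j\<bar> < h j"
        by (auto split: if_splits)
      from h(2)[OF this] show ?thesis by simp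
    qed
    then have "norm (scale x (base_point p) - p) < E"
      unfolding E'_def by (rule norm_less_of_components)
    then show ?thesis by (simp add: dist_norm norm_minus_commute)
  qed
  then show ?thesis using H(1) that by blast
qed

lemma convex_log_box: "convex (log_box p H)"
proof (rule convexI)
  fix x y and u v :: real
  assume xy: "x \<in> log_box p H" "y \<in> log_box p H" and uv: "0 \<le> u" "0 \<le> v" "u + v = 1"
  have "if p $ j = 0 then u * x $ j + v * y $ j < ln H else \<bar>u * x $ j + v * y $ j\<bar> < H" for j
  proof (cases "p $ j = 0")
    case True
    then have "x $ j < ln H" "y $ j < ln H"
      using xy by (auto simp: log_box_def)
    then show ?thesis using convex_bound_lt[OF _ _ uv] True by simp
  next
    case False
    then have "\<bar>x $ j\<bar> < H" "\<bar>y $ j\<bar> < H"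
      using xy by (auto simp: log_box_def)
    then have "u * x $ j + v * y $ j < H" "u * (- x $ j) + v * (- y $ j) < H"
      by (intro convex_bound_lt[OF _ _ uv]; simp)+
    then show ?thesis using False by (simp add: abs_less_iff)
  qed
  then show "u *\<^sub>R x + v *\<^sub>R y \<in> log_box p H"
    by (simp add: log_box_def)
qed

lemma open_log_box: "open (log_box p H)"
proof -
  have "log_box p H = (\<Inter>j\<in>UNIV. {x. if p $ j = 0 then x $ j < ln H else \<bar>x $ j\<bar> < H})"
    by (auto simp: log_box_def)
  moreover have "open {x :: real ^ 'a. if p $ j = 0 then x $ j < ln H else \<bar>x $ j\<bar> < H}" for j
    by (cases "p $ j = 0") (auto intro!: open_Collect_less continuous_intros)
  ultimately show ?thesis by (simp only:) (rule open_INT, auto)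
qed

lemma open_log_domain:
  assumes "open \<Omega>"
  shows "open (log_domain \<Omega> p H)"
proof -
  have "open ((\<lambda>x. scale x (base_point p)) -` \<Omega>)"
    by (rule open_vimage[OF assms]) (intro continuous_intros)
  then have "open (log_box p H \<inter> (\<lambda>x. scale x (base_point p)) -` \<Omega>)"
    using open_log_box by blast
  moreover have "log_domain \<Omega> p H = log_box p H \<inter> (\<lambda>x. scale x (base_point p)) -` \<Omega>"
    by (auto simp: log_domain_def)
  ultimately show ?thesis by simp
qed

lemma scale_path_open:
  assumes "open \<Omega>" "z \<in> \<Omega>"
  obtains \<mu> where "0 < \<mu>" "\<And>c. \<bar>c\<bar> \<le> \<mu> \<Longrightarrow> scale (c *\<^sub>R e) z \<in> \<Omega>"
proof -
  have "open ((\<lambda>c. scale (c *\<^sub>R e) z) -` \<Omega>)"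
    by (rule open_vimage[OF assms(1)]) (intro continuous_intros)
  moreover have "0 \<in> (\<lambda>c. scale (c *\<^sub>R e) z) -` \<Omega>" using assms(2) by simp
  ultimately obtain \<mu> where "0 < \<mu>" "cball 0 \<mu> \<subseteq> (\<lambda>c. scale (c *\<^sub>R e) z) -` \<Omega>"
    using open_contains_cball by blast
  then show ?thesis using that[of \<mu>] by (auto simp: subset_iff)
qed

text \<open>
  If the segment left the domain, then lowering the bent segment
  \<open>s \<mapsto> x(s) - E s (1 - s) e\<close> until it just touches the complement would produce a holomorphic disc
  touching the boundary from inside, whose complexified parameter \<open>s + i t\<close> gains \<open>- E t\<^sup>2\<close> in
  the direction \<open>e\<close>.
\<close>

lemma log_domain_convex:
  assumes \<Omega>: "open \<Omega>" and R: "reinhardt \<Omega>" and def: "smooth_defining_function \<Omega> \<rho>"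
    and levi: "\<And>z t. z \<in> frontier \<Omega> \<Longrightarrow>
           (\<Sum>j\<in>UNIV. wirt (axis j) (\<lambda>w. of_real (\<rho> w)) z * t $ j) = 0 \<Longrightarrow>
           0 \<le> Re (levi_form \<rho> z t)"
    and p: "p \<in> frontier \<Omega>" and T: "transversal \<rho> p e \<delta> a \<kappa>"
  obtains H0 where "0 < H0" "\<And>H. 0 < H \<Longrightarrow> H \<le> H0 \<Longrightarrow> convex (log_domain \<Omega> p H)"
proof -
  obtain U where U: "open U" "frontier \<Omega> \<subseteq> U" "smooth_on U \<rho>" "\<rho> p = 0"
    using def p unfolding smooth_defining_function_def by blast
  have \<Omega>_iff: "z \<in> \<Omega> \<longleftrightarrow> \<rho> z < 0" for z
    using notin_iff_nonneg[OF def, of z] by linarith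
  have pos: "0 < \<delta>" "0 < a" "0 < \<kappa>" using transversal_pos[OF T] by auto
  have "\<rho> (scale ((- a) *\<^sub>R e) p) + \<kappa> * (0 - (- a)) \<le> \<rho> (scale (0 *\<^sub>R e) p)"
    by (rule transversalD[OF T]) (use pos in auto)
  then have "scale ((- a) *\<^sub>R e) p \<in> \<Omega>"
    using \<Omega>_iff U(4) mult_pos_pos[OF pos(3,2)] by simp
  moreover have "open ((\<lambda>z. scale ((- a) *\<^sub>R e) z) -` \<Omega>)"
    by (rule open_vimage[OF \<Omega>]) (intro continuous_intros)
  \<comment> \<open>Points near p enter \<Omega> when translated by - a; this later keeps the
    touching parameter d0 away from the end - a of its interval.\<close>
  ultimately obtain E1 where e1: "0 < E1" "ball p E1 \<subseteq> (\<lambda>z. scale ((- a) *\<^sub>R e) z) -` \<Omega>"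
    by (meson openE vimageI)
  obtain H0 where H0: "0 < H0" "\<And>H x. H \<le> H0 \<Longrightarrow> 0 < H \<Longrightarrow> x \<in> log_box p H \<Longrightarrow> scale x (base_point p) \<in> ball p (min \<delta> E1)"
    using log_box_near[of "min \<delta> E1" p] pos(1) e1(1) by auto
  let ?P = "base_point p"
  have "convex (log_domain \<Omega> p H)" if H: "0 < H" "H \<le> H0" for H
  proof (rule ccontr)
    assume "\<not> convex (log_domain \<Omega> p H)"
    then obtain x y s1 where x: "x \<in> log_domain \<Omega> p H" and y: "y \<in> log_domain \<Omega> p H"
      and s1: "0 \<le> s1" "s1 \<le> 1" "(1 - s1) *\<^sub>R x + s1 *\<^sub>R y \<notin> log_domain \<Omega> p H"
      unfolding convex_alt by blast
    define X where "X = (\<lambda>s :: real. (1 - s) *\<^sub>R x + s *\<^sub>R y)"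
    have X_box: "X s \<in> log_box p H" if "0 \<le> s" "s \<le> 1" for s
      using convex_log_box[of p H] x y that unfolding X_def convex_alt log_domain_def by blast
    then have near: "scale (X s) ?P \<in> ball p \<delta>" "scale (X s) ?P \<in> ball p E1" if "0 \<le> s" "s \<le> 1" for s
      using H0(2)[OF H(2,1) X_box[OF that]] by auto
    have s1_out: "scale (X s1) ?P \<notin> \<Omega>"
      using s1 X_box[of s1] by (auto simp: log_domain_def X_def)
    have X01: "X 0 = x" "X 1 = y" by (simp_all add: X_def)
    have xy: "scale x ?P \<in> \<Omega>" "scale y ?P \<in> \<Omega>" using x y by (auto simp: log_domain_def)
    obtain \<mu>1 where \<mu>1: "0 < \<mu>1" "\<And>c. \<bar>c\<bar> \<le> \<mu>1 \<Longrightarrow> scale (c *\<^sub>R e) (scale x ?P) \<in> \<Omega>"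
      using scale_path_open[OF \<Omega> xy(1)] by blast
    obtain \<mu>2 where \<mu>2: "0 < \<mu>2" "\<And>c. \<bar>c\<bar> \<le> \<mu>2 \<Longrightarrow> scale (c *\<^sub>R e) (scale y ?P) \<in> \<Omega>"
      using scale_path_open[OF \<Omega> xy(2)] by blast
    \<comment> \<open>Translating the end points x and y by up to E along e does not leave \<Omega>,
      which forces the touching to occur at an interior parameter.\<close>
    define E where "E = min a (min \<mu>1 \<mu>2)"
    have E: "0 < E" "E \<le> a" "E \<le> \<mu>1" "E \<le> \<mu>2" using pos \<mu>1 \<mu>2 by (auto simp: E_def)
    have mono: "scale (d *\<^sub>R e) (scale (X s) ?P) \<in> \<Omega>"
      if "0 \<le> s" "s \<le> 1" "- a \<le> d" "d \<le> d'" "d' \<le> a" "scale (d' *\<^sub>R e) (scale (X s) ?P) \<in> \<Omega>" for s d d'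
    proof -
      have "\<rho> (scale (d *\<^sub>R e) (scale (X s) ?P)) + \<kappa> * (d' - d) \<le> \<rho> (scale (d' *\<^sub>R e) (scale (X s) ?P))"
        by (rule transversalD[OF T]) (use near that in auto)
      moreover have "0 \<le> \<kappa> * (d' - d)" using pos that by simp
      ultimately show ?thesis using that(6) \<Omega>_iff by fastforce
    qed
    define Kf where "Kf = (\<lambda>sd :: real \<times> real. scale (snd sd *\<^sub>R e) (scale (X (fst sd)) ?P))"
    define K where "K = ({0..1} \<times> {-a..a}) \<inter> Kf -` (- \<Omega>)"
    have contKf: "continuous_on UNIV Kf"
      unfolding Kf_def X_def by (intro continuous_intros)
    have "closed (Kf -` (- \<Omega>))"
      by (rule closed_vimage[OF _ contKf]) (use \<Omega> in auto)
    then have "compact K"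
      unfolding K_def by (intro compact_Int_closed compact_Times) auto
    have inK: "(s1, 0) \<in> K"
      using s1 s1_out pos by (auto simp: K_def Kf_def)
    \<comment> \<open>The value m (s, d) is the height b at which the bent curve s \<mapsto> X(s) +
      (b - E s (1 - s)) e passes through the point with parameters (s, d). Its minimum over K is the
      height of first contact with the complement.\<close>
    define m where "m = (\<lambda>sd :: real \<times> real. snd sd + E * (fst sd * (1 - fst sd)))"
    have "continuous_on K m"
      unfolding m_def by (intro continuous_intros)
    then obtain sd0 where sd0: "sd0 \<in> K" "\<And>sd. sd \<in> K \<Longrightarrow> m sd0 \<le> m sd"
      using continuous_attains_inf[OF \<open>compact K\<close>, of m] inK by blast
    obtain s0 d0 where sd: "sd0 = (s0, d0)" by (cases sd0)
    have s0: "0 \<le> s0" "s0 \<le> 1" "- a \<le> d0" "d0 \<le> a" "scale (d0 *\<^sub>R e) (scale (X s0) ?P) \<notin> \<Omega>"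
      using sd0(1) by (auto simp: K_def Kf_def sd)
    have quarter: "0 \<le> s * (1 - s) \<and> s * (1 - s) \<le> 1 / 4" if "0 \<le> s" "s \<le> 1" for s :: real
    proof -
      have "1 / 4 - s * (1 - s) = (s - 1 / 2)\<^sup>2" by (simp add: power2_eq_square field_simps)
      then show ?thesis using zero_le_power2[of "s - 1 / 2"] that by (smt (verit) mult_nonneg_nonneg)
    qed
    have below: "scale (d *\<^sub>R e) (scale (X s) ?P) \<in> \<Omega>"
      if "0 \<le> s" "s \<le> 1" "- a \<le> d" "d \<le> a" "d + E * (s * (1 - s)) < d0 + E * (s0 * (1 - s0))" for s d
      using sd0(2)[of "(s, d)"] that by (auto simp: K_def Kf_def sd m_def)
    have "m sd0 \<le> m (s1, 0)" using sd0(2) inK by blast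
    also have "\<dots> \<le> E * (1 / 4)"
      using mult_left_mono[OF conjunct2[OF quarter[OF s1(1,2)]], of E] E(1) by (simp add: m_def)
    finally have m0: "d0 + E * (s0 * (1 - s0)) \<le> E / 4" by (simp add: m_def sd)
    moreover have "0 \<le> E * (s0 * (1 - s0))" using quarter[OF s0(1,2)] E(1) by simp
    ultimately have d0_le: "d0 \<le> E / 4" by linarith
    then have d0_a: "d0 < a" using E by linarith
    have d0_ma: "- a < d0"
      using s0 near(2)[OF s0(1,2)] e1(2) by (cases "d0 = - a") auto
    have endpoint: "scale (d *\<^sub>R e) (scale (X s) ?P) \<in> \<Omega>"
      if "s = 0 \<or> s = 1" "- a \<le> d" "d \<le> E / 4" for s d
    proof -
      have "scale ((E / 4) *\<^sub>R e) (scale (X s) ?P) \<in> \<Omega>"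
        using that(1) \<mu>1(2)[of "E / 4"] \<mu>2(2)[of "E / 4"] E X01 by auto
      then show ?thesis
        using mono[of s d "E / 4"] that E by auto
    qed
    have s0_int: "0 < s0" "s0 < 1"
      using endpoint[of s0 d0] s0 d0_le by (metis less_eq_real_def)+
    define z0 where "z0 = scale (X s0) ?P"
    \<comment> \<open>The bent curve at s0 + z with z complex: the coefficient of e is the Taylor
      expansion of - E s (1 - s) about s0 without its constant term. The real part of E z^2
      contributes the gain - E (Im z)^2.\<close>
    define \<Phi> where "\<Phi> = (\<lambda>z. \<chi> j. z0 $ j * exp (z * of_real (y $ j - x $ j)
        + of_real (e $ j) * (- (of_real (E * (1 - 2 * s0)) * z) + of_real E * z\<^sup>2)))"
    define G where "G = (\<lambda>z. scale (d0 *\<^sub>R e) (\<Phi> z))"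
    have \<Phi>0: "\<Phi> 0 = z0" by (simp add: \<Phi>_def vec_eq_iff)
    have cont\<Phi>: "continuous_on UNIV \<Phi>"
      unfolding \<Phi>_def by (intro continuous_intros)
    have "open (\<Phi> -` ball p \<delta>)" using cont\<Phi> open_vimage by blast
    moreover have "0 \<in> \<Phi> -` ball p \<delta>" using near(1)[OF s0(1,2)] \<Phi>0 by (simp add: z0_def)
    ultimately obtain r1 where r1: "0 < r1" "ball 0 r1 \<subseteq> \<Phi> -` ball p \<delta>" by (meson openE)
    define g where "g = min (d0 + a) (a - d0)"
    have g: "0 < g" "g \<le> d0 + a" "g \<le> a - d0" using d0_a d0_ma by (auto simp: g_def)
    \<comment> \<open>The entries s0 and 1 - s0 keep s0 + Re z in [0, 1]; g / (8 E) keeps all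
      translation parameters below inside [- a, a].\<close>
    define r where "r = min (min r1 1) (min (min s0 (1 - s0)) (g / (8 * E)))"
    have r: "0 < r" "r \<le> r1" "r \<le> 1" "r \<le> s0" "r \<le> 1 - s0" "r \<le> g / (8 * E)"
      using r1 s0_int g E by (auto simp: r_def)
    have touch: "\<rho> (scale ((d0 + E * (Im z)\<^sup>2) *\<^sub>R e) (\<Phi> z)) \<le> 0" and small: "E * (Im z)\<^sup>2 \<le> g / 8"
      and closure: "scale ((d0 + E * (Im z)\<^sup>2) *\<^sub>R e) (\<Phi> z) \<in> closure \<Omega>"
      if z: "cmod z < r" for z
    proof -
      have ReIm: "\<bar>Re z\<bar> < r" "\<bar>Im z\<bar> < r"
        using z abs_Re_le_cmod[of z] abs_Im_le_cmod[of z] by linarith+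
      define q where "q = E * (- (1 - 2 * s0) * Re z + (Re z)\<^sup>2)"
      have sq: "t\<^sup>2 \<le> r" if "\<bar>t\<bar> < r" for t :: real
      proof -
        have "t\<^sup>2 = \<bar>t\<bar> * \<bar>t\<bar>" by (simp add: power2_eq_square)
        also have "\<dots> \<le> r * 1" using that r by (intro mult_mono) auto
        finally show ?thesis by simp
      qed
      have er: "E * r \<le> g / 8" using r(6) E(1) by (simp add: field_simps)
      have small': "E * (Im z)\<^sup>2 \<le> g / 8"
        using mult_left_mono[OF sq[OF ReIm(2)], of E] E(1) er by linarith
      then show "E * (Im z)\<^sup>2 \<le> g / 8" .
      have "\<bar>- (1 - 2 * s0) * Re z + (Re z)\<^sup>2\<bar> \<le> \<bar>1 - 2 * s0\<bar> * \<bar>Re z\<bar> + (Re z)\<^sup>2"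
        using abs_triangle_ineq[of "- (1 - 2 * s0) * Re z" "(Re z)\<^sup>2"] by (simp only: abs_mult abs_minus abs_power2)
      also have "\<dots> \<le> 1 * r + r"
        using ReIm(1) sq[OF ReIm(1)] s0 by (intro add_mono mult_mono) auto
      finally have "\<bar>q\<bar> \<le> E * (2 * r)"
        using E(1) by (simp add: q_def abs_mult)
      then have q: "\<bar>q\<bar> \<le> g / 4" using er by linarith
      define S where "S = s0 + Re z"
      have S: "0 \<le> S" "S \<le> 1" using ReIm(1) r by (auto simp: S_def)
      have bending: "q + E * (S * (1 - S)) = E * (s0 * (1 - s0))"
        by (simp add: q_def S_def power2_eq_square algebra_simps)
      \<comment> \<open>Just below the height d0 + E (Im z)^2 the translated point has the moduli of
        a point under the touching curve at S = s0 + Re z. Letting c tend to that height gives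
        membership in the closure.\<close>
      have in\<Omega>: "scale (c *\<^sub>R e) (\<Phi> z) \<in> \<Omega>"
        if c: "c < d0 + E * (Im z)\<^sup>2" "d0 + E * (Im z)\<^sup>2 - g / 2 < c" for c
      proof -
        define d where "d = c + q - E * (Im z)\<^sup>2"
        have "d \<le> a" "- a \<le> d"
          using c abs_le_D1[OF q] abs_le_D2[OF q] g unfolding d_def by linarith+
        moreover have "d + E * (S * (1 - S)) < d0 + E * (s0 * (1 - s0))"
          using bending c(1) by (simp add: d_def)
        ultimately have "scale (d *\<^sub>R e) (scale (X S) ?P) \<in> \<Omega>"
          using below[of S d] S by blast
        then show ?thesis
        proof (rule reinhardt_moduli[OF R])
          fix j
          have "X S $ j = X s0 $ j + Re z * (y $ j - x $ j)"
            by (simp add: X_def S_def algebra_simps)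
          moreover have "Re (z * of_real (y $ j - x $ j)
             + of_real (e $ j) * (- (of_real (E * (1 - 2 * s0)) * z) + of_real E * z\<^sup>2))
             = Re z * (y $ j - x $ j) + e $ j * (q - E * (Im z)\<^sup>2)"
            by (simp add: q_def power2_eq_square algebra_simps)
          ultimately show "cmod (scale (c *\<^sub>R e) (\<Phi> z) $ j) = cmod (scale (d *\<^sub>R e) (scale (X S) ?P) $ j)"
            by (simp add: \<Phi>_def z0_def norm_mult d_def exp_add[symmetric] algebra_simps)
        qed
      qed
      show "scale ((d0 + E * (Im z)\<^sup>2) *\<^sub>R e) (\<Phi> z) \<in> closure \<Omega>"
      proof (rule Lim_in_closed_set)
        let ?c = "d0 + E * (Im z)\<^sup>2"
        have "((\<lambda>c. scale (c *\<^sub>R e) (\<Phi> z)) \<longlongrightarrow> scale (?c *\<^sub>R e) (\<Phi> z)) (at ?c within UNIV)"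
          using continuous_on_def[of UNIV "\<lambda>c. scale (c *\<^sub>R e) (\<Phi> z)"] by (auto intro!: continuous_intros)
        then show "((\<lambda>c. scale (c *\<^sub>R e) (\<Phi> z)) \<longlongrightarrow> scale (?c *\<^sub>R e) (\<Phi> z)) (at_left ?c)"
          by (rule tendsto_within_subset) auto
        have "\<forall>\<^sub>F c in at_left ?c. c \<in> {?c - g / 2<..<?c}"
          using g(1) by (intro eventually_at_leftI[of "?c - g / 2"]) auto
        then show "\<forall>\<^sub>F c in at_left ?c. scale (c *\<^sub>R e) (\<Phi> z) \<in> closure \<Omega>"
          by eventually_elim (use in\<Omega> closure_subset in auto)
      qed auto
      then show "\<rho> (scale ((d0 + E * (Im z)\<^sup>2) *\<^sub>R e) (\<Phi> z)) \<le> 0"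
        by (rule defining_function_closure[OF def])
    qed
    have inside: "\<rho> (G z) \<le> - (\<kappa> * E) * (Im z)\<^sup>2" if z: "cmod z < r" for z
    proof -
      have e0: "0 \<le> E * (Im z)\<^sup>2" using E(1) by simp
      have "\<rho> (scale (d0 *\<^sub>R e) (\<Phi> z)) + \<kappa> * ((d0 + E * (Im z)\<^sup>2) - d0) \<le> \<rho> (scale ((d0 + E * (Im z)\<^sup>2) *\<^sub>R e) (\<Phi> z))"
      proof (rule transversalD[OF T])
        have "z \<in> ball 0 r1" using z r by simp
        then show "\<Phi> z \<in> ball p \<delta>" using r1(2) by blast
        show "d0 + E * (Im z)\<^sup>2 \<le> a" using small[OF z] g by linarith
      qed (use s0 e0 in auto)
      then show ?thesis using touch[OF z] by (simp add: G_def)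
    qed
    have G0: "G 0 = scale (d0 *\<^sub>R e) (scale (X s0) ?P)"
      by (simp add: G_def \<Phi>0 z0_def)
    have "G 0 \<in> closure \<Omega>"
      using closure[of 0] r(1) by (simp add: G_def)
    then have fr: "G 0 \<in> frontier \<Omega>"
      using s0(5) \<Omega> by (simp add: G0 frontier_def interior_open)
    have hol: "(\<lambda>z. G z $ j) holomorphic_on UNIV" for j
      unfolding G_def \<Phi>_def by (simp, intro holomorphic_intros)
    show False
    proof (rule no_inner_touching_disc[of U \<rho> G "\<kappa> * E" r])
      show "G 0 \<in> U" using fr U(2) by blast
      show "\<rho> (G 0) = 0" using fr def by (simp add: smooth_defining_function_def)
    qed (use U levi[OF fr] hol inside pos E r(1) in auto)
  qed
  then show ?thesis using H0(1) that by blast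
qed

text \<open>The counterpart of \<open>log_box\<close> in the original coordinates; unlike the box it
  admits zeros in the coordinates where p vanishes.\<close>

definition log_near :: "complex ^ 'n \<Rightarrow> real \<Rightarrow> complex ^ 'n \<Rightarrow> bool" where
  "log_near p H z \<longleftrightarrow>
     (\<forall>j. if p $ j = 0 then cmod (z $ j) < H else z $ j \<noteq> 0 \<and> \<bar>ln (cmod (z $ j / p $ j))\<bar> < H)"

text \<open>A zero coordinate has no logarithm and is replaced by a small t > 0, which keeps the
  point in \<Omega> by openness. The corresponding entry of x carries no information, so only the
  others are recorded.\<close>

lemma log_domain_of_point:
  fixes z :: "complex ^ 'n"
  assumes \<Omega>: "open \<Omega>" and R: "reinhardt \<Omega>" and H: "0 < H" and z: "z \<in> \<Omega>" "log_near p H z"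
  obtains x where "x \<in> log_domain \<Omega> p H" "\<And>j. p $ j \<noteq> 0 \<Longrightarrow> x $ j = ln (cmod (z $ j / p $ j))"
    "\<And>j. p $ j = 0 \<Longrightarrow> z $ j \<noteq> 0 \<Longrightarrow> x $ j = ln (cmod (z $ j))"
proof -
  define w where "w = (\<lambda>t :: real. \<chi> j. z $ j + (if z $ j = 0 then of_real t else 0))"
  have "continuous_on UNIV (\<lambda>t. if b then complex_of_real t else 0)" for b
    by (cases b) (auto intro!: continuous_intros)
  then have "open (w -` \<Omega>)"
    unfolding w_def by (intro open_vimage[OF \<Omega>] continuous_on_vec_lambda continuous_on_add continuous_on_const)
  moreover have "w 0 = z" by (simp add: w_def vec_eq_iff)
  ultimately obtain h where h: "0 < h" "ball 0 h \<subseteq> w -` \<Omega>"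
    using z(1) by (metis openE vimageI2)
  define t where "t = min h H / 2"
  have t: "0 < t" "t < h" "t < H" using h(1) H by (auto simp: t_def)
  have "t \<in> ball 0 h" using t by simp
  then have w\<Omega>: "w t \<in> \<Omega>" using h(2) by blast
  have w_nz: "w t $ j \<noteq> 0" for j using t by (simp add: w_def)
  have w_eq: "w t $ j = z $ j" if "z $ j \<noteq> 0" for j using that by (simp add: w_def)
  define x where "x = (\<chi> j. if p $ j = 0 then ln (cmod (w t $ j)) else ln (cmod (z $ j / p $ j)))"
  have "x \<in> log_domain \<Omega> p H"
    unfolding log_domain_def
  proof (intro CollectI conjI)
    have "ln (cmod (w t $ j)) < ln H" if "p $ j = 0" for j
    proof -
      have "cmod (w t $ j) < H"
        using z(2) that t unfolding log_near_def w_def by (cases "z $ j = 0") (auto split: if_splits)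
      then show ?thesis using w_nz[of j] H by simp
    qed
    then show "x \<in> log_box p H"
      using z(2) by (auto simp: log_box_def log_near_def x_def)
    show "scale x (base_point p) \<in> \<Omega>"
    proof (rule reinhardt_moduli[OF R w\<Omega>])
      fix j
      show "cmod (scale x (base_point p) $ j) = cmod (w t $ j)"
      proof (cases "p $ j = 0")
        case True
        then show ?thesis using w_nz[of j] by (simp add: x_def base_point_nth)
      next
        case False
        then have "z $ j \<noteq> 0" using z(2) by (auto simp: log_near_def)
        then show ?thesis using False w_eq[of j] by (simp add: x_def base_point_nth norm_mult norm_divide)
      qed
    qed
  qed
  then show ?thesis
    by (rule that) (auto simp: x_def w_eq)
qed

text \<open>As q vanishes where p does, the logarithmic image contains a full orthant y0 - u in
  those coordinates. In an open convex set these directions can then be followed from every point: x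
  is pushed slightly away from y0, and y lies on the segment from there to a far point of the
  orthant.\<close>

lemma log_domain_downward:
  fixes x :: "real ^ 'n"
  assumes \<Omega>: "open \<Omega>" and R: "reinhardt \<Omega>" and H: "0 < H" and conv: "convex (log_domain \<Omega> p H)"
    and q: "q \<in> \<Omega>" "log_near p H q" "\<And>j. p $ j = 0 \<Longrightarrow> q $ j = 0"
    and x: "x \<in> log_domain \<Omega> p H" and y: "\<And>j. y $ j \<le> x $ j" "\<And>j. p $ j \<noteq> 0 \<Longrightarrow> y $ j = x $ j"
  shows "y \<in> log_domain \<Omega> p H"
proof -
  let ?D = "log_domain \<Omega> p H"
  obtain r where r: "0 < r" "ball q r \<subseteq> \<Omega>" using \<Omega> q(1) openE by blast
  define l where "l = ln (min (H / 2) (r / (2 * CARD('n))))"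
  have exp_l: "exp l = min (H / 2) (r / (2 * CARD('n)))"
    unfolding l_def using H r(1) by (intro exp_ln) auto
  define y0 :: "real ^ 'n" where "y0 = (\<chi> j. if p $ j = 0 then l else ln (cmod (q $ j / p $ j)))"
  have deep: "y0 - u \<in> ?D" if u: "\<And>j. 0 \<le> u $ j" "\<And>j. p $ j \<noteq> 0 \<Longrightarrow> u $ j = 0" for u
  proof -
    have le: "exp (l - u $ j) \<le> exp l" for j using u(1)[of j] by simp
    have ltH: "exp (l - u $ j) < H" for j
      using le[of j] exp_l H by (smt (verit) field_sum_of_halves min_def)
    have ltr: "exp (l - u $ j) < r / CARD('n)" for j
    proof -
      have "exp (l - u $ j) \<le> r / (2 * CARD('n))" using le[of j] exp_l by linarith
      also have "\<dots> < r / CARD('n)" using r(1) by (simp add: field_simps)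
      finally show ?thesis .
    qed
    define w where "w = (\<chi> j. if p $ j = 0 then of_real (exp (l - u $ j)) else q $ j)"
    have "cmod ((w - q) $ j) < r / CARD('n)" for j
      using ltr[of j] q(3)[of j] r(1) by (auto simp: w_def)
    then have "w \<in> ball q r"
      using norm_less_of_components[of "w - q" r] by (simp add: dist_norm norm_minus_commute)
    then have w: "w \<in> \<Omega>" using r(2) by blast
    show ?thesis
      unfolding log_domain_def
    proof (intro CollectI conjI)
      have "l - u $ j < ln H" for j
        using ltH[of j] H by (metis exp_less_cancel_iff exp_ln)
      then show "y0 - u \<in> log_box p H"
        using q(2) u(2) by (auto simp: log_box_def y0_def log_near_def)
      show "scale (y0 - u) (base_point p) \<in> \<Omega>"
      proof (rule reinhardt_moduli[OF R w])
        fix j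
        show "cmod (scale (y0 - u) (base_point p) $ j) = cmod (w $ j)"
        proof (cases "p $ j = 0")
          case False
          then have "q $ j \<noteq> 0" using q(2) by (auto simp: log_near_def)
          then show ?thesis using False u(2) by (simp add: y0_def w_def base_point_nth norm_mult norm_divide)
        qed (simp add: y0_def w_def base_point_nth)
      qed
    qed
  qed
  \<comment> \<open>This is the point beyond x on the line from y0. It tends to x as s tends to 0,
    so it lies in the open set for small s.\<close>
  have "((\<lambda>s. (1 / (1 - s)) *\<^sub>R (x - s *\<^sub>R y0)) \<longlongrightarrow> (1 / (1 - 0)) *\<^sub>R (x - 0 *\<^sub>R y0)) (at_right 0)"
    by (intro tendsto_intros) auto
  then have "\<forall>\<^sub>F s in at_right 0. (1 / (1 - s)) *\<^sub>R (x - s *\<^sub>R y0) \<in> ?D"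
    by (rule topological_tendstoD[OF _ open_log_domain[OF \<Omega>]]) (use x in simp)
  moreover have "\<forall>\<^sub>F s in at_right (0 :: real). s \<in> {0<..<1}"
    by (intro eventually_at_right_real) simp
  ultimately have "\<forall>\<^sub>F s in at_right 0. s \<in> {0<..<1} \<and> (1 / (1 - s)) *\<^sub>R (x - s *\<^sub>R y0) \<in> ?D"
    by eventually_elim auto
  from eventually_happens'[OF trivial_limit_at_right_real this]
  obtain s where s: "0 < s" "s < 1" "(1 / (1 - s)) *\<^sub>R (x - s *\<^sub>R y0) \<in> ?D"
    by auto
  \<comment> \<open>The choice u = (x - y) / s makes the combination with weights 1 - s and s equal
    to y.\<close>
  have "y0 - (1 / s) *\<^sub>R (x - y) \<in> ?D"
    by (rule deep) (use s y in auto)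
  with s have "(1 - s) *\<^sub>R ((1 / (1 - s)) *\<^sub>R (x - s *\<^sub>R y0)) + s *\<^sub>R (y0 - (1 / s) *\<^sub>R (x - y)) \<in> ?D"
    using conv unfolding convex_alt by (meson less_imp_le)
  moreover have "(1 - s) *\<^sub>R ((1 / (1 - s)) *\<^sub>R (x - s *\<^sub>R y0)) + s *\<^sub>R (y0 - (1 / s) *\<^sub>R (x - y)) = y"
    using s by (simp add: scaleR_diff_right)
  ultimately show ?thesis by simp
qed

text \<open>Zero coordinates of z are approximated by small positive numbers, whose logarithms are
  covered by \<open>down\<close>; this limit is the reason for the closure.\<close>

lemma closure_of_log_domain:
  fixes x :: "real ^ 'n"
  assumes R: "reinhardt \<Omega>"
    and down: "\<And>y. (\<And>j. y $ j \<le> x $ j) \<Longrightarrow> (\<And>j. p $ j \<noteq> 0 \<Longrightarrow> y $ j = x $ j) \<Longrightarrow> y \<in> log_domain \<Omega> p H"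
    and z: "\<And>j. p $ j \<noteq> 0 \<Longrightarrow> cmod (z $ j) = exp (x $ j) * cmod (p $ j)"
      "\<And>j. p $ j = 0 \<Longrightarrow> cmod (z $ j) \<le> exp (x $ j)"
  shows "z \<in> closure \<Omega>"
proof (rule Lim_in_closed_set)
  define w where "w = (\<lambda>t :: real. \<chi> j. z $ j + (if z $ j = 0 \<and> p $ j = 0 then of_real (t * exp (x $ j)) else 0))"
  have "((\<lambda>t. if b then complex_of_real (t * c) else 0) \<longlongrightarrow> (if b then complex_of_real (0 * c) else 0)) (at_right 0)" for b c
    by (cases b) (auto intro!: tendsto_eq_intros)
  then have "((\<lambda>t. w t $ j) \<longlongrightarrow> z $ j + (if z $ j = 0 \<and> p $ j = 0 then of_real (0 * exp (x $ j)) else 0)) (at_right 0)" for j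
    unfolding w_def vec_lambda_beta by (intro tendsto_add tendsto_const)
  moreover have "z $ j + (if z $ j = 0 \<and> p $ j = 0 then of_real (0 * exp (x $ j)) else 0) = z $ j" for j
    by simp
  ultimately have "((\<lambda>t. w t $ j) \<longlongrightarrow> z $ j) (at_right 0)" for j
    by metis
  then show "(w \<longlongrightarrow> z) (at_right 0)"
    by (rule vec_tendstoI)
  have "w t \<in> \<Omega>" if t: "0 < t" "t < 1" for t
  proof -
    define y where "y = (\<chi> j. if p $ j = 0 then ln (cmod (w t $ j)) else x $ j)"
    have w: "w t $ j \<noteq> 0" "cmod (w t $ j) \<le> exp (x $ j)" if "p $ j = 0" for j
    proof -
      have "t * exp (x $ j) \<le> 1 * exp (x $ j)" using t by (intro mult_right_mono) auto
      then show "w t $ j \<noteq> 0" "cmod (w t $ j) \<le> exp (x $ j)"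
        using z(2)[OF that] that t by (auto simp: w_def norm_mult)
    qed
    have "y $ j \<le> x $ j" for j
    proof (cases "p $ j = 0")
      case True
      then have "ln (cmod (w t $ j)) \<le> ln (exp (x $ j))"
        using w[OF True] by (subst ln_le_cancel_iff) auto
      then show ?thesis using True by (simp add: y_def)
    qed (simp add: y_def)
    then have "y \<in> log_domain \<Omega> p H"
      by (rule down) (simp add: y_def)
    then have "scale y (base_point p) \<in> \<Omega>"
      by (simp add: log_domain_def)
    then show ?thesis
    proof (rule reinhardt_moduli[OF R])
      fix j
      show "cmod (w t $ j) = cmod (scale y (base_point p) $ j)"
        using w(1)[of j] z(1)[of j]
        by (cases "p $ j = 0") (auto simp: y_def base_point_nth norm_mult, simp add: w_def)
    qed
  qed
  then have "w t \<in> closure \<Omega>" if "0 < t" "t < 1" for t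
    using that closure_subset by blast
  moreover have "\<forall>\<^sub>F s in at_right (0 :: real). s \<in> {0<..<1}"
    by (intro eventually_at_right_real) simp
  ultimately show "\<forall>\<^sub>F t in at_right 0. w t \<in> closure \<Omega>"
    by (auto elim: eventually_mono)
qed auto

section \<open>Geometric means and the tangent plane at p\<close>

lemma log_near_scale:
  assumes "log_near p H z"
  obtains h where "0 < h" "\<And>t. \<bar>t\<bar> < h \<Longrightarrow> log_near p H (scale (t *\<^sub>R e) z)"
    "\<And>t j. p $ j \<noteq> 0 \<Longrightarrow> ln (cmod (scale (t *\<^sub>R e) z $ j / p $ j)) = t * e $ j + ln (cmod (z $ j / p $ j))"
proof -
  have ln: "ln (cmod (scale (t *\<^sub>R e) z $ j / p $ j)) = t * e $ j + ln (cmod (z $ j / p $ j))" if "p $ j \<noteq> 0" for t j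
  proof -
    have "z $ j \<noteq> 0" using assms that by (auto simp: log_near_def)
    then show ?thesis using that by (simp add: norm_mult norm_divide ln_mult ln_div)
  qed
  have "\<exists>h>0. \<forall>t. \<bar>t\<bar> < h \<longrightarrow>
      (if p $ j = 0 then exp (t * e $ j) * cmod (z $ j) < H else \<bar>t * e $ j + ln (cmod (z $ j / p $ j))\<bar> < H)" for j
  proof -
    let ?f = "if p $ j = 0 then (\<lambda>t. exp (t * e $ j) * cmod (z $ j)) else (\<lambda>t. \<bar>t * e $ j + ln (cmod (z $ j / p $ j))\<bar>)"
    have "continuous_on UNIV ?f"
      by (cases "p $ j = 0") (simp_all, (intro continuous_intros)+)
    then have "open (?f -` {..<H})" by (intro open_vimage) auto
    moreover have "0 \<in> ?f -` {..<H}" using assms by (auto simp: log_near_def)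
    ultimately obtain h where "0 < h" "ball 0 h \<subseteq> ?f -` {..<H}" by (meson openE)
    then show ?thesis by (intro exI[of _ h]) (auto simp: subset_iff)
  qed
  then obtain h where h: "\<And>j. 0 < h j" "\<And>j t. \<bar>t\<bar> < h j \<Longrightarrow>
      (if p $ j = 0 then exp (t * e $ j) * cmod (z $ j) < H else \<bar>t * e $ j + ln (cmod (z $ j / p $ j))\<bar> < H)"
    by metis
  have "0 < Min (range h)" using h(1) by auto
  moreover have "log_near p H (scale (t *\<^sub>R e) z)" if t: "\<bar>t\<bar> < Min (range h)" for t
  proof -
    have "\<bar>t\<bar> < h j" for j using t by auto
    from h(2)[OF this] ln[of _ t] assms show ?thesis
      unfolding log_near_def by (auto simp: norm_mult split: if_splits)
  qed
  ultimately show ?thesis using that ln by blast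
qed

lemma log_near_self: "0 < H \<Longrightarrow> log_near p H p"
  by (simp add: log_near_def)

lemma log_gradient_zero:
  assumes "linear (fderiv \<rho> p)" "p $ j = 0"
  shows "log_gradient \<rho> p $ j = 0"
proof -
  have "axis j (p $ j) = (0 :: complex ^ 'a)"
    using assms(2) by (simp add: axis_def vec_eq_iff)
  then show ?thesis
    unfolding log_gradient_def by (metis assms(1) linear_0 vec_lambda_beta)
qed

text \<open>Closure under weighted geometric means of moduli. Where p_j = 0 the result may lie below
  the mean and may be 0; otherwise the points Z k must be nonzero there, because the convention ln 0
  = 0 would falsify the sum.\<close>

definition log_convex_near :: "(complex ^ 'n) set \<Rightarrow> complex ^ 'n \<Rightarrow> real \<Rightarrow> bool" where
  "log_convex_near \<Omega> p H \<longleftrightarrow>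
     (\<forall>(K :: nat set) l Z w. finite K \<longrightarrow> (\<forall>k\<in>K. 0 \<le> l k \<and> Z k \<in> \<Omega> \<and> log_near p H (Z k)) \<longrightarrow> sum l K = 1 \<longrightarrow>
       (\<forall>j. p $ j \<noteq> 0 \<longrightarrow> w $ j \<noteq> 0 \<and> ln (cmod (w $ j / p $ j)) = (\<Sum>k\<in>K. l k * ln (cmod (Z k $ j / p $ j)))) \<longrightarrow>
       (\<forall>j. p $ j = 0 \<longrightarrow> w $ j = 0 \<or>
          (\<forall>k\<in>K. Z k $ j \<noteq> 0) \<and> ln (cmod (w $ j)) \<le> (\<Sum>k\<in>K. l k * ln (cmod (Z k $ j)))) \<longrightarrow>
       w \<in> closure \<Omega>)"

lemma log_convex_nearD:
  fixes K :: "nat set"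
  assumes "log_convex_near \<Omega> p H" "finite K" "\<And>k. k \<in> K \<Longrightarrow> 0 \<le> l k" "sum l K = 1"
    and "\<And>k. k \<in> K \<Longrightarrow> Z k \<in> \<Omega> \<and> log_near p H (Z k)"
    and "\<And>j. p $ j \<noteq> 0 \<Longrightarrow> w $ j \<noteq> 0 \<and> ln (cmod (w $ j / p $ j)) = (\<Sum>k\<in>K. l k * ln (cmod (Z k $ j / p $ j)))"
    and "\<And>j. p $ j = 0 \<Longrightarrow> w $ j = 0 \<or> (\<forall>k\<in>K. Z k $ j \<noteq> 0) \<and> ln (cmod (w $ j)) \<le> (\<Sum>k\<in>K. l k * ln (cmod (Z k $ j)))"
  shows "w \<in> closure \<Omega>"
  using assms(1)[unfolded log_convex_near_def, rule_format, of K l Z w] assms(2-7) by blast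

text \<open>Pseudoconvexity supplies its own defining function, which serves to prove convexity; the
  gradient in the last clause belongs to the given \<rho>. That clause holds because the convex
  image stays on one side of the tangent plane, strictly so since \<Omega> is open.\<close>

lemma local_log_convexity:
  assumes \<Omega>: "open \<Omega>" and pc: "pseudoconvex \<Omega>" and R: "reinhardt \<Omega>"
    and def: "smooth_defining_function \<Omega> \<rho>" and p: "p \<in> frontier \<Omega>"
  obtains H where "0 < H" "log_convex_near \<Omega> p H"
    "\<And>z. log_near p H z \<Longrightarrow> (\<Sum>j\<in>UNIV. log_gradient \<rho> p $ j * ln (cmod (z $ j / p $ j))) = 0 \<Longrightarrow> z \<notin> \<Omega>"
proof -
  obtain \<rho>2 where def2: "smooth_defining_function \<Omega> \<rho>2"
    and levi: "\<And>z t. z \<in> frontier \<Omega> \<Longrightarrow>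
           (\<Sum>j\<in>UNIV. wirt (axis j) (\<lambda>w. of_real (\<rho>2 w)) z * t $ j) = 0 \<Longrightarrow>
           0 \<le> Re (levi_form \<rho>2 z t)"
    using pc unfolding pseudoconvex_def by blast
  obtain \<delta>2 a2 \<kappa>2 where T2: "transversal \<rho>2 p (log_gradient \<rho>2 p) \<delta>2 a2 \<kappa>2"
    using transversal_exists[OF R def2 p] .
  obtain H where H: "0 < H" and conv: "convex (log_domain \<Omega> p H)"
    using log_domain_convex[OF \<Omega> R def2 levi p T2] by (metis order_refl)
  let ?D = "log_domain \<Omega> p H"
  let ?e = "log_gradient \<rho> p"
  obtain \<delta> a \<kappa> where T: "transversal \<rho> p ?e \<delta> a \<kappa>"
    using transversal_exists[OF R def p] .
  have pos: "0 < \<delta>" "0 < a" "0 < \<kappa>" using transversal_pos[OF T] by auto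
  obtain U where U: "open U" "frontier \<Omega> \<subseteq> U" "smooth_on U \<rho>" "\<rho> p = 0"
    using def p unfolding smooth_defining_function_def by blast
  have D: "(\<rho> has_derivative fderiv \<rho> p) (at p)"
    using smooth_on_has_derivative[OF U(3)] U(2) p by blast
  have lin: "linear (fderiv \<rho> p)"
    using D has_derivative_linear by blast
  obtain h where h: "0 < h" "\<And>t. \<bar>t\<bar> < h \<Longrightarrow> log_near p H (scale (t *\<^sub>R ?e) p)"
    "\<And>t j. p $ j \<noteq> 0 \<Longrightarrow> ln (cmod (scale (t *\<^sub>R ?e) p $ j / p $ j)) = t * ?e $ j"
    using log_near_scale[OF log_near_self[OF H]] by (metis add.right_neutral divide_self ln_one norm_one)
  have in\<Omega>: "scale ((- c) *\<^sub>R ?e) p \<in> \<Omega>" if "0 < c" "c \<le> a" for c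
  proof -
    have "\<rho> (scale ((- c) *\<^sub>R ?e) p) + \<kappa> * (0 - (- c)) \<le> \<rho> (scale (0 *\<^sub>R ?e) p)"
      by (rule transversalD[OF T]) (use pos that in auto)
    then have "\<rho> (scale ((- c) *\<^sub>R ?e) p) < 0"
      using U(4) mult_pos_pos[OF pos(3) that(1)] by simp
    then show ?thesis
      using notin_iff_nonneg[OF def] by (meson not_le)
  qed
  define c0 where "c0 = min h a / 2"
  have c0: "0 < c0" "c0 < h" "c0 < a" using h(1) pos by (auto simp: c0_def)
  have down: "y \<in> ?D"
    if "x \<in> ?D" "\<And>j. y $ j \<le> x $ j" "\<And>j. p $ j \<noteq> 0 \<Longrightarrow> y $ j = x $ j" for x y
    by (rule log_domain_downward[OF \<Omega> R H conv in\<Omega>[of c0] h(2)[of "- c0"] _ that]) (use c0 in auto)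
  have closureI: "z \<in> closure \<Omega>"
    if "x \<in> ?D" "\<And>j. p $ j \<noteq> 0 \<Longrightarrow> cmod (z $ j) = exp (x $ j) * cmod (p $ j)"
      "\<And>j. p $ j = 0 \<Longrightarrow> cmod (z $ j) \<le> exp (x $ j)" for x z
    by (rule closure_of_log_domain[OF R down[OF that(1)] that(2,3)])
  \<comment> \<open>For 0 < s < 1 the point \<open>scale (s *\<^sub>R x) p\<close> is a limit of
    points obtained from convex combinations of x with images of points tending to p. So \<rho>
    \<le> 0 along this path, its derivative at p is \<le> 0, and that derivative is the sum.\<close>
  have support: "(\<Sum>j\<in>UNIV. ?e $ j * x $ j) \<le> 0" if x: "x \<in> ?D" for x
  proof -
    have cl: "scale (s *\<^sub>R x) p \<in> closure \<Omega>" if s: "0 < s" "s < 1" for s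
    proof (rule Lim_in_closed_set)
      have "continuous_on UNIV (\<lambda>c. scale (s *\<^sub>R x - ((1 - s) * c) *\<^sub>R ?e) p)"
        by (intro continuous_intros)
      then have "isCont (\<lambda>c. scale (s *\<^sub>R x - ((1 - s) * c) *\<^sub>R ?e) p) 0"
        by (simp add: continuous_on_eq_continuous_at)
      then show "((\<lambda>c. scale (s *\<^sub>R x - ((1 - s) * c) *\<^sub>R ?e) p) \<longlongrightarrow> scale (s *\<^sub>R x) p) (at_right 0)"
        unfolding isCont_def mult_zero_right scaleR_zero_left diff_zero
        by (simp add: filterlim_at_split)
      have "scale (s *\<^sub>R x - ((1 - s) * c) *\<^sub>R ?e) p \<in> closure \<Omega>" if c: "0 < c" "c < c0" for c
      proof -
        have "\<bar>- c\<bar> < h" using c c0 by simp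
        then obtain xc where xc: "xc \<in> ?D" "\<And>j. p $ j \<noteq> 0 \<Longrightarrow> xc $ j = - c * ?e $ j"
          using log_domain_of_point[OF \<Omega> R H in\<Omega>[of c] h(2)[of "- c"]] h(3)[of _ "- c"] c c0
          by (metis less_imp_le order.strict_trans)
        have "(1 - s) *\<^sub>R xc + s *\<^sub>R x \<in> ?D"
          using conv xc(1) x s unfolding convex_alt by (meson less_imp_le)
        then show ?thesis
        proof (rule closureI)
          fix j assume "p $ j \<noteq> 0"
          then show "cmod (scale (s *\<^sub>R x - ((1 - s) * c) *\<^sub>R ?e) p $ j) = exp (((1 - s) *\<^sub>R xc + s *\<^sub>R x) $ j) * cmod (p $ j)"
            using xc(2) by (simp add: norm_mult algebra_simps)
        qed simp
      qed
      moreover have "\<forall>\<^sub>F c in at_right (0 :: real). c \<in> {0<..<c0}"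
        using c0 by (intro eventually_at_right_real) simp
      ultimately show "\<forall>\<^sub>F c in at_right 0. scale (s *\<^sub>R x - ((1 - s) * c) *\<^sub>R ?e) p \<in> closure \<Omega>"
        by (auto elim: eventually_mono)
    qed auto
    have "((\<lambda>s. scale (s *\<^sub>R x) p) has_vector_derivative (\<chi> j. of_real (x $ j) * p $ j)) (at 0)"
      using scale_has_vector_derivative[of x p 0] by simp
    moreover have "(\<rho> has_derivative fderiv \<rho> p) (at (scale (0 *\<^sub>R x) p))"
      using D by simp
    ultimately have "((\<lambda>s. \<rho> (scale (s *\<^sub>R x) p)) has_derivative
        (\<lambda>s. fderiv \<rho> p (s *\<^sub>R (\<chi> j. of_real (x $ j) * p $ j)))) (at 0)"
      unfolding has_vector_derivative_def by (rule has_derivative_compose)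
    then have "((\<lambda>s. \<rho> (scale (s *\<^sub>R x) p)) has_real_derivative
        fderiv \<rho> p (\<chi> j. of_real (x $ j) * p $ j)) (at 0)"
      by (simp add: linear_scale[OF lin] has_field_derivative_def mult_commute_abs)
    then have "fderiv \<rho> p (\<chi> j. of_real (x $ j) * p $ j) \<le> 0"
      by (rule DERIV_le_0_of_nonpos_right) (use U(4) cl defining_function_closure[OF def] in auto)
    moreover have "?e $ j * Re ((\<chi> j. of_real (x $ j) * p $ j) $ j / p $ j) = ?e $ j * x $ j" for j
      using log_gradient_zero[OF lin, of j] by (cases "p $ j = 0") auto
    then have "fderiv \<rho> p (\<chi> j. of_real (x $ j) * p $ j) = (\<Sum>j\<in>UNIV. ?e $ j * x $ j)"
      unfolding log_gradient_formula(1)[OF R def p] by (simp only:)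
    ultimately show ?thesis by simp
  qed
  show ?thesis
  proof (rule that[OF H])
    show "log_convex_near \<Omega> p H"
      unfolding log_convex_near_def
    proof (intro allI impI)
      fix K :: "nat set" and l :: "nat \<Rightarrow> real" and Z w
      assume K: "finite K" "\<forall>k\<in>K. 0 \<le> l k \<and> Z k \<in> \<Omega> \<and> log_near p H (Z k)" "sum l K = 1"
        and wN: "\<forall>j. p $ j \<noteq> 0 \<longrightarrow> w $ j \<noteq> 0 \<and> ln (cmod (w $ j / p $ j)) = (\<Sum>k\<in>K. l k * ln (cmod (Z k $ j / p $ j)))"
        and wZ: "\<forall>j. p $ j = 0 \<longrightarrow> w $ j = 0 \<or> (\<forall>k\<in>K. Z k $ j \<noteq> 0) \<and> ln (cmod (w $ j)) \<le> (\<Sum>k\<in>K. l k * ln (cmod (Z k $ j)))"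
      have "\<exists>x. k \<in> K \<longrightarrow> x \<in> ?D \<and> (\<forall>j. p $ j \<noteq> 0 \<longrightarrow> x $ j = ln (cmod (Z k $ j / p $ j)))
        \<and> (\<forall>j. p $ j = 0 \<longrightarrow> Z k $ j \<noteq> 0 \<longrightarrow> x $ j = ln (cmod (Z k $ j)))" for k
        using log_domain_of_point[OF \<Omega> R H, of "Z k" p] K(2) by metis
      then obtain x where x: "\<And>k. k \<in> K \<Longrightarrow> x k \<in> ?D"
        "\<And>k j. k \<in> K \<Longrightarrow> p $ j \<noteq> 0 \<Longrightarrow> x k $ j = ln (cmod (Z k $ j / p $ j))"
        "\<And>k j. k \<in> K \<Longrightarrow> p $ j = 0 \<Longrightarrow> Z k $ j \<noteq> 0 \<Longrightarrow> x k $ j = ln (cmod (Z k $ j))"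
        by metis
      have "(\<Sum>k\<in>K. l k *\<^sub>R x k) \<in> ?D"
        by (rule convex_sum[OF K(1) conv K(3)]) (use K x(1) in auto)
      then show "w \<in> closure \<Omega>"
      proof (rule closureI)
        fix j assume j: "p $ j \<noteq> 0"
        have eq: "(\<Sum>k\<in>K. l k *\<^sub>R x k) $ j = ln (cmod (w $ j / p $ j))"
          using wN[rule_format, OF j] x(2)[OF _ j] by (simp add: sum_component)
        show "cmod (w $ j) = exp ((\<Sum>k\<in>K. l k *\<^sub>R x k) $ j) * cmod (p $ j)"
          unfolding eq using wN[rule_format, OF j] j exp_ln[of "cmod (w $ j / p $ j)"] by (simp add: norm_divide)
      next
        fix j assume j: "p $ j = 0"
        show "cmod (w $ j) \<le> exp ((\<Sum>k\<in>K. l k *\<^sub>R x k) $ j)"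
        proof (cases "w $ j = 0")
          case False
          then have "ln (cmod (w $ j)) \<le> (\<Sum>k\<in>K. l k *\<^sub>R x k) $ j"
            using wZ[rule_format, OF j] x(3)[OF _ j] by (simp add: sum_component)
          then have "exp (ln (cmod (w $ j))) \<le> exp ((\<Sum>k\<in>K. l k *\<^sub>R x k) $ j)"
            by simp
          then show ?thesis using False by simp
        qed simp
      qed
    qed
  next
    fix z assume z: "log_near p H z" "(\<Sum>j\<in>UNIV. ?e $ j * ln (cmod (z $ j / p $ j))) = 0"
    show "z \<notin> \<Omega>"
    proof
      assume "z \<in> \<Omega>"
      obtain h1 where h1: "0 < h1" "\<And>t. \<bar>t\<bar> < h1 \<Longrightarrow> log_near p H (scale (t *\<^sub>R ?e) z)"
        "\<And>t j. p $ j \<noteq> 0 \<Longrightarrow> ln (cmod (scale (t *\<^sub>R ?e) z $ j / p $ j)) = t * ?e $ j + ln (cmod (z $ j / p $ j))"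
        using log_near_scale[OF z(1), where e = ?e] by blast
      obtain \<mu> where \<mu>: "0 < \<mu>" "\<And>c. \<bar>c\<bar> \<le> \<mu> \<Longrightarrow> scale (c *\<^sub>R ?e) z \<in> \<Omega>"
        using scale_path_open[OF \<Omega> \<open>z \<in> \<Omega>\<close>, where e = ?e] by blast
      \<comment> \<open>A point of \<Omega> can be moved slightly in direction e without leaving
        \<Omega>; this raises the sum by t |e|^2 > 0 and violates \<open>support\<close>.\<close>
      define t where "t = min \<mu> h1 / 2"
      have t: "0 < t" "\<bar>t\<bar> < h1" "\<bar>t\<bar> \<le> \<mu>" using \<mu>(1) h1(1) by (auto simp: t_def)
      obtain x where x: "x \<in> ?D"
        "\<And>j. p $ j \<noteq> 0 \<Longrightarrow> x $ j = t * ?e $ j + ln (cmod (z $ j / p $ j))"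
        using log_domain_of_point[OF \<Omega> R H \<mu>(2)[OF t(3)] h1(2)[OF t(2)]] h1(3)[of _ t] by metis
      have "?e $ j * x $ j = t * (?e $ j)\<^sup>2 + ?e $ j * ln (cmod (z $ j / p $ j))" for j
        using x(2)[of j] log_gradient_zero[OF lin, of j]
        by (cases "p $ j = 0") (simp_all add: power2_eq_square algebra_simps)
      then have "(\<Sum>j\<in>UNIV. ?e $ j * x $ j) = t * (\<Sum>j\<in>UNIV. (?e $ j)\<^sup>2)"
        using z(2) by (simp add: sum.distrib sum_distrib_left)
      moreover have "(\<Sum>j\<in>UNIV. (?e $ j)\<^sup>2) \<noteq> 0"
        using log_gradient_formula(2)[OF R def p] by (auto simp: sum_nonneg_eq_0_iff vec_eq_iff)
      then have "0 < (\<Sum>j\<in>UNIV. (?e $ j)\<^sup>2)"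
        by (simp add: less_le sum_nonneg)
      ultimately show False
        using support[OF x(1)] t(1) by (simp add: mult_le_0_iff)
    qed
  qed
qed

section \<open>Averaging over roots of unity\<close>

lemma eventually_nhds_0:
  "(\<forall>\<^sub>F z in nhds (0 :: 'a::real_normed_vector). P z) \<longleftrightarrow> (\<exists>r>0. \<forall>z. norm z < r \<longrightarrow> P z)"
  by (simp add: eventually_nhds_metric)

abbreviation order_bound :: "(complex \<Rightarrow> complex) \<Rightarrow> real \<Rightarrow> nat \<Rightarrow> bool" where
  "order_bound h C k \<equiv> \<forall>\<^sub>F z in nhds 0. cmod (h z) \<le> C * cmod z ^ k"

section \<open>Taylor polynomials and leading coefficients of holomorphic functions\<close>

lemma holomorphic_taylor_bound:
  assumes f: "f holomorphic_on ball 0 R" and R: "0 < R"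
  obtains C where "order_bound (\<lambda>z. f z - (\<Sum>i\<le>n. (deriv ^^ i) f 0 / fact i * z ^ i)) C (Suc n)"
proof -
  have hol: "(deriv ^^ i) f holomorphic_on ball 0 R" for i
    using f by (rule holomorphic_higher_deriv) auto
  have sub: "cball 0 (R / 2) \<subseteq> ball 0 R" using R by (auto simp: subset_iff)
  have "continuous_on (cball 0 (R / 2)) ((deriv ^^ Suc n) f)"
    using hol sub holomorphic_on_imp_continuous_on continuous_on_subset by blast
  then have "bounded ((deriv ^^ Suc n) f ` cball 0 (R / 2))"
    using compact_cball compact_continuous_image compact_imp_bounded by blast
  then obtain B where B: "\<And>z. z \<in> cball 0 (R / 2) \<Longrightarrow> cmod ((deriv ^^ Suc n) f z) \<le> B"
    unfolding bounded_iff by blast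
  have "cmod (f z - (\<Sum>i\<le>n. (deriv ^^ i) f 0 / fact i * z ^ i)) \<le> B / fact n * cmod z ^ Suc n"
    if z: "cmod z < R / 2" for z
  proof -
    have "cmod ((deriv ^^ 0) f z - (\<Sum>i\<le>n. (deriv ^^ i) f 0 * (z - 0) ^ i / fact i)) \<le> B * cmod (z - 0) ^ Suc n / fact n"
    proof (rule complex_Taylor[OF convex_cball])
      show "((deriv ^^ i) f has_field_derivative (deriv ^^ Suc i) f x) (at x within cball 0 (R / 2))"
        if "x \<in> cball 0 (R / 2)" for i x
      proof -
        have "x \<in> ball 0 R" using sub that by blast
        from holomorphic_derivI[OF hol[of i] open_ball this] show ?thesis by simp
      qed
    qed (use B z R in auto)
    then show ?thesis by simp
  qed
  then show ?thesis
    using that[of "B / fact n"] half_gt_zero[OF R] unfolding eventually_nhds_0 by blast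
qed

text \<open>Cauchy's inequality on the circle of radius r bounds the derivative by a multiple of r,
  and r tends to 0.\<close>

lemma higher_deriv_zero_of_bound:
  assumes f: "f holomorphic_on ball 0 R" and R: "0 < R"
    and bound: "order_bound f C (Suc n)"
  shows "(deriv ^^ n) f 0 = 0"
proof -
  obtain r0 where r0: "0 < r0" "\<And>z. cmod z < r0 \<Longrightarrow> cmod (f z) \<le> C * cmod z ^ Suc n"
    using bound by (auto simp: eventually_nhds_0)
  have le: "cmod ((deriv ^^ n) f 0) \<le> fact n * C * r" if r: "0 < r" "r < r0" "r < R" for r
  proof -
    have "cmod ((deriv ^^ n) f 0) \<le> fact n * (C * r ^ Suc n) / r ^ n"
    proof (rule Cauchy_inequality)
      show "f holomorphic_on ball 0 r"
        using f r by (rule_tac holomorphic_on_subset[OF f]) auto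
      show "continuous_on (cball 0 r) f"
        by (rule continuous_on_subset[OF holomorphic_on_imp_continuous_on[OF f]]) (use r in auto)
      show "cmod (f x) \<le> C * r ^ Suc n" if "cmod (0 - x) = r" for x
        using r0(2)[of x] that r by simp
    qed (rule r)
    then show ?thesis using r(1) by (simp add: field_simps)
  qed
  have "((\<lambda>r. fact n * C * r) \<longlongrightarrow> fact n * C * 0) (at_right 0)"
    by (intro tendsto_intros)
  moreover have "\<forall>\<^sub>F r in at_right (0::real). r \<in> {0<..<min r0 R}"
    using r0(1) R by (intro eventually_at_right_real) auto
  then have "\<forall>\<^sub>F r in at_right 0. cmod ((deriv ^^ n) f 0) \<le> fact n * C * r"
    by eventually_elim (use le in auto)
  ultimately have "cmod ((deriv ^^ n) f 0) \<le> fact n * C * 0"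
    using tendsto_lowerbound trivial_limit_at_right_real by blast
  then show ?thesis by simp
qed

lemma higher_deriv_monomial:
  "(deriv ^^ j) (\<lambda>z :: complex. z ^ n) = (\<lambda>z. of_nat (\<Prod>i\<in>{0..<j}. n - i) * z ^ (n - j))"
proof (induction j)
  case (Suc j)
  have "deriv (\<lambda>z :: complex. c * z ^ k) z = c * (of_nat k * z ^ (k - 1))" for c k z
    by (rule DERIV_imp_deriv) (auto intro!: derivative_eq_intros)
  then show ?case
    by (simp add: Suc mult.assoc)
qed simp

lemma higher_deriv_leading_coefficient:
  assumes f: "f holomorphic_on ball 0 R" and R: "0 < R"
    and bound: "order_bound (\<lambda>z. f z - c * z ^ v) C (Suc v)"
  shows "(deriv ^^ v) f 0 = fact v * c"
proof -
  have "(deriv ^^ v) (\<lambda>z. f z - c * z ^ v) 0 = 0"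
    by (rule higher_deriv_zero_of_bound[OF _ R bound]) (intro holomorphic_intros f)
  moreover have "(deriv ^^ v) (\<lambda>z. f z - c * z ^ v) 0 = (deriv ^^ v) f 0 - (deriv ^^ v) (\<lambda>z. c * z ^ v) 0"
    by (rule higher_deriv_diff[OF f _ open_ball]) (use R in \<open>auto intro!: holomorphic_intros\<close>)
  moreover have "(deriv ^^ v) (\<lambda>z. c * z ^ v) 0 = c * (deriv ^^ v) (\<lambda>z. z ^ v) 0"
    by (rule higher_deriv_cmult[of _ UNIV]) (auto intro!: holomorphic_intros)
  moreover have "(deriv ^^ v) (\<lambda>z :: complex. z ^ v) 0 = fact v"
    by (simp add: higher_deriv_monomial fact_prod_rev)
  ultimately show ?thesis by (simp add: mult.commute)
qed

text \<open>
  Positivity keeps averages inside convex sets; summed against powers of roots of unity, these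
  weights isolate the exponents \<open>0\<close> and \<open>v\<close>.
\<close>

definition fejer_weight :: "nat \<Rightarrow> nat \<Rightarrow> nat \<Rightarrow> real" where
  "fejer_weight N v k = (1 + cos (2 * pi * real k * real v / real N)) / real N"

lemma fejer_weight_nonneg: "0 \<le> fejer_weight N v k"
  by (simp add: fejer_weight_def cos_ge_minus_one add.commute le_minus_iff[symmetric] neg_le_iff_le add_nonneg_nonneg)
   (metis add.commute add_increasing2 cos_ge_minus_one diff_ge_0_iff_ge diff_minus_eq_add divide_nonneg_nonneg of_nat_0_le_iff)

lemma sum_root_unity_powers:
  assumes N: "0 < N"
  shows "(\<Sum>k<N. cis (2 * pi / real N) ^ (k * l)) = (if N dvd l then of_nat N else 0)"
proof -
  let ?w = "cis (2 * pi / real N) ^ l"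
  have w: "cis (2 * pi / real N) ^ (k * l) = ?w ^ k" for k
    by (metis mult.commute power_mult)
  have wN: "?w ^ N = 1"
  proof -
    have "?w ^ N = (cis (2 * pi / real N) ^ N) ^ l" by (metis mult.commute power_mult)
    also have "cis (2 * pi / real N) ^ N = 1" using N by (simp add: Complex.DeMoivre)
    finally show ?thesis by simp
  qed
  have one: "?w = 1 \<longleftrightarrow> N dvd l"
  proof -
    have "?w = exp (2 * of_real pi * \<i> * of_nat l / of_nat N)"
      unfolding Complex.DeMoivre by (simp add: cis_conv_exp algebra_simps)
    then show ?thesis
      using complex_root_unity_eq_1[of N l] N by simp
  qed
  show ?thesis
  proof (cases "N dvd l")
    case True
    then show ?thesis unfolding w using one by simp
  next
    case False
    then show ?thesis unfolding w using one wN geometric_sum[of ?w N] by simp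
  qed
qed

text \<open>For N = m + v one has w^(- k v) = w^(k m), so the cosine is the mean of w^(k v) and w^(k
  m). The sum detects divisibility by N of i, i + v and i + m; for i < m this happens for i = 0,
  never, and for i = v respectively. With N = m + v no other exponent below m is aliased.\<close>

lemma sum_fejer_weight:
  assumes v: "0 < v" "v < m" and i: "i < m"
  shows "(\<Sum>k<m + v. of_real (fejer_weight (m + v) v k) * cis (2 * pi / real (m + v)) ^ (k * i))
    = (if i = 0 then 1 else if i = v then 1 / 2 else 0)"
proof -
  define N where "N = m + v"
  define w where "w = cis (2 * pi / real N)"
  have N: "0 < N" using v by (simp add: N_def)
  have cosw: "of_real (cos (2 * pi * real k * real v / real N)) = (w ^ (k * v) + w ^ (k * m)) / 2" for k
  proof -
    have 1: "w ^ (k * v) = cis (2 * pi * real k * real v / real N)"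
      by (simp add: w_def Complex.DeMoivre mult_ac)
    have "w ^ N = 1" using N by (simp add: w_def Complex.DeMoivre)
    then have "w ^ (k * v) * w ^ (k * m) = 1"
      by (metis N_def add.commute distrib_left mult.commute power_add power_mult power_one)
    then have "w ^ (k * m) = cnj (w ^ (k * v))"
      unfolding 1 by (metis cis_cnj cis_inverse cis_neq_zero inverse_unique)
    then show ?thesis unfolding 1 by (simp add: complex_eq_iff)
  qed
  have S: "(\<Sum>k<N. w ^ (k * l)) = (if N dvd l then of_nat N else 0)" for l
    unfolding w_def by (rule sum_root_unity_powers[OF N])
  have "(\<Sum>k<N. of_real (fejer_weight N v k) * w ^ (k * i))
     = (\<Sum>k<N. (w ^ (k * i) + (w ^ (k * (v + i)) + w ^ (k * (m + i))) / 2) / of_nat N)"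
    unfolding fejer_weight_def of_real_divide of_real_add cosw
    by (intro sum.cong refl) (simp add: power_add distrib_left field_simps)
  also have "\<dots> = ((\<Sum>k<N. w ^ (k * i)) + ((\<Sum>k<N. w ^ (k * (v + i))) + (\<Sum>k<N. w ^ (k * (m + i)))) / 2) / of_nat N"
    by (simp add: sum.distrib sum_divide_distrib[symmetric])
  also have "\<dots> = (if i = 0 then 1 else if i = v then 1 / 2 else 0)"
  proof -
    have d0: "N dvd i \<longleftrightarrow> i = 0"
      using i by (auto simp: N_def dest: dvd_imp_le)
    have d1: "\<not> N dvd v + i"
      using i v by (auto simp: N_def dest!: dvd_imp_le)
    have d2: "N dvd m + i \<longleftrightarrow> i = v"
    proof
      assume "N dvd m + i"
      then obtain q where q: "m + i = N * q" by blast
      have "q \<noteq> 0" using q v by (cases "q = 0") auto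
      moreover have "q < 2"
      proof (rule ccontr)
        assume "\<not> q < 2"
        then have "N * 2 \<le> N * q" by simp
        then show False using q i v by (simp add: N_def)
      qed
      ultimately have "q = 1" by simp
      then show "i = v" using q by (simp add: N_def)
    qed (simp add: N_def)
    show ?thesis
      unfolding S d0 d2 using d1 N v by simp
  qed
  finally show ?thesis by (simp add: N_def w_def)
qed

lemma sum_fejer_weight_1:
  assumes "0 < v" "v < m"
  shows "(\<Sum>k<m + v. fejer_weight (m + v) v k) = 1"
proof -
  have "complex_of_real (\<Sum>k<m + v. fejer_weight (m + v) v k) = 1"
    using sum_fejer_weight[OF assms, of 0] assms by simp
  then show ?thesis using of_real_eq_1_iff by blast
qed

text \<open>The Taylor polynomial below degree m is averaged exactly, and only half of its v-th term
  survives since f 0 = 0. The remainder keeps its bound because the weights are nonnegative with sum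
  1.\<close>

lemma holomorphic_average:
  assumes f: "f holomorphic_on ball 0 R" and R: "0 < R" and f0: "f 0 = 0" and v: "0 < v" "v < m"
  obtains C where "order_bound (\<lambda>s. (\<Sum>k<m + v. of_real (fejer_weight (m + v) v k)
      * f (s * cis (2 * pi / real (m + v)) ^ k)) - (deriv ^^ v) f 0 / fact v / 2 * s ^ v) C m"
proof -
  let ?l = "fejer_weight (m + v) v" and ?w = "cis (2 * pi / real (m + v))"
  define c where "c = (\<lambda>i. (deriv ^^ i) f 0 / fact i)"
  obtain C where "order_bound (\<lambda>z. f z - (\<Sum>i\<le>m - 1. c i * z ^ i)) C (Suc (m - 1))"
    using holomorphic_taylor_bound[OF f R, of "m - 1"] unfolding c_def by blast
  then obtain r where r: "0 < r" "\<And>z. cmod z < r \<Longrightarrow> cmod (f z - (\<Sum>i\<le>m - 1. c i * z ^ i)) \<le> C * cmod z ^ Suc (m - 1)"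
    by (auto simp: eventually_nhds_0)
  have "{..m - 1} = {..<m}" using v by auto
  with r have rem: "cmod (f z - (\<Sum>i<m. c i * z ^ i)) \<le> C * cmod z ^ m" if "cmod z < r" for z
    using that v by simp
  note sum_l = sum_fejer_weight_1[OF v]
  have "cmod ((\<Sum>k<m + v. of_real (?l k) * f (s * ?w ^ k)) - c v / 2 * s ^ v) \<le> C * cmod s ^ m"
    if s: "cmod s < r" for s
  proof -
    have "(\<Sum>k<m + v. of_real (?l k) * (\<Sum>i<m. c i * (s * ?w ^ k) ^ i))
      = (\<Sum>i<m. c i * s ^ i * (\<Sum>k<m + v. of_real (?l k) * ?w ^ (k * i)))"
      unfolding sum_distrib_left
      by (subst sum.swap) (simp add: power_mult_distrib power_mult mult_ac)
    also have "\<dots> = (\<Sum>i<m. c i * s ^ i * (if i = 0 then 1 else if i = v then 1 / 2 else 0))"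
      by (intro sum.cong refl arg_cong2[where f = "(*)"] sum_fejer_weight[OF v]) auto
    also have "\<dots> = (\<Sum>i<m. if i = v then c v / 2 * s ^ v else 0)"
      using f0 v by (intro sum.cong) (auto simp: c_def)
    also have "\<dots> = c v / 2 * s ^ v" using v by simp
    finally have eq: "(\<Sum>k<m + v. of_real (?l k) * f (s * ?w ^ k)) - c v / 2 * s ^ v
      = (\<Sum>k<m + v. of_real (?l k) * (f (s * ?w ^ k) - (\<Sum>i<m. c i * (s * ?w ^ k) ^ i)))"
      by (simp add: right_diff_distrib sum_subtractf)
    have norm: "cmod (s * ?w ^ k) = cmod s" for k by (simp add: norm_mult norm_power)
    have "cmod (\<Sum>k<m + v. of_real (?l k) * (f (s * ?w ^ k) - (\<Sum>i<m. c i * (s * ?w ^ k) ^ i)))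
      \<le> (\<Sum>k<m + v. ?l k * (C * cmod s ^ m))"
    proof (rule sum_norm_le)
      fix k
      show "cmod (of_real (?l k) * (f (s * ?w ^ k) - (\<Sum>i<m. c i * (s * ?w ^ k) ^ i))) \<le> ?l k * (C * cmod s ^ m)"
        using rem[of "s * ?w ^ k"] s unfolding norm
        by (simp add: norm_mult fejer_weight_nonneg mult_left_mono)
    qed
    also have "\<dots> = C * cmod s ^ m"
      using sum_l by (simp flip: sum_distrib_right)
    finally show ?thesis unfolding eq .
  qed
  then show ?thesis
    using that[of C] r(1) unfolding eventually_nhds_0 c_def by blast
qed

text \<open>v is the least order at which some component of f - p has a nonzero derivative; it
  exists because otherwise the identity theorem would make every component constant.\<close>

lemma disc_order_expansion:
  fixes f :: "complex \<Rightarrow> complex ^ 'n"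
  assumes "analytic_disc p f"
  obtains v \<beta> where "0 < v" "disc_order f = enat v" "\<beta> \<noteq> 0"
    "\<And>j. \<exists>C. order_bound (\<lambda>z. f z $ j - p $ j - \<beta> $ j * z ^ v) C (Suc v)"
proof -
  define h where "h = (\<lambda>j z. f z $ j - f 0 $ j)"
  have f0: "f 0 = p" and nc: "\<not> f constant_on ball 0 1"
    using assms by (auto simp: analytic_disc_def)
  have hol: "h j holomorphic_on ball 0 1" for j
    using assms unfolding h_def analytic_disc_def by (intro holomorphic_intros) auto
  define A where "A = {k. \<exists>j. (deriv ^^ k) (h j) 0 \<noteq> 0}"
  have "A \<noteq> {}"
  proof
    assume "A = {}"
    then have "(deriv ^^ k) (h j) 0 = 0" for k j by (auto simp: A_def)
    then have h: "h j w = h j 0" if "w \<in> ball 0 1" for j w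
      using holomorphic_fun_eq_const_on_connected[OF hol[of j] open_ball _ _ _ that, where z = 0] by simp
    have "f w = f 0" if "w \<in> ball 0 1" for w
      using h[OF that] by (auto simp: vec_eq_iff h_def)
    then show False using nc unfolding constant_on_def by blast
  qed
  define v where "v = (LEAST k. k \<in> A)"
  have vA: "v \<in> A" unfolding v_def using \<open>A \<noteq> {}\<close> by (metis LeastI ex_in_conv)
  have lower: "(deriv ^^ k) (h j) 0 = 0" if "k < v" for k j
    using not_less_Least[of k "\<lambda>k. k \<in> A"] that unfolding v_def[symmetric] by (auto simp: A_def)
  have "0 \<notin> A" by (simp add: A_def h_def)
  then have "0 < v" using vA by (metis neq0_conv)
  have "disc_order f = enat v"
  proof (rule antisym)
    obtain j where "(deriv ^^ v) (h j) 0 \<noteq> 0" using vA by (auto simp: A_def)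
    then show "disc_order f \<le> enat v"
      unfolding disc_order_def holo_order_def h_def by (intro INF_lower2[of j] Inf_lower) auto
    show "enat v \<le> disc_order f"
      unfolding disc_order_def holo_order_def
    proof (intro INF_greatest Inf_greatest)
      fix j x assume "x \<in> {enat k |k. (deriv ^^ k) (\<lambda>z. f z $ j - f 0 $ j) 0 \<noteq> 0}"
      then show "enat v \<le> x" using lower[of _ j] by (fastforce simp: h_def not_less[symmetric])
    qed
  qed
  define \<beta> where "\<beta> = (\<chi> j. (deriv ^^ v) (h j) 0 / fact v)"
  have "\<beta> \<noteq> 0" using vA by (auto simp: A_def \<beta>_def vec_eq_iff)
  moreover have "\<exists>C. order_bound (\<lambda>z. f z $ j - p $ j - \<beta> $ j * z ^ v) C (Suc v)" for j
  proof -
    obtain C where C: "order_bound (\<lambda>z. h j z - (\<Sum>i\<le>v. (deriv ^^ i) (h j) 0 / fact i * z ^ i)) C (Suc v)"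
      using holomorphic_taylor_bound[OF hol] zero_less_one by blast
    have "(\<Sum>i\<le>v. (deriv ^^ i) (h j) 0 / fact i * z ^ i) = \<beta> $ j * z ^ v" for z
    proof -
      have "(\<Sum>i\<le>v. (deriv ^^ i) (h j) 0 / fact i * z ^ i) = (\<Sum>i\<in>{v}. (deriv ^^ i) (h j) 0 / fact i * z ^ i)"
        by (rule sum.mono_neutral_right) (use lower in auto)
      then show ?thesis by (simp add: \<beta>_def)
    qed
    then show ?thesis using C by (auto simp: h_def f0)
  qed
  ultimately show ?thesis
    using that[of v \<beta>] \<open>0 < v\<close> \<open>disc_order f = enat v\<close> by blast
qed

section \<open>Discs and their order of contact\<close>

lemma isCont_tendsto_nhds: "isCont g p \<Longrightarrow> (g \<longlongrightarrow> g p) (nhds p)"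
  by (simp add: isCont_def tendsto_at_iff_tendsto_nhds)

lemma log_near_nhds:
  assumes "0 < H"
  shows "\<forall>\<^sub>F w in nhds p. log_near p H w"
proof -
  have "\<forall>\<^sub>F w in nhds p. if p $ j = 0 then cmod (w $ j) < H else w $ j \<noteq> 0 \<and> \<bar>ln (cmod (w $ j / p $ j))\<bar> < H" for j
  proof (cases "p $ j = 0")
    case True
    have "isCont (\<lambda>w. cmod (w $ j)) p" by (intro continuous_intros)
    then have "((\<lambda>w. cmod (w $ j)) \<longlongrightarrow> cmod (p $ j)) (nhds p)"
      by (rule isCont_tendsto_nhds)
    from order_tendstoD(2)[OF this, of H] show ?thesis using True assms by simp
  next
    case False
    have "isCont (\<lambda>w. w $ j) p" by (intro continuous_intros)
    then have "((\<lambda>w. w $ j) \<longlongrightarrow> p $ j) (nhds p)"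
      by (rule isCont_tendsto_nhds)
    then have nz: "\<forall>\<^sub>F w in nhds p. w $ j \<noteq> 0"
      by (rule tendsto_imp_eventually_ne) (rule False)
    have "isCont (\<lambda>w. \<bar>ln (cmod (w $ j / p $ j))\<bar>) p"
      using False by (intro continuous_intros) auto
    then have "((\<lambda>w. \<bar>ln (cmod (w $ j / p $ j))\<bar>) \<longlongrightarrow> \<bar>ln (cmod (p $ j / p $ j))\<bar>) (nhds p)"
      by (rule isCont_tendsto_nhds)
    from order_tendstoD(2)[OF this, of H] False assms
    have "\<forall>\<^sub>F w in nhds p. \<bar>ln (cmod (w $ j / p $ j))\<bar> < H" by simp
    from eventually_conj[OF nz this] show ?thesis using False by simp
  qed
  then show ?thesis
    unfolding log_near_def by (intro eventually_all_finite)
qed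

lemma smooth_on_lipschitz:
  fixes \<rho> :: "'a::euclidean_space \<Rightarrow> real"
  assumes "open U" "smooth_on U \<rho>" "p \<in> U"
  obtains L E where "0 < E" "0 \<le> L" "\<And>x y. x \<in> ball p E \<Longrightarrow> y \<in> ball p E \<Longrightarrow> \<bar>\<rho> x - \<rho> y\<bar> \<le> L * norm (x - y)"
proof -
  obtain E where E: "0 < E" "cball p E \<subseteq> U"
    using assms open_contains_cball by blast
  have "\<exists>B. \<forall>x\<in>cball p E. norm (fderiv \<rho> x b) \<le> B" for b
  proof -
    have "continuous_on (cball p E) (\<lambda>x. fderiv \<rho> x b)"
      using Ck_on_continuous[OF smooth_on_Ck[OF smooth_on_frechet[OF assms(2)], of 0]] E(2) continuous_on_subset by blast
    then have "bounded ((\<lambda>x. fderiv \<rho> x b) ` cball p E)"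
      using compact_cball compact_continuous_image compact_imp_bounded by blast
    then show ?thesis unfolding bounded_iff by blast
  qed
  then obtain B where B: "\<And>b x. x \<in> cball p E \<Longrightarrow> norm (fderiv \<rho> x b) \<le> B b" by metis
  have B0: "0 \<le> B b" for b
    using B[of p b] E(1) by (meson centre_in_cball less_imp_le norm_ge_zero order_trans)
  define L where "L = (\<Sum>b\<in>Basis. B b)"
  have "onorm (fderiv \<rho> x) \<le> L" if x: "x \<in> ball p E" for x
  proof (rule onorm_le)
    fix v
    have xU: "x \<in> U" "x \<in> cball p E" using x E(2) by (auto simp: subset_iff)
    have lin: "linear (fderiv \<rho> x)"
      using smooth_on_has_derivative[OF assms(2) xU(1)] has_derivative_linear by blast
    have "fderiv \<rho> x v = fderiv \<rho> x (\<Sum>b\<in>Basis. (v \<bullet> b) *\<^sub>R b)"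
      by (simp add: euclidean_representation)
    also have "\<dots> = (\<Sum>b\<in>Basis. (v \<bullet> b) * fderiv \<rho> x b)"
      by (simp add: linear_sum[OF lin] linear_scale[OF lin])
    also have "norm \<dots> \<le> (\<Sum>b\<in>Basis. norm v * B b)"
      by (intro sum_norm_le) (use B[OF xU(2)] Basis_le_norm in \<open>auto simp: abs_mult intro!: mult_mono\<close>)
    also have "\<dots> = L * norm v"
      unfolding L_def sum_distrib_right by (simp add: mult.commute)
    finally show "norm (fderiv \<rho> x v) \<le> L * norm v" .
  qed
  note on = this
  have "norm (\<rho> x - \<rho> y) \<le> L * norm (x - y)" if "x \<in> ball p E" "y \<in> ball p E" for x y
  proof (rule differentiable_bound[of "ball p E" \<rho> "\<lambda>x. fderiv \<rho> x"])
    fix z assume "z \<in> ball p E"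
    then have "z \<in> U" using E(2) ball_subset_cball by blast
    then show "(\<rho> has_derivative fderiv \<rho> z) (at z within ball p E)"
      by (rule has_derivative_at_withinI[OF smooth_on_has_derivative[OF assms(2)]])
  qed (use that on in auto)
  moreover have "0 \<le> L" unfolding L_def by (intro sum_nonneg B0)
  ultimately show ?thesis using that E(1) by simp
qed

lemma analytic_disc_smooth:
  assumes "analytic_disc p f" "open U" "p \<in> U" "smooth_on U \<rho>"
  obtains S where "open S" "0 \<in> S" "smooth_on S (\<rho> \<circ> f)"
proof -
  have hol: "(\<lambda>z. f z $ j) holomorphic_on ball 0 1" for j
    using assms(1) by (auto simp: analytic_disc_def)
  have f0: "f 0 = p"
    using assms(1) by (auto simp: analytic_disc_def)
  have C: "Ck_on k f (ball 0 1)" for k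
    by (rule Ck_on_holomorphic_vec[OF open_ball hol])
  define S where "S = ball 0 1 \<inter> f -` U"
  have "open S"
    unfolding S_def by (rule continuous_open_preimage[OF Ck_on_continuous[OF C] open_ball assms(2)])
  moreover have "Ck_on k (\<lambda>z. \<rho> (f z)) S" for k
    by (rule Ck_on_compose[OF \<open>open S\<close> smooth_on_Ck[OF assms(4)] Ck_on_subset[OF C]]) (auto simp: S_def)
  moreover have "0 \<in> S" using f0 assms(3) by (simp add: S_def)
  ultimately show ?thesis using that by (simp add: smooth_on_def o_def)
qed

section \<open>The comparison disc and its tangency\<close>

lemma one_le_smooth_order:
  assumes "u 0 = 0"
  shows "enat 1 \<le> smooth_order u"
  unfolding smooth_order_def
proof (intro Inf_greatest)
  fix x assume "x \<in> {enat (a + b) |a b. (wirt id ^^ a) ((wirt_bar id ^^ b) (\<lambda>z. of_real (u z))) 0 \<noteq> 0}"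
  then obtain a b where ab: "x = enat (a + b)" "(wirt id ^^ a) ((wirt_bar id ^^ b) (\<lambda>z. of_real (u z))) 0 \<noteq> 0"
    by blast
  have "a + b \<noteq> 0"
  proof
    assume "a + b = 0"
    then show False using ab(2) assms by simp
  qed
  then show "enat 1 \<le> x" using ab(1) by (simp add: Suc_le_eq)
qed

text \<open>Where p_j \<noteq> 0 the disc is a straight line in logarithmic coordinates, so log |g_j
  / p_j| is the real part of a linear function of z. Tangency at p thus keeps the disc in the
  logarithmic tangent plane, not only to first order.\<close>

definition exp_disc :: "complex ^ 'n \<Rightarrow> complex ^ 'n \<Rightarrow> complex \<Rightarrow> complex ^ 'n" where
  "exp_disc p \<beta> = (\<lambda>z. \<chi> j. if p $ j = 0 then \<beta> $ j * z / 2 else p $ j * exp (\<beta> $ j / p $ j / 2 * z))"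

lemma exp_disc_0 [simp]: "exp_disc p \<beta> 0 = p"
  by (simp add: exp_disc_def vec_eq_iff)

lemma holomorphic_exp_disc: "(\<lambda>z. exp_disc p \<beta> z $ j) holomorphic_on S"
  by (cases "p $ j = 0") (auto simp: exp_disc_def intro!: holomorphic_intros)

lemma deriv_exp_disc: "((\<lambda>z. exp_disc p \<beta> z $ j) has_field_derivative \<beta> $ j / 2) (at 0)"
  by (cases "p $ j = 0") (auto simp: exp_disc_def intro!: derivative_eq_intros)

lemma regular_exp_disc:
  assumes "\<beta> \<noteq> 0"
  shows "regular_disc p (exp_disc p \<beta>)"
proof -
  obtain j where j: "\<beta> $ j \<noteq> 0" using assms by (auto simp: vec_eq_iff)
  have "\<not> exp_disc p \<beta> constant_on ball 0 1"
  proof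
    assume "exp_disc p \<beta> constant_on ball 0 1"
    then have "\<forall>z\<in>ball 0 1. exp_disc p \<beta> z $ j = p $ j"
      unfolding constant_on_def by (metis centre_in_ball exp_disc_0 zero_less_one)
    then have "((\<lambda>z. p $ j) has_field_derivative \<beta> $ j / 2) (at 0)"
      using has_field_derivative_transform_within_open[OF deriv_exp_disc, of "ball 0 1" p \<beta> j "\<lambda>z. p $ j"] by simp
    then have "\<beta> $ j / 2 = 0" using DERIV_const DERIV_unique by blast
    then show False using j by simp
  qed
  moreover have "deriv (\<lambda>z. exp_disc p \<beta> z $ j) 0 \<noteq> 0"
    unfolding DERIV_imp_deriv[OF deriv_exp_disc] using j by simp
  ultimately show ?thesis
    unfolding regular_disc_def analytic_disc_def by (auto intro: holomorphic_exp_disc)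
qed

lemma regular_disc_order:
  assumes "regular_disc p g"
  shows "disc_order g = enat 1"
proof -
  obtain v \<beta> where v: "0 < v" "disc_order g = enat v"
    using disc_order_expansion assms unfolding regular_disc_def by metis
  obtain j where j: "deriv (\<lambda>z. g z $ j) 0 \<noteq> 0" and "(\<lambda>z. g z $ j) holomorphic_on ball 0 1"
    using assms by (auto simp: regular_disc_def analytic_disc_def)
  then have "((\<lambda>z. g z $ j) has_field_derivative deriv (\<lambda>z. g z $ j) 0) (at 0)"
    by (intro holomorphic_derivI[OF _ open_ball]) auto
  then have "((\<lambda>z. g z $ j - g 0 $ j) has_field_derivative deriv (\<lambda>z. g z $ j) 0 - 0) (at 0)"
    by (intro DERIV_diff DERIV_const)
  then have "deriv (\<lambda>z. g z $ j - g 0 $ j) 0 \<noteq> 0"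
    using DERIV_imp_deriv j by fastforce
  then have "(deriv ^^ 1) (\<lambda>z. g z $ j - g 0 $ j) 0 \<noteq> 0" by simp
  then have "disc_order g \<le> enat 1"
    unfolding disc_order_def holo_order_def by (intro INF_lower2[of j] Inf_lower) blast+
  then show ?thesis using v by simp
qed

text \<open>The quadratic error of \<open>Ln\<close> has order 2 v \<ge> v + 1 and leaves the
  leading term unchanged.\<close>

lemma Ln_expansion:
  fixes u :: "complex \<Rightarrow> complex"
  assumes u: "order_bound (\<lambda>z. u z - c * z ^ v) C (Suc v)" and v: "0 < v"
  obtains C' where "order_bound (\<lambda>z. Ln (1 + u z) - c * z ^ v) C' (Suc v)"
proof -
  define M where "M = cmod c + \<bar>C\<bar>"
  have M: "0 \<le> M" by (simp add: M_def)
  obtain r where r: "0 < r" "\<And>z. cmod z < r \<Longrightarrow> cmod (u z - c * z ^ v) \<le> C * cmod z ^ Suc v"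
    using u by (auto simp: eventually_nhds_0)
  define r' where "r' = min r (min 1 (1 / (2 * (M + 1))))"
  have r': "0 < r'" "r' \<le> r" "r' \<le> 1" "r' \<le> 1 / (2 * (M + 1))"
    using r(1) M by (auto simp: r'_def min_le_iff_disj)
  have "cmod (Ln (1 + u z) - c * z ^ v) \<le> (\<bar>C\<bar> + 2 * M\<^sup>2) * cmod z ^ Suc v" if z: "cmod z < r'" for z
  proof -
    have z1: "cmod z \<le> 1" using z r' by linarith
    have d: "cmod (u z - c * z ^ v) \<le> \<bar>C\<bar> * cmod z ^ Suc v"
      using r(2)[of z] z r' mult_right_mono[OF abs_ge_self[of C], of "cmod z ^ Suc v"] by simp
    have "cmod (u z) \<le> cmod (c * z ^ v) + cmod (u z - c * z ^ v)"
      using norm_triangle_ineq[of "c * z ^ v" "u z - c * z ^ v"] by simp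
    also have "\<dots> \<le> cmod c * cmod z ^ v + \<bar>C\<bar> * cmod z ^ v"
    proof (rule add_mono)
      have "cmod z ^ Suc v \<le> cmod z ^ v" using z1 by (intro power_decreasing) auto
      then show "cmod (u z - c * z ^ v) \<le> \<bar>C\<bar> * cmod z ^ v"
        using d mult_left_mono[of "cmod z ^ Suc v" "cmod z ^ v" "\<bar>C\<bar>"] by linarith
    qed (simp add: norm_mult norm_power)
    finally have uM: "cmod (u z) \<le> M * cmod z ^ v" by (simp add: M_def algebra_simps)
    have "M * cmod z ^ v \<le> M * cmod z ^ 1"
      using v z1 M by (intro mult_left_mono power_decreasing) auto
    also have "\<dots> \<le> (M + 1) * (1 / (2 * (M + 1)))"
      using M z r' by (intro mult_mono) auto
    also have "\<dots> = 1 / 2" using M by simp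
    finally have half: "cmod (u z) \<le> 1 / 2" using uM by linarith
    have "cmod (Ln (1 + u z) - u z) \<le> (cmod (u z))\<^sup>2 / (1 - cmod (u z))"
      using Ln_approx_linear[of "u z"] half by simp
    also have "\<dots> \<le> (cmod (u z))\<^sup>2 / (1 / 2)"
      using half by (intro divide_left_mono) auto
    also have "\<dots> = 2 * (cmod (u z))\<^sup>2" by simp
    also have "\<dots> \<le> 2 * (M * cmod z ^ v)\<^sup>2"
      using uM by (intro mult_left_mono power_mono) auto
    also have "\<dots> = 2 * M\<^sup>2 * cmod z ^ (2 * v)"
      by (simp add: power_mult_distrib power_mult[symmetric] mult.commute)
    also have "\<dots> \<le> 2 * M\<^sup>2 * cmod z ^ Suc v"
      using v z1 by (intro mult_left_mono power_decreasing) auto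
    finally have "cmod (Ln (1 + u z) - u z) \<le> 2 * M\<^sup>2 * cmod z ^ Suc v" .
    then show ?thesis
      using d norm_triangle_ineq[of "Ln (1 + u z) - u z" "u z - c * z ^ v"] by (simp add: algebra_simps)
  qed
  then show ?thesis
    using that[of "\<bar>C\<bar> + 2 * M\<^sup>2"] r'(1) unfolding eventually_nhds_0 by blast
qed

text \<open>Along s u, with u a v-th root of w, the disc moves by s^v b up to O(s^(v+1)), while
  \<rho> is O(s^(v+1)) because m > v. The Lipschitz bound transfers this to \<rho>(p + s^v b), and
  division by s^v leaves D b = 0. The root makes all complex multiples of \<beta> reachable.\<close>

lemma leading_direction_tangent:
  fixes \<rho> :: "complex ^ 'n \<Rightarrow> real"
  assumes D: "(\<rho> has_derivative D) (at p)" and p: "\<rho> p = 0"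
    and L: "0 < E" "0 \<le> L" "\<And>x y. x \<in> ball p E \<Longrightarrow> y \<in> ball p E \<Longrightarrow> \<bar>\<rho> x - \<rho> y\<bar> \<le> L * norm (x - y)"
    and f: "\<And>j. \<exists>C. order_bound (\<lambda>z. f z $ j - p $ j - \<beta> $ j * z ^ v) C (Suc v)"
    and cont: "(f \<longlongrightarrow> p) (nhds 0)" and v: "0 < v" "v < m"
    and bound: "\<forall>\<^sub>F z in nhds 0. \<bar>\<rho> (f z)\<bar> \<le> C1 * cmod z ^ m"
  shows "D (\<chi> j. \<beta> $ j * w) = 0"
proof -
  obtain u where u: "u ^ v = w" using exists_complex_root[of v w] v(1) by auto
  define b where "b = (\<chi> j. \<beta> $ j * w)"
  have "\<forall>j. \<exists>C. order_bound (\<lambda>z. f z $ j - p $ j - \<beta> $ j * z ^ v) C (Suc v)"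
    using f by blast
  from choice[OF this] obtain C
    where C: "\<forall>j. order_bound (\<lambda>z. f z $ j - p $ j - \<beta> $ j * z ^ v) (C j) (Suc v)"
    by blast
  have "\<forall>\<^sub>F z in nhds 0. \<forall>j. cmod (f z $ j - p $ j - \<beta> $ j * z ^ v) \<le> C j * cmod z ^ Suc v"
    using C by (intro eventually_all_finite) blast
  moreover have "\<forall>\<^sub>F z in nhds 0. f z \<in> ball p E"
    using cont L(1) by (intro topological_tendstoD) auto
  ultimately have ev: "\<forall>\<^sub>F z in nhds 0. (\<forall>j. cmod (f z $ j - p $ j - \<beta> $ j * z ^ v) \<le> C j * cmod z ^ Suc v)
      \<and> f z \<in> ball p E \<and> \<bar>\<rho> (f z)\<bar> \<le> C1 * cmod z ^ m"
    using bound by eventually_elim auto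
  have lim: "((\<lambda>s :: real. s *\<^sub>R u) \<longlongrightarrow> 0) (at_right 0)"
    by (auto intro!: tendsto_eq_intros)
  have ev1: "\<forall>\<^sub>F s in at_right 0. (\<forall>j. cmod (f (s *\<^sub>R u) $ j - p $ j - \<beta> $ j * (s *\<^sub>R u) ^ v) \<le> C j * cmod (s *\<^sub>R u) ^ Suc v)
      \<and> f (s *\<^sub>R u) \<in> ball p E \<and> \<bar>\<rho> (f (s *\<^sub>R u))\<bar> \<le> C1 * cmod (s *\<^sub>R u) ^ m"
    using eventually_compose_filterlim[OF ev lim] .
  have "((\<lambda>s :: real. p + s ^ v *\<^sub>R b) \<longlongrightarrow> p + 0 ^ v *\<^sub>R b) (at_right 0)"
    by (intro tendsto_intros)
  then have ev2: "\<forall>\<^sub>F s in at_right 0. p + s ^ v *\<^sub>R b \<in> ball p E"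
    by (rule topological_tendstoD) (use L(1) v in \<open>auto simp: zero_power\<close>)
  have ev3: "\<forall>\<^sub>F s in at_right (0 :: real). s \<in> {0<..<1}"
    by (intro eventually_at_right_real) simp
  define K where "K = \<bar>C1\<bar> * cmod u ^ m + L * ((\<Sum>j\<in>UNIV. \<bar>C j\<bar>) * cmod u ^ Suc v)"
  have "\<forall>\<^sub>F s in at_right 0. norm (\<rho> (p + s ^ v *\<^sub>R b) / s ^ v) \<le> K * s"
    using ev1 ev2 ev3
  proof eventually_elim
    case (elim s)
    let ?z = "s *\<^sub>R u"
    have s: "0 < s" "s \<le> 1" using elim by auto
    have nz: "cmod ?z = s * cmod u" using s by simp
    have comp: "(f ?z - (p + s ^ v *\<^sub>R b)) $ j = f ?z $ j - p $ j - \<beta> $ j * ?z ^ v" for j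
      by (simp add: b_def u[symmetric] power_mult_distrib algebra_simps)
    have "norm (f ?z - (p + s ^ v *\<^sub>R b)) \<le> (\<Sum>j\<in>UNIV. cmod (f ?z $ j - p $ j - \<beta> $ j * ?z ^ v))"
      using norm_le_sum_components[of "f ?z - (p + s ^ v *\<^sub>R b)"] unfolding comp .
    also have "\<dots> \<le> (\<Sum>j\<in>UNIV. \<bar>C j\<bar> * cmod ?z ^ Suc v)"
    proof (rule sum_mono)
      fix j
      have "cmod (f ?z $ j - p $ j - \<beta> $ j * ?z ^ v) \<le> C j * cmod ?z ^ Suc v" using elim by blast
      also have "\<dots> \<le> \<bar>C j\<bar> * cmod ?z ^ Suc v" by (intro mult_right_mono) auto
      finally show "cmod (f ?z $ j - p $ j - \<beta> $ j * ?z ^ v) \<le> \<bar>C j\<bar> * cmod ?z ^ Suc v" .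
    qed
    also have "\<dots> = (\<Sum>j\<in>UNIV. \<bar>C j\<bar>) * cmod u ^ Suc v * s ^ Suc v"
      unfolding nz power_mult_distrib sum_distrib_right by (intro sum.cong refl) (simp only: mult_ac)
    finally have dist: "norm (f ?z - (p + s ^ v *\<^sub>R b)) \<le> (\<Sum>j\<in>UNIV. \<bar>C j\<bar>) * cmod u ^ Suc v * s ^ Suc v" .
    have "\<bar>\<rho> (f ?z) - \<rho> (p + s ^ v *\<^sub>R b)\<bar> \<le> L * norm (f ?z - (p + s ^ v *\<^sub>R b))"
      using L(3) elim by blast
    also have "\<dots> \<le> L * ((\<Sum>j\<in>UNIV. \<bar>C j\<bar>) * cmod u ^ Suc v * s ^ Suc v)"
      using dist L(2) by (rule mult_left_mono)
    finally have 1: "\<bar>\<rho> (f ?z) - \<rho> (p + s ^ v *\<^sub>R b)\<bar> \<le> L * ((\<Sum>j\<in>UNIV. \<bar>C j\<bar>) * cmod u ^ Suc v) * s ^ Suc v"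
      by (simp add: mult.assoc)
    have "\<bar>\<rho> (f ?z)\<bar> \<le> C1 * cmod ?z ^ m" using elim by blast
    also have "\<dots> \<le> \<bar>C1\<bar> * cmod u ^ m * s ^ m"
      unfolding nz power_mult_distrib using s by (simp add: mult_ac mult_right_mono)
    also have "\<dots> \<le> \<bar>C1\<bar> * cmod u ^ m * s ^ Suc v"
      using s v by (intro mult_left_mono power_decreasing) auto
    finally have "\<bar>\<rho> (p + s ^ v *\<^sub>R b)\<bar> \<le> K * s ^ Suc v"
      using 1 by (simp add: K_def distrib_right)
    then show ?case
      using s by (simp add: abs_mult field_simps)
  qed
  moreover have "((\<lambda>s. K * s) \<longlongrightarrow> K * 0) (at_right 0)"
    by (intro tendsto_intros)
  then have "((\<lambda>s. K * s) \<longlongrightarrow> 0) (at_right 0)" by simp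
  ultimately have zero: "((\<lambda>s. \<rho> (p + s ^ v *\<^sub>R b) / s ^ v) \<longlongrightarrow> 0) (at_right 0)"
    by (rule Lim_null_comparison)
  have "((\<lambda>t. \<rho> (p + t *\<^sub>R b)) has_real_derivative D b) (at 0)"
    using has_vector_derivative_along_line[of \<rho> D p 0 b] D
    by (simp add: has_real_derivative_iff_has_vector_derivative)
  then have "((\<lambda>t. \<rho> (p + t *\<^sub>R b) / t) \<longlongrightarrow> D b) (at 0)"
    using p by (simp add: DERIV_def)
  moreover have "filterlim (\<lambda>s :: real. s ^ v) (at 0) (at_right 0)"
  proof -
    have "((\<lambda>s :: real. s ^ v) \<longlongrightarrow> 0 ^ v) (at_right 0)" by (intro tendsto_intros)
    moreover have "\<forall>\<^sub>F s in at_right (0 :: real). s ^ v \<noteq> 0"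
      using ev3 by eventually_elim auto
    ultimately show ?thesis using v by (simp add: filterlim_at zero_power)
  qed
  ultimately have "((\<lambda>s. \<rho> (p + s ^ v *\<^sub>R b) / s ^ v) \<longlongrightarrow> D b) (at_right 0)"
    using filterlim_compose by blast
  then have "D b = 0"
    using zero tendsto_unique trivial_limit_at_right_real by blast
  then show ?thesis by (simp add: b_def)
qed

lemma exp_lipschitz_unit_ball:
  fixes a b :: complex
  assumes "cmod a \<le> 1" "cmod b \<le> 1"
  shows "cmod (exp a - exp b) \<le> exp 1 * cmod (a - b)"
proof (rule field_differentiable_bound[OF convex_cball[of 0 1], where f' = exp])
  show "cmod (exp z) \<le> exp 1" if "z \<in> cball 0 1" for z :: complex
    using that complex_Re_le_cmod[of z] by simp
qed (use assms in \<open>auto intro: DERIV_exp has_field_derivative_at_within\<close>)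

lemma exp_disc_of_high_contact:
  assumes \<Omega>: "open \<Omega>" and pc: "pseudoconvex \<Omega>" and R: "reinhardt \<Omega>"
    and def: "smooth_defining_function \<Omega> \<rho>" and p: "p \<in> frontier \<Omega>"
    and f: "analytic_disc p f" and v: "0 < v" "v < m" and \<beta>: "\<beta> \<noteq> 0"
    and expansion: "\<And>j. \<exists>C. order_bound (\<lambda>z. f z $ j - p $ j - \<beta> $ j * z ^ v) C (Suc v)"
    and order: "enat m \<le> smooth_order (\<rho> \<circ> f)"
  shows "enat m \<le> enat v * smooth_order (\<rho> \<circ> exp_disc p \<beta>)"
proof -
  let ?g = "exp_disc p \<beta>" and ?e = "log_gradient \<rho> p"
  let ?l = "fejer_weight (m + v) v"
  define w where "w = cis (2 * pi / real (m + v))"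
  obtain U where U: "open U" "frontier \<Omega> \<subseteq> U" "smooth_on U \<rho>" "\<rho> p = 0"
    using def p unfolding smooth_defining_function_def by blast
  have pU: "p \<in> U" using U(2) p by blast
  have D: "(\<rho> has_derivative fderiv \<rho> p) (at p)"
    using smooth_on_has_derivative[OF U(3) pU] .
  have e0: "?e $ j = 0" if "p $ j = 0" for j
    using log_gradient_zero[OF has_derivative_linear[OF D] that] .
  obtain L EL where L: "0 < EL" "0 \<le> L"
    "\<And>x y. x \<in> ball p EL \<Longrightarrow> y \<in> ball p EL \<Longrightarrow> \<bar>\<rho> x - \<rho> y\<bar> \<le> L * norm (x - y)"
    by (rule smooth_on_lipschitz[OF U(1,3) pU]) (rule that)
  obtain \<delta> a \<kappa> where T: "transversal \<rho> p ?e \<delta> a \<kappa>"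
    using transversal_exists[OF R def p] .
  have pos: "0 < \<delta>" "0 < a" "0 < \<kappa>" using transversal_pos[OF T] by auto
  obtain H where H: "0 < H"
    and convexity: "log_convex_near \<Omega> p H"
    and supp: "\<And>z. log_near p H z \<Longrightarrow> (\<Sum>j\<in>UNIV. ?e $ j * ln (cmod (z $ j / p $ j))) = 0 \<Longrightarrow> z \<notin> \<Omega>"
    by (rule local_log_convexity[OF \<Omega> pc R def p]) (rule that)
  have hol: "(\<lambda>z. f z $ j) holomorphic_on ball 0 1" for j
    using f by (auto simp: analytic_disc_def)
  have f0: "f 0 = p" using f by (auto simp: analytic_disc_def)
  have "continuous_on (ball 0 1) f"
    using Ck_on_continuous[OF Ck_on_holomorphic_vec[OF open_ball hol]] .
  then have "isCont f 0" by (simp add: continuous_on_eq_continuous_at)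
  from isCont_tendsto_nhds[OF this] have fp: "(f \<longlongrightarrow> p) (nhds 0)"
    unfolding f0 .
  obtain C1 r1 where r1: "0 < r1" and C1: "0 \<le> C1" "\<And>z. cmod z < r1 \<Longrightarrow> \<bar>\<rho> (f z)\<bar> \<le> C1 * cmod z ^ m"
  proof -
    obtain S where S: "open S" "0 \<in> S" "smooth_on S (\<rho> \<circ> f)"
      using analytic_disc_smooth[OF f U(1) pU U(3)] .
    obtain C r where "0 < r" "0 \<le> C" "\<And>z. cmod z < r \<Longrightarrow> \<bar>(\<rho> \<circ> f) z\<bar> \<le> C * cmod z ^ m"
      by (rule smooth_order_imp_bound[OF S order]) (rule that)
    then show thesis using that[of r C] by simp
  qed
  then have bound: "\<forall>\<^sub>F z in nhds 0. \<bar>\<rho> (f z)\<bar> \<le> C1 * cmod z ^ m"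
    unfolding eventually_nhds_0 by blast

  have tangent: "fderiv \<rho> p (\<chi> j. \<beta> $ j * z) = 0" for z
    by (rule leading_direction_tangent[OF D U(4) L expansion fp v bound])
  \<comment> \<open>On g the sum in \<open>supp\<close> equals the derivative of \<rho> at p in
    direction \<beta> z / 2, which vanishes by \<open>tangent\<close>.\<close>
  have nonneg: "\<forall>\<^sub>F z in nhds 0. 0 \<le> \<rho> (?g z)"
  proof -
    have "continuous_on UNIV ?g"
      by (rule Ck_on_continuous[OF Ck_on_holomorphic_vec[OF open_UNIV holomorphic_exp_disc]])
    then have "isCont ?g 0" by (simp add: continuous_on_eq_continuous_at)
    then have "(?g \<longlongrightarrow> p) (nhds 0)" using isCont_tendsto_nhds by fastforce
    then have "\<forall>\<^sub>F z in nhds 0. log_near p H (?g z)"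
      using eventually_compose_filterlim[OF log_near_nhds[OF H]] by blast
    then show ?thesis
    proof eventually_elim
      case (elim z)
      have "?e $ j * ln (cmod (?g z $ j / p $ j)) = ?e $ j * Re ((\<chi> j. \<beta> $ j * (z / 2)) $ j / p $ j)" for j
        using e0[of j] by (cases "p $ j = 0") (auto simp: exp_disc_def norm_mult mult.commute)
      then have "(\<Sum>j\<in>UNIV. ?e $ j * ln (cmod (?g z $ j / p $ j))) = 0"
        using tangent[of "z / 2"] unfolding log_gradient_formula(1)[OF R def p] by (simp only:)
      then show ?case
        using supp[OF elim] notin_iff_nonneg[OF def] by blast
    qed
  qed

  \<comment> \<open>Translation by - c z lowers \<rho> by at least (C1 + 1) |z|^m: the part C1
    compensates \<rho> o f, and the part 1 leaves a strictly negative value for z \<noteq>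
    0.\<close>
  define c where "c = (\<lambda>z :: complex. (C1 + 1) / \<kappa> * cmod z ^ m)"
  have c0: "0 \<le> c z" for z using C1(1) pos by (simp add: c_def)
  define \<Psi> where "\<Psi> = (\<lambda>z. scale ((- c z) *\<^sub>R ?e) (f z))"
  have contc: "isCont c 0" unfolding c_def by (intro continuous_intros)
  have c_0: "c 0 = 0" using v by (simp add: c_def)
  have "continuous_on (ball 0 1) \<Psi>"
    unfolding \<Psi>_def c_def using \<open>continuous_on (ball 0 1) f\<close> by (intro continuous_intros)
  then have "isCont \<Psi> 0" by (simp add: continuous_on_eq_continuous_at)
  moreover have "\<Psi> 0 = p" using c_0 f0 by (simp add: \<Psi>_def)
  ultimately have "(\<Psi> \<longlongrightarrow> p) (nhds 0)"
    using isCont_tendsto_nhds by metis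
  then have ev1: "\<forall>\<^sub>F z in nhds 0. log_near p H (\<Psi> z)"
    using eventually_compose_filterlim[OF log_near_nhds[OF H]] by blast
  have ev2: "\<forall>\<^sub>F z in nhds 0. f z \<in> ball p \<delta>"
    using fp by (rule topological_tendstoD) (use pos in auto)
  have "(c \<longlongrightarrow> 0) (nhds 0)" using isCont_tendsto_nhds[OF contc] c_0 by simp
  then have ev3: "\<forall>\<^sub>F z in nhds 0. c z < a"
    by (rule order_tendstoD) (rule pos)
  have "\<forall>\<^sub>F z in nhds 0. z \<noteq> 0 \<longrightarrow> \<Psi> z \<in> \<Omega>"
    using ev2 ev3 bound
  proof eventually_elim
    case (elim z)
    show ?case
    proof
      assume "z \<noteq> 0"
      have "\<rho> (scale ((- c z) *\<^sub>R ?e) (f z)) + \<kappa> * (0 - (- c z)) \<le> \<rho> (scale (0 *\<^sub>R ?e) (f z))"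
        by (rule transversalD[OF T]) (use elim c0[of z] pos in auto)
      then have "\<rho> (\<Psi> z) \<le> \<rho> (f z) - (C1 + 1) * cmod z ^ m"
        using pos by (simp add: \<Psi>_def c_def)
      also have "\<dots> \<le> - (cmod z ^ m)" using elim by (simp add: algebra_simps abs_le_iff)
      also have "\<dots> < 0" using \<open>z \<noteq> 0\<close> by simp
      finally show "\<Psi> z \<in> \<Omega>" using notin_iff_nonneg[OF def] by (meson not_le)
    qed
  qed
  then have ev4: "\<forall>\<^sub>F z in nhds 0. z \<noteq> 0 \<longrightarrow> \<Psi> z \<in> \<Omega> \<and> log_near p H (\<Psi> z)"
    using ev1 by eventually_elim auto

  \<comment> \<open>Quotients within distance 1 of 1 avoid the branch cut of
    \<open>Ln\<close>.\<close>
  have "\<forall>\<^sub>F z in nhds 0. p $ j \<noteq> 0 \<longrightarrow> cmod (f z $ j / p $ j - 1) < 1" for j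
  proof (cases "p $ j = 0")
    case False
    have "((\<lambda>z. cmod (f z $ j / p $ j - 1)) \<longlongrightarrow> cmod (p $ j / p $ j - 1)) (nhds 0)"
      using fp False by (intro tendsto_intros filterlim_ident)
    from order_tendstoD(2)[OF this, of 1] False show ?thesis by simp
  qed simp
  then have "\<forall>\<^sub>F z in nhds 0. \<forall>j. p $ j \<noteq> 0 \<longrightarrow> cmod (f z $ j / p $ j - 1) < 1"
    by (rule eventually_all_finite)
  then obtain R1 where R1: "0 < R1" "\<And>z j. cmod z < R1 \<Longrightarrow> p $ j \<noteq> 0 \<Longrightarrow> cmod (f z $ j / p $ j - 1) < 1"
    unfolding eventually_nhds_0 by blast
  define R0 where "R0 = min R1 1"
  have R0: "0 < R0" using R1 by (simp add: R0_def)
  define F where "F = (\<lambda>j z. Ln (f z $ j / p $ j))"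
  \<comment> \<open>The mean of the complex logarithm, not only of its real part: the imaginary part
    does not affect moduli, but it brings W close to g itself rather than to its moduli.\<close>
  define X where "X = (\<lambda>j s. \<Sum>k<m + v. of_real (?l k) * F j (s * w ^ k))"
  have "\<exists>C. p $ j \<noteq> 0 \<longrightarrow> order_bound (\<lambda>s. X j s - \<beta> $ j / p $ j / 2 * s ^ v) C m" for j
  proof (cases "p $ j = 0")
    case False
    have pos_re: "f z $ j / p $ j \<notin> \<real>\<^sub>\<le>\<^sub>0" if "z \<in> ball 0 R0" for z
    proof -
      have "cmod (f z $ j / p $ j - 1) < 1" using R1(2) that False by (simp add: R0_def)
      then have "\<bar>Re (f z $ j / p $ j - 1)\<bar> < 1" using abs_Re_le_cmod order_le_less_trans by blast
      then show ?thesis using complex_nonpos_Reals_iff by force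
    qed
    have holF: "F j holomorphic_on ball 0 R0"
      unfolding F_def using False pos_re
      by (intro holomorphic_intros holomorphic_on_subset[OF hol]) (auto simp: R0_def)
    obtain C where "order_bound (\<lambda>z. f z $ j - p $ j - \<beta> $ j * z ^ v) C (Suc v)"
      using expansion by blast
    then have "order_bound (\<lambda>z. (f z $ j / p $ j - 1) - \<beta> $ j / p $ j * z ^ v) (C / cmod (p $ j)) (Suc v)"
    proof eventually_elim
      case (elim z)
      have "(f z $ j / p $ j - 1) - \<beta> $ j / p $ j * z ^ v = (f z $ j - p $ j - \<beta> $ j * z ^ v) / p $ j"
        using False by (simp add: field_simps)
      then show ?case using divide_right_mono[OF elim, of "cmod (p $ j)"] by (simp add: norm_divide)
    qed
    from Ln_expansion[OF this v(1)] obtain C'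
      where "order_bound (\<lambda>z. Ln (1 + (f z $ j / p $ j - 1)) - \<beta> $ j / p $ j * z ^ v) C' (Suc v)" .
    then have "order_bound (\<lambda>z. F j z - \<beta> $ j / p $ j * z ^ v) C' (Suc v)"
      by (simp add: F_def)
    then have "(deriv ^^ v) (F j) 0 = fact v * (\<beta> $ j / p $ j)"
      by (rule higher_deriv_leading_coefficient[OF holF R0])
    then have coeff: "(deriv ^^ v) (F j) 0 / fact v = \<beta> $ j / p $ j" by simp
    have "F j 0 = 0" using False f0 by (simp add: F_def)
    from holomorphic_average[OF holF R0 this v, unfolded coeff] obtain C''
      where "order_bound (\<lambda>s. X j s - \<beta> $ j / p $ j / 2 * s ^ v) C'' m"
      unfolding X_def w_def .
    then show ?thesis by blast
  qed simp
  then obtain C2 where C2: "\<And>j. p $ j \<noteq> 0 \<Longrightarrow> order_bound (\<lambda>s. X j s - \<beta> $ j / p $ j / 2 * s ^ v) (C2 j) m"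
    by metis
  have "\<forall>\<^sub>F s in nhds 0. p $ j \<noteq> 0 \<longrightarrow> cmod (X j s - \<beta> $ j / p $ j / 2 * s ^ v) \<le> C2 j * cmod s ^ m" for j
    using C2[of j] by (cases "p $ j = 0") auto
  then have ev5: "\<forall>\<^sub>F s in nhds 0. \<forall>j. p $ j \<noteq> 0 \<longrightarrow> cmod (X j s - \<beta> $ j / p $ j / 2 * s ^ v) \<le> C2 j * cmod s ^ m"
    by (rule eventually_all_finite)

  \<comment> \<open>Half of the leading coefficient leaves room for the error of order v +
    1.\<close>
  have "\<forall>\<^sub>F z in nhds 0. p $ j = 0 \<longrightarrow> cmod (\<beta> $ j) / 2 * cmod z ^ v \<le> cmod (f z $ j)" for j
  proof (cases "\<beta> $ j = 0")
    case False
    obtain C where C: "order_bound (\<lambda>z. f z $ j - p $ j - \<beta> $ j * z ^ v) C (Suc v)"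
      using expansion by blast
    have "((\<lambda>z. C * cmod z) \<longlongrightarrow> C * cmod 0) (nhds 0)"
      by (intro tendsto_intros filterlim_ident)
    then have "\<forall>\<^sub>F z in nhds 0. C * cmod z < cmod (\<beta> $ j) / 2"
      by (rule order_tendstoD) (use False in simp)
    with C show ?thesis
    proof eventually_elim
      case (elim z)
      show ?case
      proof
        assume pj: "p $ j = 0"
        have "cmod (\<beta> $ j * z ^ v) \<le> cmod (f z $ j) + cmod (f z $ j - \<beta> $ j * z ^ v)"
          using norm_triangle_sub[of "\<beta> $ j * z ^ v" "f z $ j"] by (simp add: norm_minus_commute)
        also have "cmod (f z $ j - \<beta> $ j * z ^ v) \<le> C * cmod z * cmod z ^ v"
          using elim(1) pj by (simp add: mult.assoc)
        also have "\<dots> \<le> cmod (\<beta> $ j) / 2 * cmod z ^ v"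
          using elim(2) by (intro mult_right_mono) auto
        finally show "cmod (\<beta> $ j) / 2 * cmod z ^ v \<le> cmod (f z $ j)"
          by (simp add: norm_mult norm_power)
      qed
    qed
  qed simp
  then have ev6: "\<forall>\<^sub>F z in nhds 0. \<forall>j. p $ j = 0 \<longrightarrow> cmod (\<beta> $ j) / 2 * cmod z ^ v \<le> cmod (f z $ j)"
    by (rule eventually_all_finite)

  from ev4 ev6 have "\<forall>\<^sub>F z in nhds 0. (z \<noteq> 0 \<longrightarrow> \<Psi> z \<in> \<Omega> \<and> log_near p H (\<Psi> z))
      \<and> (\<forall>j. p $ j = 0 \<longrightarrow> cmod (\<beta> $ j) / 2 * cmod z ^ v \<le> cmod (f z $ j))"
    by eventually_elim auto
  then obtain r2 where r2: "0 < r2"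
    "\<And>z. cmod z < r2 \<Longrightarrow> z \<noteq> 0 \<Longrightarrow> \<Psi> z \<in> \<Omega> \<and> log_near p H (\<Psi> z)"
    "\<And>z j. cmod z < r2 \<Longrightarrow> p $ j = 0 \<Longrightarrow> cmod (\<beta> $ j) / 2 * cmod z ^ v \<le> cmod (f z $ j)"
    unfolding eventually_nhds_0 by blast

  note sum_l = sum_fejer_weight_1[OF v]
  \<comment> \<open>In modulus W s is the geometric mean of the points \<Psi> (s w^k) where p_j
    \<noteq> 0; the shift passes through the mean because c depends only on |s|. Where p_j = 0 it
    agrees with g (s^v) and lies below the mean.\<close>
  define W where "W = (\<lambda>s. \<chi> j. if p $ j = 0 then \<beta> $ j * s ^ v / 2
     else p $ j * exp (X j s - of_real (c s * ?e $ j)))"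
  have W_closure: "W s \<in> closure \<Omega>" if s: "cmod s < r2" "s \<noteq> 0" for s
  proof (rule log_convex_nearD[OF convexity, of "{..<m + v}" ?l "\<lambda>k. \<Psi> (s * w ^ k)"])
    have norm: "cmod (s * w ^ k) = cmod s" for k by (simp add: w_def norm_mult norm_power)
    have ck: "c (s * w ^ k) = c s" for k by (simp only: c_def norm)
    show "\<Psi> (s * w ^ k) \<in> \<Omega> \<and> log_near p H (\<Psi> (s * w ^ k))" for k
      using r2(2)[of "s * w ^ k"] s norm by (metis norm_eq_zero)
    then have near: "log_near p H (\<Psi> (s * w ^ k))" for k by blast
    show "W s $ j \<noteq> 0 \<and> ln (cmod (W s $ j / p $ j)) = (\<Sum>k<m + v. ?l k * ln (cmod (\<Psi> (s * w ^ k) $ j / p $ j)))"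
      if j: "p $ j \<noteq> 0" for j
    proof -
      have "ln (cmod (\<Psi> (s * w ^ k) $ j / p $ j)) = Re (F j (s * w ^ k)) - c s * ?e $ j" for k
      proof -
        have "f (s * w ^ k) $ j \<noteq> 0"
          using near[of k, unfolded log_near_def, rule_format, of j] j by (simp add: \<Psi>_def)
        then show ?thesis
          using j by (simp add: \<Psi>_def ck F_def norm_mult norm_divide ln_mult ln_div)
      qed
      then have "(\<Sum>k<m + v. ?l k * ln (cmod (\<Psi> (s * w ^ k) $ j / p $ j)))
        = (\<Sum>k<m + v. ?l k * Re (F j (s * w ^ k))) - (\<Sum>k<m + v. ?l k) * (c s * ?e $ j)"
        by (simp only: right_diff_distrib sum_subtractf sum_distrib_right)
      then show ?thesis
        using j by (simp add: sum_l W_def X_def)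
    qed
    show "W s $ j = 0 \<or> (\<forall>k\<in>{..<m + v}. \<Psi> (s * w ^ k) $ j \<noteq> 0)
       \<and> ln (cmod (W s $ j)) \<le> (\<Sum>k<m + v. ?l k * ln (cmod (\<Psi> (s * w ^ k) $ j)))"
      if j: "p $ j = 0" for j
    proof (cases "\<beta> $ j = 0")
      case True
      then show ?thesis using j by (simp add: W_def)
    next
      case False
      have \<Psi>j: "\<Psi> (s * w ^ k) $ j = f (s * w ^ k) $ j" for k
        using e0[OF j] by (simp add: \<Psi>_def)
      have Wj: "cmod (W s $ j) = cmod (\<beta> $ j) / 2 * cmod s ^ v"
        using j by (simp add: W_def norm_mult norm_divide norm_power)
      have low: "cmod (W s $ j) \<le> cmod (f (s * w ^ k) $ j)" for k
        using r2(3)[of "s * w ^ k" j] s(1) j unfolding norm Wj by blast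
      have Wpos: "0 < cmod (W s $ j)" unfolding Wj using False s(2) by simp
      have "(\<Sum>k<m + v. ?l k * ln (cmod (W s $ j))) \<le> (\<Sum>k<m + v. ?l k * ln (cmod (\<Psi> (s * w ^ k) $ j)))"
      proof (intro sum_mono mult_left_mono fejer_weight_nonneg)
        fix k
        show "ln (cmod (W s $ j)) \<le> ln (cmod (\<Psi> (s * w ^ k) $ j))"
          unfolding \<Psi>j using low[of k] Wpos by (subst ln_le_cancel_iff) auto
      qed
      then have "ln (cmod (W s $ j)) \<le> (\<Sum>k<m + v. ?l k * ln (cmod (\<Psi> (s * w ^ k) $ j)))"
        using sum_l by (simp flip: sum_distrib_right)
      moreover have "\<Psi> (s * w ^ k) $ j \<noteq> 0" for k
        unfolding \<Psi>j using low[of k] Wpos by auto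
      ultimately show ?thesis by blast
    qed
  qed (use sum_l fejer_weight_nonneg in auto)

  \<comment> \<open>C3 collects the averaging error and the inward shift, both of size |s|^m; C4
    also includes the Lipschitz constant exp 1 of \<open>exp\<close> on the unit disc.\<close>
  define C3 where "C3 = (\<lambda>j. \<bar>C2 j\<bar> + (C1 + 1) / \<kappa> * \<bar>?e $ j\<bar>)"
  have C3: "0 \<le> C3 j" for j using C1(1) pos by (simp add: C3_def)
  define C4 where "C4 = (\<Sum>j\<in>UNIV. cmod (p $ j) * (exp 1 * C3 j))"
  have C4: "0 \<le> C4" unfolding C4_def using C3 by (intro sum_nonneg mult_nonneg_nonneg) auto
  \<comment> \<open>For p_j = 0 the quotient \<beta>_j / p_j is 0, so no case distinction
    arises.\<close>
  have "\<forall>\<^sub>F s in nhds 0. cmod (\<beta> $ j / p $ j / 2 * s ^ v) < 1 / 2 \<and> C3 j * cmod s ^ m < 1 / 2" for j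
  proof -
    have "((\<lambda>s. cmod (\<beta> $ j / p $ j / 2 * s ^ v)) \<longlongrightarrow> cmod (\<beta> $ j / p $ j / 2 * 0 ^ v)) (nhds 0)"
      "((\<lambda>s :: complex. C3 j * cmod s ^ m) \<longlongrightarrow> C3 j * cmod 0 ^ m) (nhds 0)"
      by (intro tendsto_intros filterlim_ident; simp)+
    from order_tendstoD(2)[OF this(1), of "1 / 2"] order_tendstoD(2)[OF this(2), of "1 / 2"] v
    show ?thesis by (simp add: zero_power eventually_conj)
  qed
  then have "\<forall>\<^sub>F s in nhds 0. \<forall>j. cmod (\<beta> $ j / p $ j / 2 * s ^ v) < 1 / 2 \<and> C3 j * cmod s ^ m < 1 / 2"
    by (rule eventually_all_finite)
  with ev5 have close: "\<forall>\<^sub>F s in nhds 0. norm (?g (s ^ v) - W s) \<le> C4 * cmod s ^ m"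
  proof eventually_elim
    case (elim s)
    have "cmod ((?g (s ^ v) - W s) $ j) \<le> cmod (p $ j) * (exp 1 * C3 j) * cmod s ^ m" for j
    proof (cases "p $ j = 0")
      case True
      then show ?thesis by (simp add: exp_disc_def W_def)
    next
      case False
      define A where "A = \<beta> $ j / p $ j / 2 * s ^ v"
      define B where "B = X j s - of_real (c s * ?e $ j)"
      have "cmod (A - B) \<le> cmod (X j s - A) + cmod (of_real (c s * ?e $ j))"
        using norm_triangle_ineq[of "A - X j s" "of_real (c s * ?e $ j)"]
        by (simp add: B_def norm_minus_commute algebra_simps)
      also have "\<dots> \<le> \<bar>C2 j\<bar> * cmod s ^ m + (C1 + 1) / \<kappa> * \<bar>?e $ j\<bar> * cmod s ^ m"
      proof (rule add_mono)
        have "cmod (X j s - A) \<le> C2 j * cmod s ^ m" using elim(1) False by (simp add: A_def)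
        also have "\<dots> \<le> \<bar>C2 j\<bar> * cmod s ^ m" by (intro mult_right_mono) auto
        finally show "cmod (X j s - A) \<le> \<bar>C2 j\<bar> * cmod s ^ m" .
        show "cmod (of_real (c s * ?e $ j)) \<le> (C1 + 1) / \<kappa> * \<bar>?e $ j\<bar> * cmod s ^ m"
          unfolding norm_of_real abs_mult abs_of_nonneg[OF c0] by (simp add: c_def mult_ac)
      qed
      finally have AB: "cmod (A - B) \<le> C3 j * cmod s ^ m"
        by (simp add: C3_def distrib_right)
      have "cmod A < 1 / 2" "C3 j * cmod s ^ m < 1 / 2" using elim(2) by (auto simp: A_def)
      moreover from this have "cmod B \<le> 1"
        using AB norm_triangle_sub[of B A] by (simp add: norm_minus_commute)
      ultimately have "cmod (exp A - exp B) \<le> exp 1 * cmod (A - B)"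
        by (intro exp_lipschitz_unit_ball) auto
      also have "\<dots> \<le> exp 1 * (C3 j * cmod s ^ m)"
        using AB by (intro mult_left_mono) auto
      finally have "cmod (exp A - exp B) \<le> exp 1 * (C3 j * cmod s ^ m)" .
      moreover have "(?g (s ^ v) - W s) $ j = p $ j * (exp A - exp B)"
        using False by (simp add: exp_disc_def W_def A_def B_def right_diff_distrib)
      ultimately show ?thesis
        by (simp add: norm_mult mult.assoc mult_left_mono)
    qed
    then have "(\<Sum>j\<in>UNIV. cmod ((?g (s ^ v) - W s) $ j)) \<le> (\<Sum>j\<in>UNIV. cmod (p $ j) * (exp 1 * C3 j) * cmod s ^ m)"
      by (intro sum_mono)
    then show ?case
      using norm_le_sum_components[of "?g (s ^ v) - W s"] by (simp add: C4_def sum_distrib_right)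
  qed

  have contg: "((\<lambda>s. ?g (s ^ v)) \<longlongrightarrow> p) (nhds 0)"
  proof -
    have "continuous_on UNIV ?g"
      by (rule Ck_on_continuous[OF Ck_on_holomorphic_vec[OF open_UNIV holomorphic_exp_disc]])
    then have "continuous_on UNIV (\<lambda>s. ?g (s ^ v))"
      by (rule continuous_on_compose2) (auto intro!: continuous_intros)
    then have "isCont (\<lambda>s. ?g (s ^ v)) 0" by (simp add: continuous_on_eq_continuous_at)
    from isCont_tendsto_nhds[OF this] v show ?thesis by (simp add: zero_power)
  qed
  have ev7: "\<forall>\<^sub>F s in nhds 0. ?g (s ^ v) \<in> ball p (EL / 2)"
    using contg by (rule topological_tendstoD) (use L(1) in auto)
  have "((\<lambda>s :: complex. C4 * cmod s ^ m) \<longlongrightarrow> C4 * cmod 0 ^ m) (nhds 0)"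
    by (intro tendsto_intros filterlim_ident)
  then have ev8: "\<forall>\<^sub>F s in nhds 0. C4 * cmod (s :: complex) ^ m < EL / 2"
    by (rule order_tendstoD) (use v L(1) in \<open>simp add: zero_power\<close>)
  have ev9: "\<forall>\<^sub>F s in nhds 0. 0 \<le> \<rho> (?g (s ^ v))"
  proof -
    have "((\<lambda>s :: complex. s ^ v) \<longlongrightarrow> 0 ^ v) (nhds 0)" by (intro tendsto_intros filterlim_ident)
    then have "filterlim (\<lambda>s :: complex. s ^ v) (nhds 0) (nhds 0)" using v by (simp add: zero_power)
    then show ?thesis using eventually_compose_filterlim[OF nonneg] by blast
  qed
  have ev10: "\<forall>\<^sub>F s in nhds 0. cmod s < r2"
    unfolding eventually_nhds_0 using r2(1) by blast
  \<comment> \<open>The upper bound compares with \<rho> (W s) \<le> 0, and \<open>ev9\<close> gives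
    the sign. The case s = 0 is separate because W s is known to lie in the closure for s \<noteq>
    0.\<close>
  have "\<forall>\<^sub>F s in nhds 0. \<bar>\<rho> (?g (s ^ v))\<bar> \<le> L * C4 * cmod s ^ m"
    using close ev7 ev8 ev9 ev10
  proof eventually_elim
    case (elim s)
    show ?case
    proof (cases "s = 0")
      case True
      then show ?thesis using v U(4) by (simp add: zero_power)
    next
      case False
      have "norm (p - W s) \<le> norm (p - ?g (s ^ v)) + norm (?g (s ^ v) - W s)"
        using norm_triangle_ineq[of "p - ?g (s ^ v)" "?g (s ^ v) - W s"] by simp
      also have "\<dots> < EL" using elim(1-3) by (simp add: dist_norm)
      finally have WL: "W s \<in> ball p EL" by (simp add: dist_norm)
      have gL: "?g (s ^ v) \<in> ball p EL" using elim(2) L(1) by simp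
      have "\<rho> (W s) \<le> 0"
        using defining_function_closure[OF def W_closure[OF elim(5) False]] .
      then have "\<rho> (?g (s ^ v)) \<le> \<bar>\<rho> (?g (s ^ v)) - \<rho> (W s)\<bar>" by linarith
      also have "\<dots> \<le> L * norm (?g (s ^ v) - W s)" using L(3)[OF gL WL] .
      also have "\<dots> \<le> L * (C4 * cmod s ^ m)" using elim(1) L(2) by (rule mult_left_mono)
      finally show ?thesis using elim(4) by (simp add: mult.assoc)
    qed
  qed
  then obtain r where r: "0 < r" "\<And>s. cmod s < r \<Longrightarrow> \<bar>\<rho> (?g (s ^ v))\<bar> \<le> L * C4 * cmod s ^ m"
    unfolding eventually_nhds_0 by blast
  obtain S where S: "open S" "0 \<in> S" "smooth_on S (\<rho> \<circ> ?g)"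
    by (rule analytic_disc_smooth[OF _ U(1) pU U(3), of ?g]) (use regular_exp_disc[OF \<beta>] in \<open>auto simp: regular_disc_def\<close>)
  show ?thesis
  proof (rule bound_imp_smooth_order[OF S v(1)])
    show "0 < r ^ v" using r(1) by simp
    fix z :: complex assume z: "cmod z < r ^ v"
    \<comment> \<open>A v-th root turns the bound in |s| into one in |z| for the v-th power of
      |\<rho> o g|.\<close>
    obtain s where s: "s ^ v = z" using exists_complex_root[of v z] v(1) by auto
    have nz: "cmod s ^ v = cmod z" using s by (simp flip: norm_power)
    then have "cmod s < r"
      using z r(1) power_less_imp_less_base[of "cmod s" v r] by simp
    then have "\<bar>(\<rho> \<circ> ?g) z\<bar> ^ v \<le> (L * C4 * cmod s ^ m) ^ v"
      using r(2)[of s] s by (intro power_mono) auto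
    also have "\<dots> = (L * C4) ^ v * cmod z ^ m"
      unfolding power_mult_distrib nz[symmetric] by (simp add: power_mult[symmetric] mult.commute)
    finally show "\<bar>(\<rho> \<circ> ?g) z\<bar> ^ v \<le> (L * C4) ^ v * cmod z ^ m" .
  qed
qed

text \<open>For m \<le> v it is enough that \<rho> o g vanishes at 0. Only m > v makes the leading
  direction tangent and calls for the averaging argument.\<close>

lemma regular_disc_of_contact:
  assumes \<Omega>: "open \<Omega>" and pc: "pseudoconvex \<Omega>" and R: "reinhardt \<Omega>"
    and def: "smooth_defining_function \<Omega> \<rho>" and p: "p \<in> frontier \<Omega>"
    and f: "analytic_disc p f" "disc_order f = enat v" and order: "enat m \<le> smooth_order (\<rho> \<circ> f)"
  obtains g where "regular_disc p g" "enat m \<le> enat v * smooth_order (\<rho> \<circ> g)"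
proof -
  obtain v' \<beta> where v': "0 < v'" "disc_order f = enat v'" and \<beta>: "\<beta> \<noteq> 0"
    and expansion: "\<And>j. \<exists>C. order_bound (\<lambda>z. f z $ j - p $ j - \<beta> $ j * z ^ v') C (Suc v')"
    using disc_order_expansion[OF f(1)] by blast
  have [simp]: "v' = v" using v'(2) f(2) by simp
  have "enat m \<le> enat v * smooth_order (\<rho> \<circ> exp_disc p \<beta>)"
  proof (cases "v < m")
    case True
    then show ?thesis
      using exp_disc_of_high_contact[OF \<Omega> pc R def p f(1) _ True \<beta>] v'(1) expansion order by simp
  next
    case False
    have "\<rho> p = 0" using def p by (simp add: smooth_defining_function_def)
    then have "enat 1 \<le> smooth_order (\<rho> \<circ> exp_disc p \<beta>)"
      by (intro one_le_smooth_order) simp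
    then have "enat v * enat 1 \<le> enat v * smooth_order (\<rho> \<circ> exp_disc p \<beta>)"
      by (rule mult_left_mono) simp
    moreover have "enat m \<le> enat v * enat 1" using False by simp
    ultimately show ?thesis by (rule order_trans[rotated])
  qed
  then show ?thesis using that regular_exp_disc[OF \<beta>] by blast
qed

theorem theorem4:
  fixes \<Omega> :: "(complex ^ 'n) set" and \<rho> :: "complex ^ 'n \<Rightarrow> real" and p :: "complex ^ 'n"
  assumes "smoothly_bounded_domain \<Omega>"
    and "pseudoconvex \<Omega>"
    and "reinhardt \<Omega>"
    and "smooth_defining_function \<Omega> \<rho>"
    and "p \<in> frontier \<Omega>"
  shows "variety_type \<rho> p = regular_type \<rho> p"
proof (rule antisym)
  have \<Omega>: "open \<Omega>" using assms(1) by (simp add: smoothly_bounded_domain_def)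
  show "regular_type \<rho> p \<le> variety_type \<rho> p"
    unfolding regular_type_def variety_type_def
    by (rule SUP_subset_mono) (auto simp: regular_disc_def)
  show "variety_type \<rho> p \<le> regular_type \<rho> p"
    unfolding variety_type_def
  proof (rule SUP_least)
    fix f assume "f \<in> {f. analytic_disc p f}"
    then have f: "analytic_disc p f" by simp
    obtain v where v: "0 < v" "disc_order f = enat v"
      using disc_order_expansion[OF f] by metis
    \<comment> \<open>Comparing finite lower bounds m of the order, rather than the order itself,
      lets the infinite case follow from the multiples m = v n.\<close>
    have le: "ereal (real m / real v) \<le> regular_type \<rho> p" if m: "enat m \<le> smooth_order (\<rho> \<circ> f)" for m
    proof -
      obtain g where g: "regular_disc p g" "enat m \<le> enat v * smooth_order (\<rho> \<circ> g)"
        using regular_disc_of_contact[OF \<Omega> assms(2-5) f v(2) m] .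
      have "ereal (real m / real v) \<le> contact_ratio \<rho> g"
      proof (cases "smooth_order (\<rho> \<circ> g)")
        case (enat k)
        then have "m \<le> v * k" using g(2) by simp
        then have "real m \<le> real v * real k" by (metis of_nat_le_iff of_nat_mult)
        then show ?thesis
          using v(1) enat by (simp add: contact_ratio_def regular_disc_order[OF g(1)] field_simps)
      next
        case infinity
        then show ?thesis by (simp add: contact_ratio_def regular_disc_order[OF g(1)])
      qed
      also have "\<dots> \<le> regular_type \<rho> p"
        unfolding regular_type_def using g(1) by (intro SUP_upper) simp
      finally show ?thesis .
    qed
    show "contact_ratio \<rho> f \<le> regular_type \<rho> p"
    proof (cases "smooth_order (\<rho> \<circ> f)")
      case (enat k)
      then show ?thesis using le[of k] v by (simp add: contact_ratio_def)
    next
      case infinity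
      have "regular_type \<rho> p = \<infinity>"
      proof (rule ereal_top)
        fix B
        obtain n where n: "B \<le> real n" using real_arch_simple by blast
        have "ereal (real (v * n) / real v) \<le> regular_type \<rho> p"
          using infinity by (intro le) simp
        then show "ereal B \<le> regular_type \<rho> p"
          using n v(1) order_trans[of "ereal B" "ereal (real n)"] by simp
      qed
      then show ?thesis by simp
    qed
  qed
qed

end
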